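(* Let $\alpha>1/2$, $d\in\mathbb{N}$, $\tau>0$, let $R>1$ be an odd integer, let $(\gamma_j)_{j\ge1}$ be a non-increasing sequence with $\gamma_j\in(0,1]$, let $N$ be an odd prime, sufficiently large that $N_2>1$, and let $$\varepsilon_2:=\frac{|\mathcal{A}_{d,\alpha,\boldsymbol{\gamma}}(N_2)|}{2}\left(\frac{8}{1+\tau\log N_2}\right)^{\lceil R/2\rceil}.$$ Then, with probability at least $1-\varepsilon_2$ over the random generating vectors $\boldsymbol{z}_1,\dots,\boldsymbol{z}_R$, $$\mathrm{err}\bigl(\mathcal{H}_{d,\alpha,\boldsymbol{\gamma}},L_2,A_{N,\boldsymbol{z}_{\{1:R\}},\mathcal{A}_{d,\alpha,\boldsymbol{\gamma}}(N_2)}\bigr)\le C_{d,\alpha}\,\frac{(1+\log_2N_2)^{\frac{d-1}{2}}}{N_2^{\alpha}},$$ where $C_{d,\alpha}>0$ is a constant independent of $N$ and $N_2$ but dependent on $d$ and $\alpha$.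
   Context: Weights and frequency function: for $\boldsymbol{h}=(h_1,\dots,h_d)\in\mathbb{Z}^d$ let $\mathrm{supp}(\boldsymbol{h})=\{j\in\{1,\dots,d\}: h_j\ne0\}$. With product weights $\gamma_{\mathfrak u}=\prod_{j\in\mathfrak u}\gamma_j$, $\gamma_\emptyset=1$, set $r_{2\alpha,\boldsymbol{\gamma}}(\boldsymbol{h})=\gamma_{\mathrm{supp}(\boldsymbol{h})}^{-1}\prod_{j\in\mathrm{supp}(\boldsymbol{h})}|h_j|^{2\alpha}$, so $r_{2\alpha,\boldsymbol{\gamma}}(\boldsymbol{0})=1$. For real $L\ge0$ let $\mathcal{A}_{d,\alpha,\boldsymbol{\gamma}}(L)=\{\boldsymbol{h}\in\mathbb{Z}^d: r_{2\alpha,\boldsymbol{\gamma}}(\boldsymbol{h})<L^{2\alpha}\}$. Korobov space: for $f\in L_2([0,1]^d)$ let $\widehat f(\boldsymbol{h})=\int_{[0,1]^d}f(\boldsymbol{x})e^{-2\pi \mathtt{i}\,\boldsymbol{h}\cdot\boldsymbol{x}}\,\mathrm{d}\boldsymbol{x}$. The weighted periodic Korobov space $\mathcal{H}_{d,\alpha,\boldsymbol{\gamma}}$ consists of all $f:[0,1]^d\to\mathbb{R}$ in $L_2([0,1]^d)$ with $\|f\|_{d,\alpha,\boldsymbol{\gamma}}^2:=\sum_{\boldsymbol{h}\in\mathbb{Z}^d}|\widehat f(\boldsymbol{h})|^2r_{2\alpha,\boldsymbol{\gamma}}(\boldsymbol{h})<\infty$ (for $\alpha>1/2$ its elements are bounded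 and continuous). For a map $A:\mathcal{H}_{d,\alpha,\boldsymbol{\gamma}}\to L_2([0,1]^d)$, the worst-case $L_2$ error is $\mathrm{err}(\mathcal{H}_{d,\alpha,\boldsymbol{\gamma}},L_2,A)=\sup\{\|f-A(f)\|_{L_2}: f\in\mathcal{H}_{d,\alpha,\boldsymbol{\gamma}},\ \|f\|_{d,\alpha,\boldsymbol{\gamma}}\le1\}$. Threshold: $P_{N,d}(\tau,\alpha,\boldsymbol{\gamma})=\prod_{j=1}^d\bigl(1+2\gamma_j^{1/(2\alpha)}(1+\tau\log N)\bigr)$ and $N_2=\dfrac{N-1}{\exp(\tau^{-1})\,P_{N,d}(\tau,\alpha,\boldsymbol{\gamma})}$. Median: for odd $R$ and complex $Z_1,\dots,Z_R$, $\mathrm{median}_{r}(Z_r)=\mathrm{median}_r\Re(Z_r)+\mathtt{i}\cdot\mathrm{median}_r\Im(Z_r)$. Median lattice algorithm: draw $\boldsymbol{z}_1,\dots,\boldsymbol{z}_R$ independently and uniformly from $\{1,\dots,N-1\}^d$. For $\boldsymbol{h}\in\mathcal{A}_{d,\alpha,\boldsymbol{\gamma}}(N_2)$ put $\widehat f_{N,\boldsymbol{z}_r}(\boldsymbol{h})=\frac1N\sum_{k=0}^{N-1}f(\{k\boldsymbol{z}_r/N\})\exp(-2\pi\mathtt{i}\,\boldsymbol{h}\cdot(k\boldsymbol{z}_r/N))$, where $\{\cdot\}$ is the componentwise fractional part, and $\widehat f_{N,\boldsymbol{z}_{\{1:R\}}}(\boldsymbol{h})=\mathrm{median}_{r\in\{1,\dots,R\}}\bigl(\widehat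 f_{N,\boldsymbol{z}_r}(\boldsymbol{h})\bigr)$. The output is $(A_{N,\boldsymbol{z}_{\{1:R\}},\mathcal{A}_{d,\alpha,\boldsymbol{\gamma}}(N_2)}(f))(\boldsymbol{x})=\sum_{\boldsymbol{h}\in\mathcal{A}_{d,\alpha,\boldsymbol{\gamma}}(N_2)}\widehat f_{N,\boldsymbol{z}_{\{1:R\}}}(\boldsymbol{h})\exp(2\pi\mathtt{i}\,\boldsymbol{h}\cdot\boldsymbol{x})$. *)

theory Defs
  imports "HOL-Probability.Probability"
begin

section \<open>The unit cube and integer frequencies\<close>

text \<open>
  Vectors indexed by \<open>1, \<dots>, d\<close> are functions on \<open>nat\<close> that are \<open>undefined\<close> outside
  \<open>{1..d}\<close>. The carrier of \<open>cube d\<close> is \<open>{1..d} \<rightarrow>\<^sub>E {0..1}\<close>.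
\<close>

definition cube :: "nat \<Rightarrow> (nat \<Rightarrow> real) measure" where
  "cube d = Pi\<^sub>M {1..d} (\<lambda>_. restrict_space lborel {0..1})"

definition int_vecs :: "nat \<Rightarrow> (nat \<Rightarrow> int) set" where
  "int_vecs d = {1..d} \<rightarrow>\<^sub>E UNIV"

definition supp :: "nat \<Rightarrow> (nat \<Rightarrow> int) \<Rightarrow> nat set" where
  "supp d h = {j \<in> {1..d}. h j \<noteq> 0}"

definition weight :: "(nat \<Rightarrow> real) \<Rightarrow> nat set \<Rightarrow> real" where
  "weight \<gamma> u = (\<Prod>j\<in>u. \<gamma> j)"

definition freq_fun :: "nat \<Rightarrow> real \<Rightarrow> (nat \<Rightarrow> real) \<Rightarrow> (nat \<Rightarrow> int) \<Rightarrow> real" where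
  "freq_fun d \<alpha> \<gamma> h =
     inverse (weight \<gamma> (supp d h)) * (\<Prod>j\<in>supp d h. \<bar>real_of_int (h j)\<bar> powr (2 * \<alpha>))"

definition freq_set :: "nat \<Rightarrow> real \<Rightarrow> (nat \<Rightarrow> real) \<Rightarrow> real \<Rightarrow> (nat \<Rightarrow> int) set" where
  "freq_set d \<alpha> \<gamma> L = {h \<in> int_vecs d. freq_fun d \<alpha> \<gamma> h < L powr (2 * \<alpha>)}"

definition dot :: "nat \<Rightarrow> (nat \<Rightarrow> int) \<Rightarrow> (nat \<Rightarrow> real) \<Rightarrow> real" where
  "dot d h x = (\<Sum>j=1..d. real_of_int (h j) * x j)"

section \<open>The weighted periodic Korobov space\<close>

definition fourier_coeff :: "nat \<Rightarrow> ((nat \<Rightarrow> real) \<Rightarrow> real) \<Rightarrow> (nat \<Rightarrow> int) \<Rightarrow> complex" where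
  "fourier_coeff d f h =
     (\<integral>x. of_real (f x) * exp (- 2 * of_real pi * \<i> * of_real (dot d h x)) \<partial>cube d)"

text \<open>
  For \<open>\<alpha> > 1/2\<close> the Fourier series of an element converges absolutely and uniformly, and the
  space consists of continuous functions. As the algorithm uses point values, an element has to be
  the continuous representative of its class in \<open>L\<^sub>2\<close>; this is the continuity requirement below.
  Periodicity need not be demanded: a function continuous on the closed cube with absolutely
  summable Fourier coefficients equals its (periodic) Fourier series everywhere on the cube.
\<close>

definition korobov :: "nat \<Rightarrow> real \<Rightarrow> (nat \<Rightarrow> real) \<Rightarrow> ((nat \<Rightarrow> real) \<Rightarrow> real) set" where
  "korobov d \<alpha> \<gamma> =
     {f. f \<in> borel_measurable (cube d) \<and>
         integrable (cube d) (\<lambda>x. (f x)\<^sup>2) \<and>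
         continuous_on (space (cube d)) f \<and>
         (\<lambda>h. (cmod (fourier_coeff d f h))\<^sup>2 * freq_fun d \<alpha> \<gamma> h) summable_on int_vecs d}"

definition korobov_norm ::
    "nat \<Rightarrow> real \<Rightarrow> (nat \<Rightarrow> real) \<Rightarrow> ((nat \<Rightarrow> real) \<Rightarrow> real) \<Rightarrow> real" where
  "korobov_norm d \<alpha> \<gamma> f =
     sqrt (\<Sum>\<^sub>\<infinity>h\<in>int_vecs d. (cmod (fourier_coeff d f h))\<^sup>2 * freq_fun d \<alpha> \<gamma> h)"

definition L2_cube_norm :: "nat \<Rightarrow> ((nat \<Rightarrow> real) \<Rightarrow> complex) \<Rightarrow> real" where
  "L2_cube_norm d g = sqrt (\<integral>x. (cmod (g x))\<^sup>2 \<partial>cube d)"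

text \<open>
  The supremum is taken in the extended reals, so it is \<open>\<infinity>\<close> when the errors are unbounded.
\<close>

definition wc_err :: "nat \<Rightarrow> real \<Rightarrow> (nat \<Rightarrow> real) \<Rightarrow>
    (((nat \<Rightarrow> real) \<Rightarrow> real) \<Rightarrow> ((nat \<Rightarrow> real) \<Rightarrow> complex)) \<Rightarrow> ereal" where
  "wc_err d \<alpha> \<gamma> A =
     (SUP f \<in> {f \<in> korobov d \<alpha> \<gamma>. korobov_norm d \<alpha> \<gamma> f \<le> 1}.
        ereal (L2_cube_norm d (\<lambda>x. of_real (f x) - A f x)))"

section \<open>The median lattice algorithm\<close>

definition P_bound :: "nat \<Rightarrow> nat \<Rightarrow> real \<Rightarrow> real \<Rightarrow> (nat \<Rightarrow> real) \<Rightarrow> real" where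
  "P_bound N d \<tau> \<alpha> \<gamma> = (\<Prod>j=1..d. (1 + 2 * \<gamma> j powr (1 / (2 * \<alpha>)) * (1 + \<tau> * ln (real N))))"

definition N2 :: "nat \<Rightarrow> nat \<Rightarrow> real \<Rightarrow> real \<Rightarrow> (nat \<Rightarrow> real) \<Rightarrow> real" where
  "N2 N d \<tau> \<alpha> \<gamma> = (real N - 1) / (exp (1 / \<tau>) * P_bound N d \<tau> \<alpha> \<gamma>)"

text \<open>The median of \<open>Z 1, \<dots>, Z R\<close> for odd \<open>R\<close>; list positions start at \<open>0\<close>.\<close>

definition median_real :: "nat \<Rightarrow> (nat \<Rightarrow> real) \<Rightarrow> real" where
  "median_real R Z = sort (map Z [1..<R + 1]) ! (R div 2)"

definition median_complex :: "nat \<Rightarrow> (nat \<Rightarrow> complex) \<Rightarrow> complex" where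
  "median_complex R Z =
     Complex (median_real R (\<lambda>r. Re (Z r))) (median_real R (\<lambda>r. Im (Z r)))"

definition lattice_coeff :: "nat \<Rightarrow> nat \<Rightarrow> (nat \<Rightarrow> nat) \<Rightarrow>
    ((nat \<Rightarrow> real) \<Rightarrow> real) \<Rightarrow> (nat \<Rightarrow> int) \<Rightarrow> complex" where
  "lattice_coeff d N z f h =
     1 / of_nat N *
     (\<Sum>k<N. of_real (f (\<lambda>j\<in>{1..d}. frac (real k * real (z j) / real N))) *
       exp (- 2 * of_real pi * \<i> * of_real (dot d h (\<lambda>j. real k * real (z j) / real N))))"

definition median_coeff :: "nat \<Rightarrow> nat \<Rightarrow> nat \<Rightarrow> (nat \<Rightarrow> nat \<Rightarrow> nat) \<Rightarrow>
    ((nat \<Rightarrow> real) \<Rightarrow> real) \<Rightarrow> (nat \<Rightarrow> int) \<Rightarrow> complex" where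
  "median_coeff d N R zs f h = median_complex R (\<lambda>r. lattice_coeff d N (zs r) f h)"

definition median_lattice_alg :: "nat \<Rightarrow> nat \<Rightarrow> nat \<Rightarrow> (nat \<Rightarrow> nat \<Rightarrow> nat) \<Rightarrow>
    (nat \<Rightarrow> int) set \<Rightarrow> ((nat \<Rightarrow> real) \<Rightarrow> real) \<Rightarrow> ((nat \<Rightarrow> real) \<Rightarrow> complex)" where
  "median_lattice_alg d N R zs F f x =
     (\<Sum>h\<in>F. median_coeff d N R zs f h * exp (2 * of_real pi * \<i> * of_real (dot d h x)))"

text \<open>
  Independent uniform draws \<open>zs 1, \<dots>, zs R\<close> from \<open>{1, \<dots>, N - 1}\<^sup>d\<close>; the default value is only
  taken outside \<open>{1..R}\<close>.
\<close>

definition gen_vectors_pmf :: "nat \<Rightarrow> nat \<Rightarrow> nat \<Rightarrow> (nat \<Rightarrow> nat \<Rightarrow> nat) pmf" where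
  "gen_vectors_pmf d N R =
     Pi_pmf {1..R} undefined (\<lambda>_. pmf_of_set ({1..d} \<rightarrow>\<^sub>E {1..N - 1}))"

definition eps2 :: "nat \<Rightarrow> nat \<Rightarrow> nat \<Rightarrow> real \<Rightarrow> real \<Rightarrow> (nat \<Rightarrow> real) \<Rightarrow> real" where
  "eps2 N d R \<tau> \<alpha> \<gamma> =
     real (card (freq_set d \<alpha> \<gamma> (N2 N d \<tau> \<alpha> \<gamma>))) / 2 *
     (8 / (1 + \<tau> * ln (N2 N d \<tau> \<alpha> \<gamma>))) ^ nat \<lceil>real R / 2\<rceil>"

end

theory Submission
  imports Defs
begin

text \<open>
  Write \<open>L\<close> for the threshold, \<open>A\<close> for the frequency set and \<open>u = 1 / (1 + \<tau> ln L)\<close>. For a fixed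
  generating vector call \<open>h \<in> A\<close> good if no other element of \<open>A\<close> is aliased with \<open>h\<close> and the
  aliased frequencies outside \<open>A\<close> have reciprocal weights summing to \<open>O(L powr (-2\<alpha>))\<close>.
  Good frequencies have disjoint alias classes, so by Cauchy-Schwarz the squared errors over all
  good \<open>h\<close> add up to \<open>O(L powr (-2\<alpha>))\<close>, uniformly in \<open>f\<close>. If each \<open>h\<close> is good for
  \<open>t\<close> more draws than a bare majority, then the squared error of the median is at most the sum of
  the squared errors of the good draws divided by \<open>t + 1\<close>, hence the total is
  \<open>O(R / (t + 1) \<sqdot> L powr (-2\<alpha>))\<close>; summing over draws instead of taking the worst one avoids any
  further dependence on \<open>R\<close>.

  With \<open>t\<close> of order \<open>R / (1 + log L)\<close> the factor \<open>R / (t + 1)\<close> is absorbed by the logarithms when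
  \<open>d \<ge> 2\<close>, and for \<open>d = 1\<close> no aliasing is random. The failure probability stays below \<open>\<epsilon>\<^sub>2\<close>
  because a frequency is bad with probability at most \<open>3u/2\<close> rather than \<open>2u\<close>; if \<open>\<tau>\<close> is so large
  that this gain is lost, a random collision needs two differing coordinates, which makes the
  probability \<open>O(L powr (2\<alpha> + 1) / \<tau>\<^sup>2) \<le> u powr (3/2)\<close>.
\<close>

section \<open>Absolutely convergent Fourier series on the cube\<close>

text \<open>The shape of the argument is dictated by uniformity: the constant may depend neither on
  R nor on \<tau>. Put m = (R + 1) / 2 and let q bound the probability that a draw is bad. A bare
  majority (t = 0) already meets the failure probability, but adding the errors over all draws then
  costs a factor R. Asking for t extra good draws turns q^m into q^(m - t), so a spare factor
  exponential in m has to pay for q^(-t). With q = 3u/2 instead of 2u the spare factor is (4/3)^m,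
  which allows t of order m / ln (1/u). As 1/u = 1 + \<tau> ln L, this is of order R / (1 + log L)
  unless \<tau> exceeds a high power of L; in that range q \<le> u^(3/2) supplies the spare factor.

  The threshold is tuned to sums with exponent 1 + e, where e = 1 / (\<tau> ln L): then L^e = exp
  (1/\<tau>), and zeta(1 + e) \<le> 1 + 1/e = 1 + \<tau> ln L is dominated by the logarithmic factor
  in \<open>P_bound\<close>. Counting \<open>A\<close> with this exponent while saving one zeta
  factor gives |A| - 1 \<le> u (N - 1), so a fixed frequency collides inside \<open>A\<close> with
  probability at most u.\<close>

definition unit_exp :: "nat \<Rightarrow> (nat \<Rightarrow> int) \<Rightarrow> (nat \<Rightarrow> real) \<Rightarrow> complex" where
  "unit_exp d h x = exp (2 * of_real pi * \<i> * of_real (dot d h x))"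

lemma unit_exp_cis: "unit_exp d h x = cis (2 * pi * dot d h x)"
  by (simp add: unit_exp_def cis_conv_exp mult_ac)

lemma norm_unit_exp [simp]: "cmod (unit_exp d h x) = 1"
  by (simp add: unit_exp_cis)

lemma unit_exp_prod: "unit_exp d h x = (\<Prod>j\<in>{1..d}. cis (2 * pi * (h j * x j)))"
proof -
  have "cis (\<Sum>j\<in>A. f j) = (\<Prod>j\<in>A. cis (f j))" if "finite A" for A :: "nat set" and f
    using that by (induction A) (auto simp flip: cis_mult)
  from this[of "{1..d}" "\<lambda>j. 2 * pi * (h j * x j)"] show ?thesis
    by (simp add: unit_exp_cis dot_def sum_distrib_left)
qed

lemma unit_exp_add: "unit_exp d (\<lambda>j. h j + k j) x = unit_exp d h x * unit_exp d k x"
  by (simp add: unit_exp_cis dot_def cis_mult ring_distribs sum.distrib)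

lemma unit_exp_diff: "unit_exp d (\<lambda>j. h j - k j) x = unit_exp d h x * cnj (unit_exp d k x)"
  by (simp add: unit_exp_cis dot_def cis_mult cis_cnj ring_distribs sum_subtractf)

lemma fourier_coeff_eq:
  "fourier_coeff d f h = (\<integral>x. of_real (f x) * cnj (unit_exp d h x) \<partial>cube d)"
  by (simp add: fourier_coeff_def unit_exp_def exp_cnj mult_ac)

lemma space_cube: "space (cube d) = {1..d} \<rightarrow>\<^sub>E {0..1}"
  by (simp add: cube_def space_PiM space_restrict_space)

lemma prob_space_unit: "prob_space (restrict_space lborel {0..1::real})"
  by (rule prob_space_restrict_space) auto

lemma product_sigma_finite_unit: "product_sigma_finite (\<lambda>_::nat. restrict_space lborel {0..1::real})"
  by (intro product_sigma_finite.intro prob_space_imp_sigma_finite prob_space_unit)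

lemma prob_space_cube: "prob_space (cube d)"
  unfolding cube_def by (intro prob_space_PiM prob_space_unit)

lemma component_measurable [measurable]:
  assumes "j \<in> {1..d}"
  shows "(\<lambda>x. x j) \<in> borel_measurable (cube d)"
proof -
  have "(\<lambda>x. x j) \<in> cube d \<rightarrow>\<^sub>M restrict_space lborel {0..1}"
    unfolding cube_def by (rule measurable_component_singleton) (use assms in auto)
  moreover have "(\<lambda>x. x) \<in> restrict_space lborel {0..1::real} \<rightarrow>\<^sub>M borel"
    by (rule measurable_restrict_space1) auto
  ultimately show ?thesis by (rule measurable_compose)
qed

lemma unit_exp_measurable [measurable]: "unit_exp d h \<in> borel_measurable (cube d)"
proof -
  have "dot d h \<in> borel_measurable (cube d)"
    unfolding dot_def[abs_def] by measurable
  hence "(\<lambda>x. cis (2 * pi * dot d h x)) \<in> borel_measurable (cube d)"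
    unfolding cis_conv_exp by measurable
  thus ?thesis by (simp add: unit_exp_cis[abs_def])
qed

lemma borel_measurable_cnj [measurable (raw)]:
  "f \<in> borel_measurable M \<Longrightarrow> (\<lambda>x. cnj (f x)) \<in> borel_measurable M"
  by (rule borel_measurable_continuous_on[OF continuous_on_cnj[OF continuous_on_id]])

lemma integrable_bounded_cube:
  assumes "f \<in> borel_measurable (cube d)" "\<And>x. x \<in> space (cube d) \<Longrightarrow> norm (f x) \<le> B"
  shows "integrable (cube d) (f :: _ \<Rightarrow> 'b::{banach, second_countable_topology})"
proof -
  interpret prob_space "cube d" by (rule prob_space_cube)
  show ?thesis by (rule integrable_const_bound[of _ B]) (use assms in auto)
qed

lemma integral_unit_circle:
  fixes n :: int
  shows "(\<integral>x. cis (2 * pi * (n * x)) \<partial>restrict_space lborel {0..1::real}) = (if n = 0 then 1 else 0)"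
proof (cases "n = 0")
  case True
  interpret prob_space "restrict_space lborel {0..1::real}" by (rule prob_space_unit)
  show ?thesis using True prob_space by simp
next
  case False
  have "(\<integral>x. cis (2 * pi * (n * x)) \<partial>restrict_space lborel {0..1::real}) =
        (\<integral>x. indicator {0..1} x *\<^sub>R cis (2 * pi * (n * x)) \<partial>lborel)"
    by (subst integral_restrict_space) (auto simp: set_lebesgue_integral_def)
  also have "\<dots> = cis (2 * pi * (n * (1::real))) / (2 * pi * n * \<i>) - cis (2 * pi * (n * (0::real))) / (2 * pi * n * \<i>)"
  proof (rule integral_FTC_Icc)
    fix x :: real
    show "((\<lambda>x. cis (2 * pi * (n * x)) / (2 * pi * n * \<i>)) has_vector_derivative cis (2 * pi * (n * x))) (at x within {0..1})"
    proof -
      let ?F = "\<lambda>z. exp (2 * pi * n * \<i> * z) / (2 * pi * n * \<i>)"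
      have "(?F has_field_derivative exp (2 * pi * n * \<i> * of_real x)) (at (of_real x))"
        using False by (auto intro!: derivative_eq_intros)
      from has_vector_derivative_real_field[OF this, of "{0..1}"] show ?thesis
        by (simp add: cis_conv_exp mult_ac)
    qed
  next
    show "continuous_on {0..1} (\<lambda>x. cis (2 * pi * (real_of_int n * x)))"
      by (intro continuous_intros)
  qed auto
  also have "cis (2 * pi * (real_of_int n * 1)) = 1"
    using cis_multiple_2pi[of n] by (simp add: mult_ac)
  finally show ?thesis using False by simp
qed

lemma integral_unit_exp:
  "(\<integral>x. unit_exp d h x \<partial>cube d) = (if \<forall>j\<in>{1..d}. h j = 0 then 1 else 0)"
proof -
  have "integrable (restrict_space lborel {0..1::real}) (\<lambda>x. cis (2 * pi * (real_of_int n * x)))" for n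
  proof -
    interpret prob_space "restrict_space lborel {0..1::real}" by (rule prob_space_unit)
    have "(\<lambda>x. cis (2 * pi * (real_of_int n * x))) \<in> borel_measurable borel"
      by (intro borel_measurable_continuous_onI continuous_intros)
    hence "(\<lambda>x. cis (2 * pi * (real_of_int n * x))) \<in> borel_measurable (restrict_space lborel {0..1::real})"
      by (intro measurable_restrict_space1) simp
    thus ?thesis by (intro integrable_const_bound[of _ 1]) auto
  qed
  hence "(\<integral>x. unit_exp d h x \<partial>cube d) =
      (\<Prod>j\<in>{1..d}. \<integral>x. cis (2 * pi * (h j * x)) \<partial>restrict_space lborel {0..1::real})"
    unfolding unit_exp_prod cube_def by (intro product_sigma_finite.product_integral_prod product_sigma_finite_unit) auto
  also have "\<dots> = (if \<forall>j\<in>{1..d}. h j = 0 then 1 else 0)"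
    by (auto simp: integral_unit_circle intro!: prod.neutral)
  finally show ?thesis .
qed

lemma int_vecs_eqI: "h \<in> int_vecs d \<Longrightarrow> k \<in> int_vecs d \<Longrightarrow> (\<And>j. j \<in> {1..d} \<Longrightarrow> h j = k j) \<Longrightarrow> h = k"
  unfolding int_vecs_def by (rule PiE_ext)

lemma integral_unit_exp_orthonormal:
  assumes "h \<in> int_vecs d" "k \<in> int_vecs d"
  shows "(\<integral>x. unit_exp d h x * cnj (unit_exp d k x) \<partial>cube d) = (if h = k then 1 else 0)"
proof -
  have "(\<forall>j\<in>{1..d}. h j - k j = 0) \<longleftrightarrow> h = k"
    using int_vecs_eqI[OF assms] by auto
  thus ?thesis
    unfolding unit_exp_diff[symmetric] by (subst integral_unit_exp) auto
qed

lemma integral_trig_poly_coeff: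
  assumes "finite F" "F \<subseteq> int_vecs d" "k \<in> int_vecs d"
  shows "(\<integral>x. (\<Sum>h\<in>F. c h * unit_exp d h x) * cnj (unit_exp d k x) \<partial>cube d) = (if k \<in> F then c k else 0)"
proof -
  have int: "integrable (cube d) (\<lambda>x. c h * (unit_exp d h x * cnj (unit_exp d k x)))" for h
    by (rule integrable_bounded_cube[of _ _ "cmod (c h)"]) (auto simp: norm_mult)
  have "(\<integral>x. (\<Sum>h\<in>F. c h * unit_exp d h x) * cnj (unit_exp d k x) \<partial>cube d) =
        (\<integral>x. (\<Sum>h\<in>F. c h * (unit_exp d h x * cnj (unit_exp d k x))) \<partial>cube d)"
    by (simp only: sum_distrib_right mult.assoc)
  also have "\<dots> = (\<Sum>h\<in>F. c h * (\<integral>x. unit_exp d h x * cnj (unit_exp d k x) \<partial>cube d))"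
    using int by (subst Bochner_Integration.integral_sum) auto
  also have "\<dots> = (\<Sum>h\<in>F. if h = k then c k else 0)"
    using assms by (intro sum.cong) (auto simp: integral_unit_exp_orthonormal)
  also have "\<dots> = (if k \<in> F then c k else 0)" using assms(1) by simp
  finally show ?thesis .
qed

lemma integral_trig_poly_norm_square:
  assumes "finite F" "F \<subseteq> int_vecs d"
  shows "(\<integral>x. (cmod (\<Sum>h\<in>F. c h * unit_exp d h x))\<^sup>2 \<partial>cube d) = (\<Sum>h\<in>F. (cmod (c h))\<^sup>2)"
proof -
  let ?S = "\<lambda>x. \<Sum>h\<in>F. c h * unit_exp d h x"
  have bd: "cmod (?S x) \<le> (\<Sum>h\<in>F. cmod (c h))" for x
    by (rule order.trans[OF norm_sum]) (simp add: norm_mult)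
  have int: "integrable (cube d) (\<lambda>x. cnj (c h) * (?S x * cnj (unit_exp d h x)))" for h
    using bd by (intro integrable_bounded_cube[of _ _ "cmod (c h) * (\<Sum>h\<in>F. cmod (c h))"])
      (auto simp: norm_mult intro: mult_left_mono)
  have cnj_sum_mult: "S * cnj (\<Sum>h\<in>F. c h * e h) = (\<Sum>h\<in>F. cnj (c h) * (S * cnj (e h)))"
    for S and e :: "_ \<Rightarrow> complex"
    by (simp add: sum_distrib_left mult_ac)
  have "complex_of_real (\<integral>x. (cmod (?S x))\<^sup>2 \<partial>cube d) = (\<integral>x. of_real ((cmod (?S x))\<^sup>2) \<partial>cube d)"
    by (rule integral_complex_of_real[symmetric])
  also have "\<dots> = (\<integral>x. (\<Sum>h\<in>F. cnj (c h) * (?S x * cnj (unit_exp d h x))) \<partial>cube d)"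
    by (simp only: complex_norm_square cnj_sum_mult)
  also have "\<dots> = (\<Sum>h\<in>F. cnj (c h) * (\<integral>x. ?S x * cnj (unit_exp d h x) \<partial>cube d))"
    using int by (subst Bochner_Integration.integral_sum) auto
  also have "\<dots> = (\<Sum>h\<in>F. cnj (c h) * c h)"
    using assms by (intro sum.cong refl arg_cong2[where f = times])
      (subst integral_trig_poly_coeff, auto)
  also have "\<dots> = of_real (\<Sum>h\<in>F. (cmod (c h))\<^sup>2)"
    by (simp only: of_real_sum complex_norm_square mult.commute)
  finally show ?thesis by (simp only: of_real_eq_iff)
qed

text \<open>An exhausting sequence of finite frequency sets: it turns unordered sums over
  \<open>int_vecs d\<close> into sequential limits, the form that dominated convergence requires.
  Its product shape also lets sums of products factor.\<close>

definition int_box :: "nat \<Rightarrow> nat \<Rightarrow> (nat \<Rightarrow> int) set" where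
  "int_box d n = {1..d} \<rightarrow>\<^sub>E {- int n..int n}"

lemma finite_int_box [simp]: "finite (int_box d n)"
  by (auto simp: int_box_def intro: finite_PiE)

lemma int_box_subset: "int_box d n \<subseteq> int_vecs d"
  by (auto simp: int_box_def int_vecs_def)

lemma int_box_mono: "m \<le> n \<Longrightarrow> int_box d m \<subseteq> int_box d n"
  unfolding int_box_def by (rule PiE_mono) auto

lemma finite_subset_int_box:
  assumes "finite F" "F \<subseteq> int_vecs d"
  shows "\<exists>n. F \<subseteq> int_box d n"
proof -
  define n where "n = Max (insert 0 ((\<lambda>(h, j). nat \<bar>h j\<bar>) ` (F \<times> {1..d})))"
  have "nat \<bar>h j\<bar> \<le> n" if "h \<in> F" "j \<in> {1..d}" for h j
    unfolding n_def using that assms by (intro Max_ge) (auto intro!: image_eqI[of _ _ "(h, j)"])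
  hence "F \<subseteq> int_box d n"
    using assms(2) by (force simp: int_box_def int_vecs_def PiE_iff)
  thus ?thesis ..
qed

lemma filterlim_int_box: "filterlim (int_box d) (finite_subsets_at_top (int_vecs d)) sequentially"
  unfolding filterlim_finite_subsets_at_top eventually_sequentially
proof (intro allI impI)
  fix X assume "finite X \<and> X \<subseteq> int_vecs d"
  then obtain n where "X \<subseteq> int_box d n" using finite_subset_int_box by blast
  thus "\<exists>N. \<forall>n\<ge>N. finite (int_box d n) \<and> X \<subseteq> int_box d n \<and> int_box d n \<subseteq> int_vecs d"
    using int_box_mono int_box_subset by (meson finite_int_box order_trans)
qed

lemma has_sum_int_box: "(f has_sum S) (int_vecs d) \<Longrightarrow> (\<lambda>n. \<Sum>h\<in>int_box d n. f h) \<longlonglongrightarrow> S"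
  unfolding has_sum_def by (rule filterlim_compose[OF _ filterlim_int_box])

text \<open>Instantiated twice: with the coefficients of \<open>f\<close>, to recover its point
  values, and with those of \<open>f\<close> minus the output of the algorithm, where
  \<open>parseval\<close> computes the error.\<close>

locale abs_fourier_series =
  fixes d :: nat and c :: "(nat \<Rightarrow> int) \<Rightarrow> complex"
  assumes abs_summable: "(\<lambda>h. cmod (c h)) summable_on int_vecs d"
begin

definition series :: "(nat \<Rightarrow> real) \<Rightarrow> complex" where
  "series x = (\<Sum>\<^sub>\<infinity>h\<in>int_vecs d. c h * unit_exp d h x)"

lemma has_sum_series: "((\<lambda>h. c h * unit_exp d h x) has_sum series x) (int_vecs d)"
proof -
  have "(\<lambda>h. norm (c h * unit_exp d h x)) summable_on int_vecs d"
    using abs_summable by (simp add: norm_mult)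
  thus ?thesis unfolding series_def by (rule has_sum_infsum[OF abs_summable_summable])
qed

lemma norm_partial_le:
  "F \<subseteq> int_vecs d \<Longrightarrow> finite F \<Longrightarrow> cmod (\<Sum>h\<in>F. c h * unit_exp d h x) \<le> (\<Sum>\<^sub>\<infinity>h\<in>int_vecs d. cmod (c h))"
  by (rule order.trans[OF norm_sum])
     (auto simp: norm_mult intro!: finite_sum_le_infsum abs_summable)

lemma box_series_tendsto: "(\<lambda>n. \<Sum>h\<in>int_box d n. c h * unit_exp d h x) \<longlonglongrightarrow> series x"
  by (rule has_sum_int_box[OF has_sum_series])

lemma norm_series_le: "cmod (series x) \<le> (\<Sum>\<^sub>\<infinity>h\<in>int_vecs d. cmod (c h))"
  by (rule LIMSEQ_le_const2[OF tendsto_norm[OF box_series_tendsto]])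
     (auto intro!: exI[of _ 0] norm_partial_le int_box_subset)

lemma series_measurable [measurable]: "series \<in> borel_measurable (cube d)"
  by (rule borel_measurable_LIMSEQ_metric[of "\<lambda>n x. \<Sum>h\<in>int_box d n. c h * unit_exp d h x"])
     (auto intro: box_series_tendsto)

lemma series_coeff:
  assumes "k \<in> int_vecs d"
  shows "(\<integral>x. series x * cnj (unit_exp d k x) \<partial>cube d) = c k"
proof -
  interpret prob_space "cube d" by (rule prob_space_cube)
  let ?B = "\<Sum>\<^sub>\<infinity>h\<in>int_vecs d. cmod (c h)"
  have lim: "(\<lambda>n. \<integral>x. (\<Sum>h\<in>int_box d n. c h * unit_exp d h x) * cnj (unit_exp d k x) \<partial>cube d)
     \<longlonglongrightarrow> (\<integral>x. series x * cnj (unit_exp d k x) \<partial>cube d)"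
    by (rule integral_dominated_convergence[where w = "\<lambda>_. ?B"])
       (auto simp: norm_mult intro!: tendsto_intros box_series_tendsto norm_partial_le int_box_subset)
  obtain m where "k \<in> int_box d m" using finite_subset_int_box[of "{k}" d] assms by auto
  hence "\<forall>n\<ge>m. k \<in> int_box d n" using int_box_mono by blast
  hence "\<forall>\<^sub>F n in sequentially. (\<integral>x. (\<Sum>h\<in>int_box d n. c h * unit_exp d h x) * cnj (unit_exp d k x) \<partial>cube d) = c k"
    unfolding eventually_sequentially using integral_trig_poly_coeff[OF finite_int_box int_box_subset assms]
    by (intro exI[of _ m]) auto
  hence "(\<lambda>n. \<integral>x. (\<Sum>h\<in>int_box d n. c h * unit_exp d h x) * cnj (unit_exp d k x) \<partial>cube d) \<longlonglongrightarrow> c k"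
    by (rule tendsto_eventually)
  with lim show ?thesis by (rule LIMSEQ_unique)
qed

lemma norm_square_summable: "(\<lambda>h. (cmod (c h))\<^sup>2) summable_on int_vecs d"
proof -
  let ?B = "\<Sum>\<^sub>\<infinity>h\<in>int_vecs d. cmod (c h)"
  have "cmod (c h) \<le> ?B" if "h \<in> int_vecs d" for h
    using finite_sum_le_infsum[OF abs_summable, of "{h}"] that by simp
  hence "(cmod (c h))\<^sup>2 \<le> ?B * cmod (c h)" if "h \<in> int_vecs d" for h
    using that by (simp add: power2_eq_square mult_right_mono)
  thus ?thesis
    by (intro summable_on_comparison_test[OF summable_on_cmult_right[OF abs_summable, of ?B]]) auto
qed

lemma parseval: "(\<integral>x. (cmod (series x))\<^sup>2 \<partial>cube d) = (\<Sum>\<^sub>\<infinity>h\<in>int_vecs d. (cmod (c h))\<^sup>2)"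
proof -
  interpret prob_space "cube d" by (rule prob_space_cube)
  let ?B = "\<Sum>\<^sub>\<infinity>h\<in>int_vecs d. cmod (c h)"
  have lim: "(\<lambda>n. \<integral>x. (cmod (\<Sum>h\<in>int_box d n. c h * unit_exp d h x))\<^sup>2 \<partial>cube d)
     \<longlonglongrightarrow> (\<integral>x. (cmod (series x))\<^sup>2 \<partial>cube d)"
    by (rule integral_dominated_convergence[where w = "\<lambda>_. ?B\<^sup>2"])
       (auto simp: norm_mult intro!: tendsto_intros box_series_tendsto power_mono norm_partial_le int_box_subset)
  have "(\<lambda>n. \<Sum>h\<in>int_box d n. (cmod (c h))\<^sup>2) \<longlonglongrightarrow> (\<Sum>\<^sub>\<infinity>h\<in>int_vecs d. (cmod (c h))\<^sup>2)"
    by (rule has_sum_int_box[OF has_sum_infsum[OF norm_square_summable]])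
  with lim show ?thesis
    unfolding integral_trig_poly_norm_square[OF finite_int_box int_box_subset] by (rule LIMSEQ_unique)
qed

text \<open>Uniqueness is applied to \<open>f\<close> minus its series, which therefore has to be
  continuous.\<close>

lemma continuous_on_series: "continuous_on UNIV series"
proof -
  let ?B = "\<lambda>F. \<Sum>h\<in>F. cmod (c h)"
  have "continuous_on UNIV (unit_exp d h)" for h
    unfolding unit_exp_def[abs_def] dot_def
    by (intro continuous_intros continuous_on_product_then_coordinatewise[OF continuous_on_id])
  hence 1: "\<forall>\<^sub>F F in finite_subsets_at_top (int_vecs d). continuous_on UNIV (\<lambda>x. \<Sum>h\<in>F. c h * unit_exp d h x)"
    by (intro always_eventually allI continuous_intros)
  have "uniform_limit UNIV (\<lambda>F x. \<Sum>h\<in>F. c h * unit_exp d h x) series (finite_subsets_at_top (int_vecs d))"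
  proof (rule uniform_limitI)
    fix e :: real assume "e > 0"
    let ?T = "\<Sum>\<^sub>\<infinity>h\<in>int_vecs d. cmod (c h)"
    have "(?B \<longlongrightarrow> ?T) (finite_subsets_at_top (int_vecs d))"
      using has_sum_infsum[OF abs_summable] by (simp add: has_sum_def)
    hence "\<forall>\<^sub>F F in finite_subsets_at_top (int_vecs d). dist (?B F) ?T < e"
      using \<open>e > 0\<close> by (rule tendstoD)
    moreover have "\<forall>\<^sub>F F in finite_subsets_at_top (int_vecs d). finite F \<and> F \<subseteq> int_vecs d"
      by (rule eventually_finite_subsets_at_top_weakI) auto
    ultimately show "\<forall>\<^sub>F F in finite_subsets_at_top (int_vecs d). \<forall>x\<in>UNIV. dist (\<Sum>h\<in>F. c h * unit_exp d h x) (series x) < e"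
    proof eventually_elim
      case (elim F)
      show ?case
      proof
        fix x
        have F: "finite F" "F \<subseteq> int_vecs d" using elim by auto
        have s: "(\<lambda>h. c h * unit_exp d h x) summable_on int_vecs d - F"
          using has_sum_imp_summable[OF has_sum_series] by (rule summable_on_subset_banach) auto
        have s': "(\<lambda>h. cmod (c h)) summable_on int_vecs d - F"
          using abs_summable by (rule summable_on_subset_banach) auto
        have "series x - (\<Sum>h\<in>F. c h * unit_exp d h x) = (\<Sum>\<^sub>\<infinity>h\<in>int_vecs d - F. c h * unit_exp d h x)"
          unfolding series_def using F has_sum_imp_summable[OF has_sum_series]
          by (subst infsum_Diff) auto
        also have "cmod \<dots> \<le> (\<Sum>\<^sub>\<infinity>h\<in>int_vecs d - F. cmod (c h * unit_exp d h x))"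
          using s' by (intro norm_infsum_bound) (simp add: norm_mult)
        also have "\<dots> = ?T - ?B F"
          using F abs_summable by (simp add: norm_mult infsum_Diff)
        also have "\<dots> < e" using elim by (simp add: dist_real_def)
        finally show "dist (\<Sum>h\<in>F. c h * unit_exp d h x) (series x) < e"
          by (simp add: dist_norm norm_minus_commute)
      qed
    qed
  qed
  from uniform_limit_theorem[OF 1 this] show ?thesis by simp
qed

end

section \<open>Uniqueness of Fourier coefficients\<close>

text \<open>Continuity of functions on the cube refers to the product topology, so convergent
  sequences of points are built coordinate by coordinate.\<close>

lemma tendsto_fun_componentwise:
  fixes X :: "'b \<Rightarrow> 'i \<Rightarrow> 'a::topological_space"
  assumes "\<And>i. ((\<lambda>n. X n i) \<longlongrightarrow> y i) F"
  shows "(X \<longlongrightarrow> y) F"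
proof -
  have "limitin (product_topology (\<lambda>_. euclidean) UNIV) X y F"
    using assms by (simp add: limitin_componentwise)
  thus ?thesis by (simp add: euclidean_product_topology)
qed

lemma half_cos_bounds:
  fixes t :: real
  shows "0 \<le> (1 + cos t) / 2" "(1 + cos t) / 2 \<le> 1"
  using cos_ge_minus_one[of t] cos_le_one[of t] by (simp_all add: field_simps del: cos_ge_minus_one cos_le_one)

text \<open>The aim is that a continuous \<open>f\<close> of this kind vanishes at every point of
  the cube. Orthogonality to the characters extends to trigonometric polynomials, and a peaked
  nonnegative one isolates the value at a single point.\<close>

locale zero_coeffs =
  fixes d :: nat and f :: "(nat \<Rightarrow> real) \<Rightarrow> complex"
  assumes integrable_f: "integrable (cube d) f"
    and zero_coeff: "\<And>h. h \<in> int_vecs d \<Longrightarrow> (\<integral>x. f x * cnj (unit_exp d h x) \<partial>cube d) = 0"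
begin

text \<open>Quantifying over all \<open>h\<close> makes the property stable under multiplication by
  characters; arbitrary functions are allowed because \<open>unit_exp d\<close> reads only the
  coordinates in \<open>{1..d}\<close>. The bound by 1 keeps the products with \<open>f\<close>
  integrable.\<close>

definition annihilator :: "((nat \<Rightarrow> real) \<Rightarrow> complex) \<Rightarrow> bool" where
  "annihilator w \<longleftrightarrow> w \<in> borel_measurable (cube d) \<and> (\<forall>x. cmod (w x) \<le> 1) \<and>
     (\<forall>h. (\<integral>x. f x * w x * unit_exp d h x \<partial>cube d) = 0)"

lemma integrable_mult_bounded:
  assumes "w \<in> borel_measurable (cube d)" "\<And>x. cmod (w x) \<le> 1"
  shows "integrable (cube d) (\<lambda>x. f x * w x)"
proof (rule Bochner_Integration.integrable_bound[OF integrable_f])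
  show "(\<lambda>x. f x * w x) \<in> borel_measurable (cube d)"
    using integrable_f assms(1) by measurable
  show "AE x in cube d. cmod (f x * w x) \<le> cmod (f x)"
    using assms(2) by (intro AE_I2) (simp add: norm_mult mult_left_le)
qed

lemma annihilator_one: "annihilator (\<lambda>_. 1)"
  unfolding annihilator_def
proof (intro conjI allI)
  fix h :: "nat \<Rightarrow> int"
  define k where "k = restrict (\<lambda>j. - h j) {1..d}"
  have "k \<in> int_vecs d" by (simp add: k_def int_vecs_def)
  moreover have "cnj (unit_exp d k x) = unit_exp d h x" for x
    by (simp add: k_def unit_exp_cis dot_def cis_cnj sum_negf)
  ultimately show "(\<integral>x. f x * 1 * unit_exp d h x \<partial>cube d) = 0"
    using zero_coeff[of k] by simp
qed auto

text \<open>The cosine is half the sum of two characters with frequency 1 and -1 in coordinate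
  \<open>j\<close>, so the new integral combines three old ones, at \<open>h\<close> and at its two
  shifts.\<close>

lemma annihilator_mult_factor:
  assumes w: "annihilator w" and j: "j \<in> {1..d}"
  shows "annihilator (\<lambda>x. w x * of_real ((1 + cos (2 * pi * (x j - t))) / 2))"
  unfolding annihilator_def
proof (intro conjI allI)
  have wm [measurable]: "w \<in> borel_measurable (cube d)" and wb: "cmod (w x) \<le> 1"
    and w0: "(\<integral>x. f x * w x * unit_exp d h x \<partial>cube d) = 0" for x h
    using w by (auto simp: annihilator_def)
  show "(\<lambda>x. w x * of_real ((1 + cos (2 * pi * (x j - t))) / 2)) \<in> borel_measurable (cube d)"
    using component_measurable[OF j] by measurable
  show "cmod (w x * of_real ((1 + cos (2 * pi * (x j - t))) / 2)) \<le> 1" for x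
    unfolding norm_mult norm_of_real
    using half_cos_bounds[of "2 * pi * (x j - t)"] wb[of x] by (intro mult_le_one) auto
  fix h :: "nat \<Rightarrow> int"
  define e where "e s = (\<lambda>i. if i = j then s else 0 :: int)" for s
  have dot_e: "dot d (e s) x = s * x j" for s x
  proof -
    have "dot d (e s) x = (\<Sum>i=1..d. if i = j then s * x j else 0)"
      unfolding dot_def e_def by (intro sum.cong) auto
    thus ?thesis using j by simp
  qed
  have eq: "f x * (w x * of_real ((1 + cos (2 * pi * (x j - t))) / 2)) * unit_exp d h x =
     1/2 * (f x * w x * unit_exp d h x) +
     (cis (-2*pi*t) / 4 * (f x * w x * unit_exp d (\<lambda>i. h i + e 1 i) x) +
      cis (2*pi*t) / 4 * (f x * w x * unit_exp d (\<lambda>i. h i + e (-1) i) x))" for x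
  proof -
    have "of_real (cos (2 * pi * (x j - t))) = (cis (2 * pi * (x j - t)) + cis (- (2 * pi * (x j - t)))) / 2"
      by (simp add: complex_eq_iff)
    also have "cis (2 * pi * (x j - t)) = unit_exp d (e 1) x * cis (-2*pi*t)"
      by (simp add: unit_exp_cis dot_e cis_mult ring_distribs)
    also have "cis (- (2 * pi * (x j - t))) = unit_exp d (e (-1)) x * cis (2*pi*t)"
      by (simp add: unit_exp_cis dot_e cis_mult ring_distribs)
    finally have c: "complex_of_real (cos (2 * pi * (x j - t))) =
      (unit_exp d (e 1) x * cis (-2*pi*t) + unit_exp d (e (-1)) x * cis (2*pi*t)) / 2" .
    show ?thesis unfolding unit_exp_add of_real_divide of_real_add c
      by (simp add: field_simps)
  qed
  have int: "integrable (cube d) (\<lambda>x. f x * w x * unit_exp d h x)" for h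
    using integrable_mult_bounded[of "\<lambda>x. w x * unit_exp d h x"] wb by (auto simp: norm_mult mult.assoc)
  show "(\<integral>x. f x * (w x * of_real ((1 + cos (2 * pi * (x j - t))) / 2)) * unit_exp d h x \<partial>cube d) = 0"
    unfolding eq using int w0
    by (subst Bochner_Integration.integral_add Bochner_Integration.integrable_add)+
       (auto intro!: Bochner_Integration.integrable_add)
qed

text \<open>
  The kernel lies in \<open>[0, 1]\<close> and, for \<open>y\<close> in the open cube, equals \<open>1\<close> only at \<open>y\<close>, so its
  powers, which are trigonometric polynomials, concentrate at \<open>y\<close>.
\<close>

definition kernel :: "(nat \<Rightarrow> real) \<Rightarrow> (nat \<Rightarrow> real) \<Rightarrow> real" where
  "kernel y x = (\<Prod>j\<in>{1..d}. (1 + cos (2 * pi * (x j - y j))) / 2)"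

lemma annihilator_kernel_power: "annihilator (\<lambda>x. of_real (kernel y x ^ n))"
proof (induction n)
  case 0
  show ?case using annihilator_one by simp
next
  case (Suc n)
  have "annihilator (\<lambda>x. of_real (kernel y x ^ n) * of_real (\<Prod>j\<in>J. (1 + cos (2 * pi * (x j - y j))) / 2))"
    if "J \<subseteq> {1..d}" for J
    using finite_subset[OF that finite_atLeastAtMost] that
  proof (induction J)
    case empty
    show ?case using Suc by simp
  next
    case (insert j J)
    have "annihilator (\<lambda>x. of_real (kernel y x ^ n) * of_real (\<Prod>j\<in>J. (1 + cos (2 * pi * (x j - y j))) / 2) *
        of_real ((1 + cos (2 * pi * (x j - y j))) / 2))"
      by (rule annihilator_mult_factor) (use insert in auto)
    thus ?case using insert.hyps by (simp add: mult_ac)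
  qed
  from this[of "{1..d}"] show ?case by (simp add: kernel_def mult.commute)
qed

lemma kernel_bounds: "0 \<le> kernel y x" "kernel y x \<le> 1"
  unfolding kernel_def using half_cos_bounds by (blast intro: prod_nonneg prod_le_1)+

lemma kernel_measurable [measurable]: "kernel y \<in> borel_measurable (cube d)"
  unfolding kernel_def[abs_def] by measurable

text \<open>The cosine returns to 1 when the distance approaches 1, near the opposite face. Keeping
  \<open>y j\<close> at distance \<open>s\<close> from both faces confines the distance to
  [s, 1 - s].\<close>

lemma kernel_le_far:
  assumes x: "x \<in> space (cube d)" and j: "j \<in> {1..d}" and s: "0 < s" "s \<le> 1/4" "s \<le> y j" "s \<le> 1 - y j"
    and far: "s \<le> \<bar>x j - y j\<bar>"
  shows "kernel y x \<le> (1 + cos (2 * pi * s)) / 2"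
proof -
  have xj: "0 \<le> x j" "x j \<le> 1" using x j by (auto simp: space_cube PiE_iff)
  define t where "t = \<bar>x j - y j\<bar>"
  have t: "s \<le> t" "t \<le> 1 - s" using xj s far by (auto simp: t_def)
  have "cos (2 * pi * (x j - y j)) = cos (2 * pi * t)"
    by (cases "x j \<ge> y j") (auto simp: t_def algebra_simps cos_diff)
  also have "\<dots> \<le> cos (2 * pi * s)"
  proof (cases "t \<le> 1/2")
    case True
    thus ?thesis using t s by (intro cos_monotone_0_pi_le) auto
  next
    case False
    have "cos (2 * pi * t) = cos (2 * pi * (1 - t))"
      by (simp add: algebra_simps cos_diff)
    also have "\<dots> \<le> cos (2 * pi * s)" using t s False by (intro cos_monotone_0_pi_le) auto
    finally show ?thesis .
  qed
  finally have le: "(1 + cos (2 * pi * (x j - y j))) / 2 \<le> (1 + cos (2 * pi * s)) / 2" by simp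
  have "kernel y x = (1 + cos (2 * pi * (x j - y j))) / 2 *
      (\<Prod>j\<in>{1..d} - {j}. (1 + cos (2 * pi * (x j - y j))) / 2)"
    unfolding kernel_def by (rule prod.remove) (use j in auto)
  also have "\<dots> \<le> (1 + cos (2 * pi * (x j - y j))) / 2 * 1"
    by (intro mult_left_mono prod_le_1 conjI half_cos_bounds)
  finally show ?thesis using le by simp
qed

lemma kernel_ge_near:
  assumes "0 \<le> s" "s \<le> 1/4" "\<And>j. j \<in> {1..d} \<Longrightarrow> \<bar>x j - y j\<bar> \<le> s"
  shows "((1 + cos (2 * pi * s)) / 2) ^ d \<le> kernel y x"
proof -
  have "(\<Prod>j\<in>{1..d}. (1 + cos (2 * pi * s)) / 2) \<le> kernel y x"
    unfolding kernel_def
  proof (rule prod_mono, intro conjI)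
    fix j assume j: "j \<in> {1..d}"
    show "0 \<le> (1 + cos (2 * pi * s)) / 2"
      by (rule half_cos_bounds)
    have "cos (2 * pi * s) \<le> cos (2 * pi * \<bar>x j - y j\<bar>)"
      using assms(1,2) assms(3)[OF j] by (intro cos_monotone_0_pi_le) auto
    also have "\<dots> = cos (2 * pi * (x j - y j))"
      by (cases "x j \<ge> y j") (auto simp: algebra_simps cos_diff)
    finally show "(1 + cos (2 * pi * s)) / 2 \<le> (1 + cos (2 * pi * (x j - y j))) / 2" by simp
  qed
  thus ?thesis by simp
qed

text \<open>If \<open>f y\<close> were nonzero, \<open>G\<close> would be positive near
  \<open>y\<close>, while its integral against every kernel power is 0. A small box \<open>V\<close>
  contributes at least a constant times \<rho>'^n, the outside of a larger box at least minus a
  constant times \<rho>^n, and \<rho>' > \<rho>: impossible for large n.\<close>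

lemma zero_interior:
  assumes cont: "continuous_on (space (cube d)) f" and y: "y \<in> space (cube d)"
    and interior: "\<And>j. j \<in> {1..d} \<Longrightarrow> 0 < y j \<and> y j < 1"
  shows "f y = 0"
proof (rule ccontr)
  assume fy: "f y \<noteq> 0"
  define G where "G x = Re (f x * cnj (f y))" for x
  have Gy: "G y > 0" using fy by (simp add: G_def flip: complex_norm_square)
  have contG: "continuous_on (space (cube d)) G"
    unfolding G_def[abs_def] by (intro continuous_intros cont)
  \<comment> \<open>Otherwise points violating the claim at radius 1/(n + 1) would converge to
    \<open>y\<close>, against the continuity of \<open>G\<close>.\<close>
  have "\<exists>\<delta>>0. \<forall>x\<in>space (cube d). (\<forall>j\<in>{1..d}. \<bar>x j - y j\<bar> < \<delta>) \<longrightarrow> G x > G y / 2"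
  proof (rule ccontr)
    assume "\<not> ?thesis"
    hence "\<forall>n::nat. \<exists>x\<in>space (cube d). (\<forall>j\<in>{1..d}. \<bar>x j - y j\<bar> < inverse (real (Suc n))) \<and> G x \<le> G y / 2"
      by (metis inverse_positive_iff_positive of_nat_0_less_iff zero_less_Suc not_less)
    then obtain X where X: "\<And>n. X n \<in> space (cube d)" "\<And>n. G (X n) \<le> G y / 2"
        "\<And>n j. j \<in> {1..d} \<Longrightarrow> \<bar>X n j - y j\<bar> < inverse (real (Suc n))" by metis
    have "X \<longlonglongrightarrow> y"
    proof (rule tendsto_fun_componentwise)
      fix i
      show "(\<lambda>n. X n i) \<longlonglongrightarrow> y i"
      proof (cases "i \<in> {1..d}")
        case True
        have "(\<lambda>n. X n i - y i) \<longlonglongrightarrow> 0"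
          using X(3)[OF True] by (intro Lim_null_comparison[OF _ LIMSEQ_inverse_real_of_nat])
            (auto intro!: always_eventually less_imp_le)
        thus ?thesis by (simp add: LIM_zero_iff)
      next
        case False
        hence "X n i = y i" for n using X(1)[of n] y by (auto simp: space_cube PiE_def extensional_def)
        thus ?thesis by simp
      qed
    qed
    hence "(\<lambda>n. G (X n)) \<longlonglongrightarrow> G y"
      by (rule continuous_on_tendsto_compose[OF contG]) (use X y in auto)
    hence "G y \<le> G y / 2" by (rule LIMSEQ_le_const2) (use X in auto)
    thus False using Gy by simp
  qed
  then obtain s0 where s0: "s0 > 0" "\<And>x. x \<in> space (cube d) \<Longrightarrow> (\<And>j. j \<in> {1..d} \<Longrightarrow> \<bar>x j - y j\<bar> < s0) \<Longrightarrow> G x > G y / 2"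
    by blast
  define S where "S = insert s0 (insert (1/4) (y ` {1..d} \<union> (\<lambda>j. 1 - y j) ` {1..d}))"
  define s where "s = Min S"
  have S: "finite S" "S \<noteq> {}" "\<forall>a\<in>S. a > 0" using s0 interior by (auto simp: S_def)
  hence s: "s > 0" and s_le: "\<And>a. a \<in> S \<Longrightarrow> s \<le> a" unfolding s_def by (auto intro: Min_le)
  have sle: "s \<le> s0" "s \<le> 1/4" "\<And>j. j \<in> {1..d} \<Longrightarrow> s \<le> y j" "\<And>j. j \<in> {1..d} \<Longrightarrow> s \<le> 1 - y j"
    by (rule s_le, force simp: S_def)+
  define \<rho> where "\<rho> = (1 + cos (2 * pi * s)) / 2"
  have "cos (2 * pi * s) < cos 0" using s sle(2) by (intro cos_monotone_0_pi) auto
  moreover have "cos (2 * pi * s) \<ge> 0" using s sle(2) by (intro cos_ge_zero) (auto intro: order.trans[of _ 0])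
  ultimately have \<rho>: "0 < \<rho>" "\<rho> < 1" by (auto simp: \<rho>_def)
  \<comment> \<open>The lower bound for the kernel on the box of radius e tends to 1 as e tends to
    0, so some e < s lifts it above \<rho>, the upper bound outside the box of radius s.\<close>
  have "((\<lambda>e::real. ((1 + cos (2 * pi * e)) / 2) ^ d) \<longlongrightarrow> ((1 + cos (2 * pi * 0)) / 2) ^ d) (at_right 0)"
    by (intro tendsto_intros) auto
  hence "\<forall>\<^sub>F e in at_right 0. ((1 + cos (2 * pi * e)) / 2) ^ d > \<rho>"
    using \<rho> by (intro order_tendstoD) auto
  moreover have "\<forall>\<^sub>F e in at_right 0. e \<in> {0<..<s}" using s by (rule eventually_at_right_real)
  ultimately have "\<forall>\<^sub>F e in at_right (0::real). ((1 + cos (2 * pi * e)) / 2) ^ d > \<rho> \<and> e \<in> {0<..<s}"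
    by eventually_elim auto
  then obtain e where e: "((1 + cos (2 * pi * e)) / 2) ^ d > \<rho>" "0 < e" "e < s"
    by (auto dest!: eventually_happens' [rotated])
  define \<rho>' where "\<rho>' = ((1 + cos (2 * pi * e)) / 2) ^ d"
  define V where "V = (\<Pi>\<^sub>E j\<in>{1..d}. {y j - e..y j + e})"
  have V_set: "{y j - e..y j + e} \<in> sets (restrict_space lborel {0..1::real})" if "j \<in> {1..d}" for j
    using e sle(3,4)[OF that] by (subst sets_restrict_space_iff) auto
  have V_sets [measurable]: "V \<in> sets (cube d)"
    unfolding V_def cube_def by (intro sets_PiM_I_finite V_set) auto
  interpret prob_space "cube d" by (rule prob_space_cube)
  have "emeasure (cube d) V = (\<Prod>j\<in>{1..d}. emeasure (restrict_space lborel {0..1}) {y j - e..y j + e})"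
    unfolding V_def cube_def
    by (intro product_sigma_finite.emeasure_PiM product_sigma_finite_unit V_set) auto
  also have "\<dots> = (\<Prod>j\<in>{1..d}. ennreal (2 * e))"
    using e sle(3,4) by (intro prod.cong refl, subst emeasure_restrict_space) force+
  also have "\<dots> = ennreal ((2 * e) ^ d)" using e by (simp add: ennreal_power)
  finally have measV: "measure (cube d) V = (2 * e) ^ d"
    using e by (simp add: measure_def)
  have Gint: "integrable (cube d) G"
    unfolding G_def[abs_def] using integrable_f by (intro integrable_Re integrable_mult_left)
  have ineq: "G y / 2 * (2 * e) ^ d * \<rho>' ^ n \<le> \<rho> ^ n * (\<integral>x. \<bar>G x\<bar> \<partial>cube d)" for n
  proof -
    have Kint: "integrable (cube d) (\<lambda>x. f x * of_real (kernel y x ^ n))"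
      using kernel_bounds by (intro integrable_mult_bounded) (auto simp: norm_power intro!: power_le_one)
    have GK: "G x * kernel y x ^ n = Re (cnj (f y) * (f x * of_real (kernel y x ^ n)))" for x
      by (simp add: G_def algebra_simps)
    have "(\<integral>x. G x * kernel y x ^ n \<partial>cube d) = Re (cnj (f y) * (\<integral>x. f x * of_real (kernel y x ^ n) \<partial>cube d))"
      unfolding GK using Kint by (subst integral_Re) auto
    also have "(\<integral>x. f x * of_real (kernel y x ^ n) \<partial>cube d) = 0"
      using annihilator_kernel_power[of y n] unfolding annihilator_def
      by (auto dest: spec[of _ "\<lambda>_. 0"] simp: unit_exp_cis dot_def)
    finally have zero: "(\<integral>x. G x * kernel y x ^ n \<partial>cube d) = 0" by simp
    have "(\<integral>x. G y / 2 * \<rho>' ^ n * indicator V x - \<rho> ^ n * \<bar>G x\<bar> \<partial>cube d) \<le> (\<integral>x. G x * kernel y x ^ n \<partial>cube d)"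
    proof (rule integral_mono)
      show "integrable (cube d) (\<lambda>x. G y / 2 * \<rho>' ^ n * indicator V x - \<rho> ^ n * \<bar>G x\<bar>)"
        using Gint by (intro Bochner_Integration.integrable_diff integrable_mult_right integrable_real_indicator integrable_abs)
           (auto simp: emeasure_eq_measure)
      show "integrable (cube d) (\<lambda>x. G x * kernel y x ^ n)"
        unfolding GK using Kint by (intro integrable_Re integrable_mult_right)
    next
      fix x assume x: "x \<in> space (cube d)"
      have K: "0 \<le> kernel y x ^ n" using kernel_bounds by simp
      \<comment> \<open>Three regions: on \<open>V\<close> both factors are bounded below, on the
        rest of the s-box their product is nonnegative, and outside the s-box the kernel is at most
        \<rho>.\<close>
      show "G y / 2 * \<rho>' ^ n * indicator V x - \<rho> ^ n * \<bar>G x\<bar> \<le> G x * kernel y x ^ n"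
      proof (cases "\<forall>j\<in>{1..d}. \<bar>x j - y j\<bar> < s")
        case True
        hence G: "G x > G y / 2" using x sle(1) by (intro s0(2)) force+
        show ?thesis
        proof (cases "x \<in> V")
          case xV: True
          have "\<rho>' \<le> kernel y x" unfolding \<rho>'_def
            using e sle(2) xV by (intro kernel_ge_near) (force simp: V_def PiE_iff abs_le_iff)+
          moreover have "0 \<le> \<rho>'" using e \<rho> by (simp add: \<rho>'_def)
          ultimately have "G y / 2 * \<rho>' ^ n \<le> G x * kernel y x ^ n"
            using G Gy by (intro mult_mono power_mono) auto
          moreover have "0 \<le> \<rho> ^ n * \<bar>G x\<bar>" using \<rho> by simp
          ultimately show ?thesis using xV by simp
        next
          case False
          have "0 \<le> G x * kernel y x ^ n" using G Gy K by (intro mult_nonneg_nonneg) auto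
          moreover have "0 \<le> \<rho> ^ n * \<bar>G x\<bar>" using \<rho> by simp
          ultimately show ?thesis using False by simp
        qed
      next
        case False
        then obtain j where j: "j \<in> {1..d}" "s \<le> \<bar>x j - y j\<bar>" by force
        have "x \<notin> V" using j e unfolding V_def by (auto simp: PiE_iff dest!: bspec[of _ _ j])
        have "kernel y x \<le> \<rho>" unfolding \<rho>_def
          using s sle j x by (intro kernel_le_far[of x j]) auto
        hence "kernel y x ^ n \<le> \<rho> ^ n" using kernel_bounds by (intro power_mono) auto
        hence "\<bar>G x\<bar> * kernel y x ^ n \<le> \<bar>G x\<bar> * \<rho> ^ n" by (intro mult_left_mono) auto
        moreover have "- \<bar>G x\<bar> * kernel y x ^ n \<le> G x * kernel y x ^ n"
          using K by (intro mult_right_mono) auto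
        ultimately show ?thesis using \<open>x \<notin> V\<close> by (simp add: mult.commute)
      qed
    qed
    also have "(\<integral>x. G y / 2 * \<rho>' ^ n * indicator V x - \<rho> ^ n * \<bar>G x\<bar> \<partial>cube d) =
        G y / 2 * \<rho>' ^ n * (2 * e) ^ d - \<rho> ^ n * (\<integral>x. \<bar>G x\<bar> \<partial>cube d)"
      using Gint measV by (subst Bochner_Integration.integral_diff) (auto simp: emeasure_eq_measure)
    finally show ?thesis unfolding zero by (simp add: mult_ac)
  qed
  define A where "A = G y / 2 * (2 * e) ^ d"
  have A: "A > 0" using Gy e by (simp add: A_def)
  have "\<rho>' / \<rho> > 1" using e \<rho> by (simp add: \<rho>'_def)
  then obtain n where n: "(\<rho>' / \<rho>) ^ n > (\<integral>x. \<bar>G x\<bar> \<partial>cube d) / A"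
    using real_arch_pow by blast
  have "(\<rho>' / \<rho>) ^ n \<le> (\<integral>x. \<bar>G x\<bar> \<partial>cube d) / A"
    using ineq[of n] A \<rho> unfolding A_def[symmetric] by (simp add: field_simps)
  thus False using n by simp
qed

text \<open>Boundary points are reached along the segment from the centre of the cube. They matter:
  every lattice contains the origin.\<close>

lemma zero_on_cube:
  assumes cont: "continuous_on (space (cube d)) f" and y: "y \<in> space (cube d)"
  shows "f y = 0"
proof -
  define t where "t n = inverse (real (Suc n))" for n
  define X where "X n = restrict (\<lambda>j. (1 - t n) * y j + t n * (1/2)) {1..d}" for n
  have t: "0 < t n" "t n \<le> 1" for n by (auto simp: t_def field_simps)
  have y01: "0 \<le> y j \<and> y j \<le> 1" if "j \<in> {1..d}" for j using y that by (auto simp: space_cube PiE_iff)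
  have in01: "0 < X n j \<and> X n j < 1" if "j \<in> {1..d}" for n j
  proof -
    have "(1 - t n) * y j \<ge> 0" "(1 - t n) * y j \<le> (1 - t n) * 1"
      using t[of n] y01[OF that] by (intro mult_nonneg_nonneg mult_left_mono; simp)+
    thus ?thesis using t[of n] that by (simp add: X_def)
  qed
  have Xin: "X n \<in> space (cube d)" for n
    using in01[of _ n] by (force simp: space_cube X_def intro!: PiE_I intro: less_imp_le)
  have lim_t: "t \<longlonglongrightarrow> 0" unfolding t_def by (rule LIMSEQ_inverse_real_of_nat)
  have "X \<longlonglongrightarrow> y"
  proof (rule tendsto_fun_componentwise)
    fix i
    show "(\<lambda>n. X n i) \<longlonglongrightarrow> y i"
    proof (cases "i \<in> {1..d}")
      case True
      have "(\<lambda>n. (1 - t n) * y i + t n * (1/2)) \<longlonglongrightarrow> (1 - 0) * y i + 0 * (1/2)"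
        by (intro tendsto_intros lim_t)
      thus ?thesis using True by (simp add: X_def)
    next
      case False
      hence "X n i = y i" for n using y by (auto simp: X_def space_cube PiE_def extensional_def)
      thus ?thesis by simp
    qed
  qed
  hence "(\<lambda>n. f (X n)) \<longlonglongrightarrow> f y"
    by (rule continuous_on_tendsto_compose[OF cont]) (use Xin y in auto)
  moreover have "f (X n) = 0" for n by (rule zero_interior[OF cont Xin in01])
  ultimately show ?thesis by (simp add: LIMSEQ_const_iff)
qed

end

text \<open>The equality must hold at every point, since the algorithm reads \<open>f\<close> at
  finitely many points, about which an almost-everywhere statement says nothing.\<close>

lemma continuous_eq_fourier_series:
  assumes meas: "f \<in> borel_measurable (cube d)" and sq: "integrable (cube d) (\<lambda>x. (f x)\<^sup>2)"
    and cont: "continuous_on (space (cube d)) f"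
    and summ: "(\<lambda>h. cmod (fourier_coeff d f h)) summable_on int_vecs d"
    and x: "x \<in> space (cube d)"
  shows "((\<lambda>h. fourier_coeff d f h * unit_exp d h x) has_sum of_real (f x)) (int_vecs d)"
proof -
  interpret prob_space "cube d" by (rule prob_space_cube)
  interpret S: abs_fourier_series d "fourier_coeff d f" by standard (rule summ)
  have intf: "integrable (cube d) f"
    using square_integrable_imp_integrable[OF meas] sq by simp
  have intS: "integrable (cube d) S.series"
    by (rule integrable_bounded_cube[OF S.series_measurable S.norm_series_le])
  interpret Z: zero_coeffs d "\<lambda>x. of_real (f x) - S.series x"
  proof
    show "integrable (cube d) (\<lambda>x. of_real (f x) - S.series x)"
      using intf intS by auto
    fix h assume h: "h \<in> int_vecs d"
    have 1: "integrable (cube d) (\<lambda>x. of_real (f x) * cnj (unit_exp d h x))"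
      by (rule Bochner_Integration.integrable_bound[OF intf]) (use meas in \<open>auto simp: norm_mult\<close>)
    have 2: "integrable (cube d) (\<lambda>x. S.series x * cnj (unit_exp d h x))"
      by (rule Bochner_Integration.integrable_bound[OF intS]) (auto simp: norm_mult)
    have "(\<integral>x. (of_real (f x) - S.series x) * cnj (unit_exp d h x) \<partial>cube d) =
        (\<integral>x. of_real (f x) * cnj (unit_exp d h x) \<partial>cube d) - (\<integral>x. S.series x * cnj (unit_exp d h x) \<partial>cube d)"
      using 1 2 by (simp add: left_diff_distrib)
    thus "(\<integral>x. (of_real (f x) - S.series x) * cnj (unit_exp d h x) \<partial>cube d) = 0"
      using S.series_coeff[OF h] by (simp add: fourier_coeff_eq)
  qed
  have "of_real (f x) - S.series x = 0"
    by (intro Z.zero_on_cube x continuous_intros cont continuous_on_subset[OF S.continuous_on_series]) auto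
  thus ?thesis using S.has_sum_series[of x] by simp
qed

section \<open>Aliasing, medians and the deterministic error bound\<close>

text \<open>If the median lies at or above \<open>a\<close>, the sorted values from the middle
  position upwards are at least as far from \<open>a\<close>; otherwise those up to the middle are.
  Either half, with the middle, has R div 2 + 1 positions.\<close>

lemma median_real_count:
  fixes Z :: "nat \<Rightarrow> real"
  assumes "odd R"
  shows "R div 2 + 1 \<le> card {r \<in> {1..R}. \<bar>median_real R Z - a\<bar> \<le> \<bar>Z r - a\<bar>}"
proof -
  define xs where "xs = sort (map Z [1..<R + 1])"
  have len: "length xs = R" and sorted: "sorted xs" by (simp_all add: xs_def)
  have R: "R = 2 * (R div 2) + 1" using assms by presburger
  have card_filter: "card {r \<in> {1..R}. P (Z r)} = card {i. i < R \<and> P (xs ! i)}" for P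
  proof -
    have "card {r \<in> {1..R}. P (Z r)} = length (filter (\<lambda>r. P (Z r)) [1..<R + 1])"
      by (subst distinct_card[symmetric]) (auto intro!: arg_cong[of _ _ card])
    also have "\<dots> = length (filter P (map Z [1..<R + 1]))"
      by (simp add: filter_map comp_def)
    also have "mset (filter P (map Z [1..<R + 1])) = mset (filter P xs)"
      by (simp only: mset_filter xs_def mset_sort)
    hence "length (filter P (map Z [1..<R + 1])) = length (filter P xs)"
      by (rule mset_eq_length)
    finally show ?thesis by (simp add: length_filter_conv_card len)
  qed
  have med: "median_real R Z = xs ! (R div 2)" by (simp add: median_real_def xs_def)
  note card_eq = card_filter[of "\<lambda>v. \<bar>median_real R Z - a\<bar> \<le> \<bar>v - a\<bar>"]
  show ?thesis
  proof (cases "a \<le> xs ! (R div 2)")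
    case True
    have "{R div 2..<R} \<subseteq> {i. i < R \<and> \<bar>median_real R Z - a\<bar> \<le> \<bar>xs ! i - a\<bar>}"
    proof safe
      fix i assume i: "i \<in> {R div 2..<R}"
      thus "i < R" by simp
      have "xs ! (R div 2) \<le> xs ! i"
        using i len by (intro sorted_nth_mono[OF sorted]) auto
      thus "\<bar>median_real R Z - a\<bar> \<le> \<bar>xs ! i - a\<bar>" using True by (simp add: med)
    qed
    from card_mono[OF _ this] show ?thesis unfolding card_eq using R by simp
  next
    case False
    have "{..R div 2} \<subseteq> {i. i < R \<and> \<bar>median_real R Z - a\<bar> \<le> \<bar>xs ! i - a\<bar>}"
    proof safe
      fix i assume i: "i \<le> R div 2"
      thus "i < R" using R by linarith
      have "xs ! i \<le> xs ! (R div 2)"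
        using i R len by (intro sorted_nth_mono[OF sorted]) linarith+
      thus "\<bar>median_real R Z - a\<bar> \<le> \<bar>xs ! i - a\<bar>" using False by (simp add: med)
    qed
    from card_mono[OF _ this] show ?thesis unfolding card_eq by simp
  qed
qed

text \<open>Pigeonhole: since R = 2 (R div 2) + 1, the indices whose values are at least as far from
  \<open>a\<close> as the median meet \<open>G\<close> in at least t + 1 places, and each of these
  pays for one copy of the squared median error.\<close>

lemma median_real_square_le:
  fixes Z :: "nat \<Rightarrow> real"
  assumes "odd R" "G \<subseteq> {1..R}" "R div 2 + 1 + t \<le> card G"
  shows "real (t + 1) * (median_real R Z - a)\<^sup>2 \<le> (\<Sum>r\<in>G. (Z r - a)\<^sup>2)"
proof -
  define H where "H = {r \<in> {1..R}. \<bar>median_real R Z - a\<bar> \<le> \<bar>Z r - a\<bar>}"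
  have fin: "finite G" "finite H" using assms(2) by (auto intro: finite_subset simp: H_def)
  have H: "R div 2 + 1 \<le> card H" using median_real_count[OF assms(1)] by (simp add: H_def)
  have "card (G \<union> H) \<le> card {1..R}" using assms(2) by (intro card_mono) (auto simp: H_def)
  moreover have "card G + card H = card (G \<union> H) + card (G \<inter> H)" using fin by (rule card_Un_Int)
  moreover have "R = 2 * (R div 2) + 1" using assms(1) by presburger
  ultimately have t: "t + 1 \<le> card (G \<inter> H)" using assms(3) H by simp
  have "real (t + 1) * (median_real R Z - a)\<^sup>2 \<le> real (card (G \<inter> H)) * (median_real R Z - a)\<^sup>2"
    using t by (intro mult_right_mono) auto
  also have "\<dots> = (\<Sum>r\<in>G \<inter> H. (median_real R Z - a)\<^sup>2)" by simp
  also have "\<dots> \<le> (\<Sum>r\<in>G \<inter> H. (Z r - a)\<^sup>2)"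
    by (intro sum_mono) (auto simp: H_def abs_le_square_iff)
  also have "\<dots> \<le> (\<Sum>r\<in>G. (Z r - a)\<^sup>2)" using fin by (intro sum_mono2) auto
  finally show ?thesis .
qed

lemma median_complex_square_le:
  fixes Z :: "nat \<Rightarrow> complex"
  assumes "odd R" "G \<subseteq> {1..R}" "R div 2 + 1 + t \<le> card G"
  shows "real (t + 1) * (cmod (median_complex R Z - a))\<^sup>2 \<le> (\<Sum>r\<in>G. (cmod (Z r - a))\<^sup>2)"
proof -
  have "real (t + 1) * (cmod (median_complex R Z - a))\<^sup>2 =
      real (t + 1) * (median_real R (\<lambda>r. Re (Z r)) - Re a)\<^sup>2 +
      real (t + 1) * (median_real R (\<lambda>r. Im (Z r)) - Im a)\<^sup>2"
    by (simp add: cmod_power2 median_complex_def ring_distribs)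
  also have "\<dots> \<le> (\<Sum>r\<in>G. (Re (Z r) - Re a)\<^sup>2) + (\<Sum>r\<in>G. (Im (Z r) - Im a)\<^sup>2)"
    by (intro add_mono median_real_square_le assms)
  also have "\<dots> = (\<Sum>r\<in>G. (cmod (Z r - a))\<^sup>2)"
    by (simp add: cmod_power2 sum.distrib)
  finally show ?thesis .
qed

text \<open>The finite inequality bounds all finite sums uniformly, so summability and the estimate
  come together. On all of \<open>int_vecs d\<close> this yields absolute convergence of the Fourier
  series, on an alias class the error of one coefficient.\<close>

lemma weighted_cauchy_schwarz_infsum:
  fixes a :: "'i \<Rightarrow> complex" and w :: "'i \<Rightarrow> real"
  assumes w: "\<And>k. k \<in> S \<Longrightarrow> w k > 0"
    and X: "(\<lambda>k. (cmod (a k))\<^sup>2 * w k) summable_on S"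
    and Y: "(\<lambda>k. inverse (w k)) summable_on S"
  shows "(\<lambda>k. cmod (a k)) summable_on S"
    and "(cmod (\<Sum>\<^sub>\<infinity>k\<in>S. a k))\<^sup>2 \<le> (\<Sum>\<^sub>\<infinity>k\<in>S. (cmod (a k))\<^sup>2 * w k) * (\<Sum>\<^sub>\<infinity>k\<in>S. inverse (w k))"
proof -
  let ?X = "\<Sum>\<^sub>\<infinity>k\<in>S. (cmod (a k))\<^sup>2 * w k" and ?Y = "\<Sum>\<^sub>\<infinity>k\<in>S. inverse (w k)"
  have fin: "(\<Sum>k\<in>F. cmod (a k)) \<le> sqrt (?X * ?Y)" if F: "finite F" "F \<subseteq> S" for F
  proof -
    have "(\<Sum>k\<in>F. cmod (a k)) = (\<Sum>k\<in>F. (cmod (a k) * sqrt (w k)) * inverse (sqrt (w k)))"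
      using F w by (intro sum.cong) force+
    hence "(\<Sum>k\<in>F. cmod (a k))\<^sup>2 \<le>
        (\<Sum>k\<in>F. (cmod (a k) * sqrt (w k))\<^sup>2) * (\<Sum>k\<in>F. (inverse (sqrt (w k)))\<^sup>2)"
      using Cauchy_Schwarz_ineq_sum by metis
    also have "(\<Sum>k\<in>F. (cmod (a k) * sqrt (w k))\<^sup>2) = (\<Sum>k\<in>F. (cmod (a k))\<^sup>2 * w k)"
      using F w by (intro sum.cong) (force simp: power_mult_distrib less_imp_le subset_iff)+
    also have "(\<Sum>k\<in>F. (inverse (sqrt (w k)))\<^sup>2) = (\<Sum>k\<in>F. inverse (w k))"
      using F w by (intro sum.cong) (force simp: power_inverse less_imp_le subset_iff)+
    also have "(\<Sum>k\<in>F. (cmod (a k))\<^sup>2 * w k) * (\<Sum>k\<in>F. inverse (w k)) \<le> ?X * ?Y"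
      using F w by (intro mult_mono finite_sum_le_infsum X Y sum_nonneg infsum_nonneg)
        (auto simp: less_imp_le subset_iff)
    finally show ?thesis by (rule real_le_rsqrt)
  qed
  show summ: "(\<lambda>k. cmod (a k)) summable_on S"
    by (rule nonneg_bdd_above_summable_on) (auto intro!: bdd_aboveI2[of _ _ "sqrt (?X * ?Y)"] fin)
  have "cmod (\<Sum>\<^sub>\<infinity>k\<in>S. a k) \<le> (\<Sum>\<^sub>\<infinity>k\<in>S. cmod (a k))"
    using summ by (rule norm_infsum_bound)
  also have "\<dots> \<le> sqrt (?X * ?Y)" by (rule infsum_le_finite_sums[OF summ fin])
  finally have "(cmod (\<Sum>\<^sub>\<infinity>k\<in>S. a k))\<^sup>2 \<le> (sqrt (?X * ?Y))\<^sup>2" by (intro power_mono) auto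
  also have "\<dots> = ?X * ?Y"
    using w by (intro real_sqrt_pow2 mult_nonneg_nonneg infsum_nonneg) (auto simp: less_imp_le)
  finally show "(cmod (\<Sum>\<^sub>\<infinity>k\<in>S. a k))\<^sup>2 \<le> ?X * ?Y" .
qed

section \<open>Aliasing on rank-1 lattices\<close>

text \<open>The difference \<open>k - h\<close> lies in the dual lattice of the rank-1 lattice
  generated by \<open>z\<close>; equivalently, both characters agree at all lattice points.\<close>

definition aliased :: "nat \<Rightarrow> nat \<Rightarrow> (nat \<Rightarrow> nat) \<Rightarrow> (nat \<Rightarrow> int) \<Rightarrow> (nat \<Rightarrow> int) \<Rightarrow> bool" where
  "aliased d N z h k \<longleftrightarrow> int N dvd (\<Sum>j=1..d. (k j - h j) * int (z j))"

lemma aliased_refl: "aliased d N z h h"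
  by (simp add: aliased_def)

text \<open>Alias classes are cosets, so classes sharing an element have aliased representatives.
  For good frequencies this is excluded, which makes their classes disjoint.\<close>

lemma aliased_common:
  assumes "aliased d N z h k" "aliased d N z h' k"
  shows "aliased d N z h h'"
proof -
  have "(\<Sum>j=1..d. (h' j - h j) * int (z j)) =
      (\<Sum>j=1..d. (k j - h j) * int (z j)) - (\<Sum>j=1..d. (k j - h' j) * int (z j))"
    by (simp add: ring_distribs flip: sum_subtractf)
  thus ?thesis using assms by (simp add: aliased_def)
qed

lemma lattice_point_in_cube:
  "(\<lambda>j\<in>{1..d}. frac (real k * real (z j) / real N)) \<in> space (cube d)"
  by (auto simp: space_cube frac_lt_1 less_imp_le)

lemma unit_exp_frac:
  "unit_exp d h (\<lambda>j\<in>{1..d}. frac (y j)) = unit_exp d h y"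
proof -
  have "cis (2 * pi * (h j * frac (y j))) = cis (2 * pi * (h j * y j))" for j
  proof -
    have "2 * pi * (h j * frac (y j)) = 2 * pi * (h j * y j) - 2 * pi * real_of_int (h j * \<lfloor>y j\<rfloor>)"
      by (simp add: frac_def algebra_simps)
    thus ?thesis
      by (metis cis_divide cis_multiple_2pi div_by_1 Ints_of_int)
  qed
  thus ?thesis unfolding unit_exp_prod by (intro prod.cong) auto
qed

lemma sum_roots_of_unity:
  fixes m :: int
  assumes "N > 0"
  shows "(\<Sum>k<N. cis (2 * pi * (real k * real_of_int m / real N))) = (if int N dvd m then of_nat N else 0)"
proof -
  define w where "w = cis (2 * pi * (real_of_int m / real N))"
  have pow: "cis (2 * pi * (real k * real_of_int m / real N)) = w ^ k" for k
    by (simp add: w_def Complex.DeMoivre mult_ac)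
  have w1: "w = 1 \<longleftrightarrow> int N dvd m"
  proof
    assume "w = 1"
    hence "cos (2 * pi * (real_of_int m / real N)) = 1" by (simp add: w_def complex_eq_iff)
    then obtain n :: int where "2 * pi * (real_of_int m / real N) = real_of_int n * 2 * pi"
      by (auto simp: cos_one_2pi_int)
    hence "real_of_int m = real_of_int (n * int N)" using assms by (simp add: field_simps)
    hence "m = n * int N" by linarith
    thus "int N dvd m" by simp
  next
    assume "int N dvd m"
    then obtain n where "m = int N * n" ..
    hence "real_of_int m / real N = of_int n" using assms by simp
    thus "w = 1" by (simp add: w_def cis_multiple_2pi)
  qed
  have "w ^ N = cis (2 * pi * real_of_int m)" using assms by (simp add: w_def Complex.DeMoivre)
  hence wN: "w ^ N = 1" by (simp add: cis_multiple_2pi)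
  show ?thesis
  proof (cases "int N dvd m")
    case True
    thus ?thesis unfolding pow using w1 by simp
  next
    case False
    thus ?thesis unfolding pow using w1 wN by (simp add: geometric_sum)
  qed
qed

lemma lattice_average_unit_exp:
  assumes "N > 0"
  shows "1 / of_nat N * (\<Sum>i<N. unit_exp d k (\<lambda>j. real i * real (z j) / real N) *
           cnj (unit_exp d h (\<lambda>j. real i * real (z j) / real N))) = (if aliased d N z h k then 1 else 0)"
proof -
  have "unit_exp d k (\<lambda>j. real i * real (z j) / real N) * cnj (unit_exp d h (\<lambda>j. real i * real (z j) / real N)) =
     cis (2 * pi * (real i * real_of_int (\<Sum>j=1..d. (k j - h j) * int (z j)) / real N))" for i
    unfolding unit_exp_diff[symmetric] unfolding unit_exp_cis dot_def
    by (simp add: sum_distrib_left sum_divide_distrib mult_ac)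
  thus ?thesis using assms by (simp only: sum_roots_of_unity aliased_def) auto
qed

lemma has_sum_sum:
  fixes f :: "'a \<Rightarrow> 'b \<Rightarrow> 'c :: topological_comm_monoid_add"
  assumes "\<And>i. i \<in> I \<Longrightarrow> (f i has_sum s i) A"
  shows "((\<lambda>k. \<Sum>i\<in>I. f i k) has_sum (\<Sum>i\<in>I. s i)) A"
  using assms by (induction I rule: infinite_finite_induct) (auto intro!: has_sum_add)

text \<open>Inserting the series at the lattice points and averaging, the geometric sum over the N
  points keeps exactly the frequencies aliased with \<open>h\<close>.\<close>

lemma has_sum_lattice_coeff:
  assumes N: "N > 0"
    and f: "\<And>x. x \<in> space (cube d) \<Longrightarrow> ((\<lambda>k. c k * unit_exp d k x) has_sum of_real (f x)) (int_vecs d)"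
  shows "(c has_sum lattice_coeff d N z f h) {k \<in> int_vecs d. aliased d N z h k}"
proof -
  define p where "p i = (\<lambda>j. real i * real (z j) / real N)" for i :: nat
  have "((\<lambda>k. 1 / of_nat N * (\<Sum>i<N. (c k * unit_exp d k (p i)) * cnj (unit_exp d h (p i)))) has_sum
     1 / of_nat N * (\<Sum>i<N. of_real (f (\<lambda>j\<in>{1..d}. frac (p i j))) * cnj (unit_exp d h (p i)))) (int_vecs d)"
  proof (intro has_sum_cmult_right has_sum_sum has_sum_cmult_left)
    fix i
    show "((\<lambda>k. c k * unit_exp d k (p i)) has_sum of_real (f (\<lambda>j\<in>{1..d}. frac (p i j)))) (int_vecs d)"
      using f[OF lattice_point_in_cube[where k = i and z = z and N = N]] by (simp only: p_def unit_exp_frac)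
  qed
  also have "1 / of_nat N * (\<Sum>i<N. of_real (f (\<lambda>j\<in>{1..d}. frac (p i j))) * cnj (unit_exp d h (p i))) =
      lattice_coeff d N z f h"
    by (simp add: lattice_coeff_def p_def unit_exp_def exp_cnj mult_ac)
  also have "(\<lambda>k. 1 / of_nat N * (\<Sum>i<N. (c k * unit_exp d k (p i)) * cnj (unit_exp d h (p i)))) =
      (\<lambda>k. c k * (1 / of_nat N * (\<Sum>i<N. unit_exp d k (p i) * cnj (unit_exp d h (p i)))))"
    by (simp add: sum_distrib_left mult_ac)
  also have "\<dots> = (\<lambda>k. if aliased d N z h k then c k else 0)"
    unfolding p_def lattice_average_unit_exp[OF N] by auto
  finally show ?thesis
    by (subst (asm) has_sum_cong_neutral[where T = "{k \<in> int_vecs d. aliased d N z h k}" and g = c]) auto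
qed

section \<open>Deterministic error bound for the median algorithm\<close>

definition good_index ::
    "nat \<Rightarrow> real \<Rightarrow> (nat \<Rightarrow> real) \<Rightarrow> real \<Rightarrow> nat \<Rightarrow> real \<Rightarrow> (nat \<Rightarrow> nat) \<Rightarrow> (nat \<Rightarrow> int) \<Rightarrow> bool" where
  "good_index d \<alpha> \<gamma> L N T z h \<longleftrightarrow>
     (\<forall>k\<in>freq_set d \<alpha> \<gamma> L. k \<noteq> h \<longrightarrow> \<not> aliased d N z h k) \<and>
     (\<Sum>\<^sub>\<infinity>k\<in>{k \<in> int_vecs d - freq_set d \<alpha> \<gamma> L. aliased d N z h k}. inverse (freq_fun d \<alpha> \<gamma> k)) \<le> T"

theorem median_lattice_error:
  fixes \<gamma> :: "nat \<Rightarrow> real"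
  assumes pos: "\<And>k. freq_fun d \<alpha> \<gamma> k > 0"
    and summ: "(\<lambda>k. inverse (freq_fun d \<alpha> \<gamma> k)) summable_on int_vecs d"
    and finA: "finite (freq_set d \<alpha> \<gamma> L)" and L: "L > 0" and R: "odd R" and N: "N > 0" and T: "T \<ge> 0"
    and good: "\<And>h. h \<in> freq_set d \<alpha> \<gamma> L \<Longrightarrow>
      R div 2 + 1 + t \<le> card {r \<in> {1..R}. good_index d \<alpha> \<gamma> L N T (zs r) h}"
  shows "wc_err d \<alpha> \<gamma> (median_lattice_alg d N R zs (freq_set d \<alpha> \<gamma> L))
    \<le> ereal (sqrt (L powr (-2 * \<alpha>) + real R / real (t + 1) * T))"
  unfolding wc_err_def
proof (rule SUP_least, clarify, subst ereal_less_eq)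
  fix f assume f: "f \<in> korobov d \<alpha> \<gamma>" and norm_f: "korobov_norm d \<alpha> \<gamma> f \<le> 1"
  define w where "w = freq_fun d \<alpha> \<gamma>"
  define A where "A = freq_set d \<alpha> \<gamma> L"
  define c where "c = fourier_coeff d f"
  note pos = pos[folded w_def] and summ = summ[folded w_def] and finA = finA[folded A_def]
  have A: "A \<subseteq> int_vecs d" by (auto simp: A_def freq_set_def)
  have en: "(\<lambda>k. (cmod (c k))\<^sup>2 * w k) summable_on int_vecs d"
    using f by (simp add: korobov_def c_def w_def)
  have en_sub: "(\<lambda>k. (cmod (c k))\<^sup>2 * w k) summable_on S" if "S \<subseteq> int_vecs d" for S
    using en that by (rule summable_on_subset_banach)
  have inv_sub: "(\<lambda>k. inverse (w k)) summable_on S" if "S \<subseteq> int_vecs d" for S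
    using summ that by (rule summable_on_subset_banach)
  have energy: "(\<Sum>\<^sub>\<infinity>k\<in>int_vecs d. (cmod (c k))\<^sup>2 * w k) \<le> 1"
    using norm_f by (simp add: korobov_norm_def c_def w_def)
  have energy_fin: "(\<Sum>k\<in>F. (cmod (c k))\<^sup>2 * w k) \<le> 1" if "finite F" "F \<subseteq> int_vecs d" for F
    using finite_sum_le_infsum[OF en that] energy pos by (simp add: less_imp_le)
  have abs_c: "(\<lambda>k. cmod (c k)) summable_on int_vecs d"
    using pos en summ by (intro weighted_cauchy_schwarz_infsum(1)[where w = w])
  have fser: "((\<lambda>k. c k * unit_exp d k x) has_sum of_real (f x)) (int_vecs d)" if "x \<in> space (cube d)" for x
    unfolding c_def using f that abs_c[unfolded c_def]
    by (intro continuous_eq_fourier_series) (auto simp: korobov_def)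
  define m where "m = median_coeff d N R zs f"
  \<comment> \<open>The coefficient sequence of the error; it is absolutely summable because only
    finitely many coefficients are modified.\<close>
  define b where "b k = c k - (if k \<in> A then m k else 0)" for k
  have "(\<lambda>k. cmod (c k) + (if k \<in> A then cmod (m k) else 0)) summable_on int_vecs d"
    using finA by (intro summable_on_add abs_c finite_nonzero_values_imp_summable_on) (auto elim: finite_subset[rotated])
  hence "(\<lambda>k. cmod (b k)) summable_on int_vecs d"
    by (rule summable_on_comparison_test) (auto simp: b_def norm_triangle_ineq4)
  then interpret B: abs_fourier_series d b by unfold_locales
  have alg: "of_real (f x) - median_lattice_alg d N R zs A f x = B.series x" if x: "x \<in> space (cube d)" for x
  proof -
    have "((\<lambda>k. if k \<in> A then m k * unit_exp d k x else 0) has_sum median_lattice_alg d N R zs A f x) (int_vecs d)"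
      using A finA by (intro has_sum_finite_neutralI[of A]) (auto simp: median_lattice_alg_def m_def unit_exp_def)
    note has_sum_add[OF fser[OF x] has_sum_uminusI[OF this]]
    moreover have "(\<lambda>k. c k * unit_exp d k x + - (if k \<in> A then m k * unit_exp d k x else 0)) =
        (\<lambda>k. b k * unit_exp d k x)"
      by (auto simp: b_def algebra_simps)
    ultimately have "((\<lambda>k. b k * unit_exp d k x) has_sum (of_real (f x) - median_lattice_alg d N R zs A f x)) (int_vecs d)"
      by simp
    thus ?thesis using B.has_sum_series has_sum_unique by blast
  qed
  have tail: "(\<Sum>k\<in>F - A. (cmod (b k))\<^sup>2) \<le> L powr (-2 * \<alpha>)" if F: "finite F" "F \<subseteq> int_vecs d" for F
  proof -
    have "(\<Sum>k\<in>F - A. (cmod (b k))\<^sup>2) \<le> (\<Sum>k\<in>F - A. L powr (-2 * \<alpha>) * ((cmod (c k))\<^sup>2 * w k))"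
    proof (rule sum_mono)
      fix k assume k: "k \<in> F - A"
      hence "L powr (2 * \<alpha>) \<le> w k" using F by (force simp: A_def freq_set_def w_def)
      hence "L powr (-2 * \<alpha>) * L powr (2 * \<alpha>) \<le> L powr (-2 * \<alpha>) * w k" by (intro mult_left_mono) auto
      hence "1 \<le> L powr (-2 * \<alpha>) * w k" using L by (simp flip: powr_add)
      hence "(cmod (c k))\<^sup>2 * 1 \<le> (cmod (c k))\<^sup>2 * (L powr (-2 * \<alpha>) * w k)" by (intro mult_left_mono) auto
      thus "(cmod (b k))\<^sup>2 \<le> L powr (-2 * \<alpha>) * ((cmod (c k))\<^sup>2 * w k)" using k by (simp add: b_def mult_ac)
    qed
    also have "\<dots> \<le> L powr (-2 * \<alpha>) * 1"
      unfolding sum_distrib_left[symmetric] using F by (intro mult_left_mono energy_fin) auto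
    finally show ?thesis by simp
  qed
  define G where "G h = {r \<in> {1..R}. good_index d \<alpha> \<gamma> L N T (zs r) h}" for h
  define K where "K r h = {k \<in> int_vecs d - A. aliased d N (zs r) h k}" for r h
  define X where "X r h = (\<Sum>\<^sub>\<infinity>k\<in>K r h. (cmod (c k))\<^sup>2 * w k)" for r h
  have K_sub: "K r h \<subseteq> int_vecs d" for r h by (auto simp: K_def)
  have X_nonneg: "X r h \<ge> 0" for r h unfolding X_def using pos by (intro infsum_nonneg) (simp add: less_imp_le)
  have err: "(cmod (lattice_coeff d N (zs r) f h - c h))\<^sup>2 \<le> X r h * T" if h: "h \<in> A" and r: "r \<in> G h" for r h
  proof -
    have g: "\<And>k. k \<in> A \<Longrightarrow> k \<noteq> h \<Longrightarrow> \<not> aliased d N (zs r) h k" "(\<Sum>\<^sub>\<infinity>k\<in>K r h. inverse (w k)) \<le> T"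
      using r by (auto simp: G_def good_index_def A_def K_def w_def)
    have "{k \<in> int_vecs d. aliased d N (zs r) h k} = insert h (K r h)"
      using h A g(1) by (auto simp: K_def aliased_refl)
    hence "(c has_sum lattice_coeff d N (zs r) f h) (insert h (K r h))"
      using has_sum_lattice_coeff[OF N fser, of "zs r" h] by simp
    hence 1: "infsum c (insert h (K r h)) = lattice_coeff d N (zs r) f h" by (rule infsumI)
    have "c summable_on K r h"
      by (rule abs_summable_summable[OF summable_on_subset_banach[OF abs_c K_sub]])
    hence "infsum c (insert h (K r h)) = c h + infsum c (K r h)"
      using h by (intro infsum_insert) (auto simp: K_def)
    hence "lattice_coeff d N (zs r) f h - c h = infsum c (K r h)" using 1 by simp
    hence "(cmod (lattice_coeff d N (zs r) f h - c h))\<^sup>2 \<le> X r h * (\<Sum>\<^sub>\<infinity>k\<in>K r h. inverse (w k))"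
      unfolding X_def using pos K_sub by (simp add: weighted_cauchy_schwarz_infsum(2) en_sub inv_sub)
    also have "\<dots> \<le> X r h * T" using g(2) X_nonneg by (intro mult_left_mono)
    finally show ?thesis .
  qed
  \<comment> \<open>For a fixed draw the sets \<open>K r h\<close> of good \<open>h\<close> are
    disjoint, so their energies add up to at most the squared norm of \<open>f\<close>.\<close>
  have X_sum: "(\<Sum>h\<in>{h \<in> A. r \<in> G h}. X r h) \<le> 1" for r
  proof -
    have disj: "K r h \<inter> K r h' = {}" if "h \<in> A" "h' \<in> A" "r \<in> G h" "h \<noteq> h'" for h h'
    proof -
      have "\<not> aliased d N (zs r) h h'" using that by (auto simp: G_def good_index_def A_def)
      thus ?thesis using aliased_common[of d N "zs r" h _ h'] by (auto simp: K_def)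
    qed
    have "((\<lambda>k. (cmod (c k))\<^sup>2 * w k) has_sum (\<Sum>h\<in>{h \<in> A. r \<in> G h}. X r h)) (\<Union>h\<in>{h \<in> A. r \<in> G h}. K r h)"
      using finA disj unfolding X_def by (intro sum_has_sum has_sum_infsum en_sub K_sub) auto
    moreover have "((\<lambda>k. (cmod (c k))\<^sup>2 * w k) has_sum (\<Sum>\<^sub>\<infinity>k\<in>int_vecs d. (cmod (c k))\<^sup>2 * w k)) (int_vecs d)"
      by (rule has_sum_infsum[OF en])
    ultimately have "(\<Sum>h\<in>{h \<in> A. r \<in> G h}. X r h) \<le> (\<Sum>\<^sub>\<infinity>k\<in>int_vecs d. (cmod (c k))\<^sup>2 * w k)"
      using pos K_sub by (elim has_sum_mono2) (auto simp: less_imp_le)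
    thus ?thesis using energy by simp
  qed
  have main: "(\<Sum>k\<in>A. (cmod (b k))\<^sup>2) \<le> real R / real (t + 1) * T"
  proof -
    have "real (t + 1) * (\<Sum>k\<in>A. (cmod (b k))\<^sup>2) = (\<Sum>h\<in>A. real (t + 1) * (cmod (m h - c h))\<^sup>2)"
      by (simp add: sum_distrib_left b_def norm_minus_commute)
    also have "\<dots> \<le> (\<Sum>h\<in>A. \<Sum>r\<in>G h. (cmod (lattice_coeff d N (zs r) f h - c h))\<^sup>2)"
      unfolding m_def median_coeff_def using good R
      by (intro sum_mono median_complex_square_le) (auto simp: G_def A_def)
    also have "\<dots> \<le> (\<Sum>h\<in>A. \<Sum>r\<in>G h. X r h * T)"
      by (intro sum_mono err)
    \<comment> \<open>Disjointness holds for each draw separately, so the sum over draws is moved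
      outside; each of the R draws then costs at most \<open>T\<close>.\<close>
    also have "\<dots> = (\<Sum>h\<in>A. \<Sum>r | r \<in> {1..R} \<and> r \<in> G h. X r h * T)"
      by (intro sum.cong refl) (auto simp: G_def)
    also have "\<dots> = (\<Sum>r\<in>{1..R}. \<Sum>h | h \<in> A \<and> r \<in> G h. X r h * T)"
      using finA by (intro sum.swap_restrict) auto
    also have "\<dots> \<le> (\<Sum>r\<in>{1..R}. 1 * T)"
      unfolding sum_distrib_right[symmetric] using X_sum T by (intro sum_mono mult_right_mono) auto
    also have "\<dots> = real R * T" by simp
    finally show ?thesis by (simp add: field_simps)
  qed
  have "(\<Sum>\<^sub>\<infinity>k\<in>int_vecs d. (cmod (b k))\<^sup>2) \<le> L powr (-2 * \<alpha>) + real R / real (t + 1) * T"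
  proof (rule infsum_le_finite_sums[OF B.norm_square_summable])
    fix F assume F: "finite F" "F \<subseteq> int_vecs d"
    have "(\<Sum>k\<in>F. (cmod (b k))\<^sup>2) = (\<Sum>k\<in>F - A. (cmod (b k))\<^sup>2) + (\<Sum>k\<in>F \<inter> A. (cmod (b k))\<^sup>2)"
      using F by (subst sum.union_disjoint[symmetric]) (auto intro: sum.cong)
    also have "(\<Sum>k\<in>F \<inter> A. (cmod (b k))\<^sup>2) \<le> (\<Sum>k\<in>A. (cmod (b k))\<^sup>2)"
      using finA by (intro sum_mono2) auto
    finally show "(\<Sum>k\<in>F. (cmod (b k))\<^sup>2) \<le> L powr (-2 * \<alpha>) + real R / real (t + 1) * T"
      using tail[OF F] main by linarith
  qed
  moreover have "L2_cube_norm d (\<lambda>x. of_real (f x) - median_lattice_alg d N R zs A f x) =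
      sqrt (\<Sum>\<^sub>\<infinity>k\<in>int_vecs d. (cmod (b k))\<^sup>2)"
    unfolding L2_cube_norm_def B.parseval[symmetric]
    by (intro arg_cong[of _ _ sqrt] Bochner_Integration.integral_cong) (auto simp: alg)
  ultimately show "L2_cube_norm d (\<lambda>x. of_real (f x) - median_lattice_alg d N R zs (freq_set d \<alpha> \<gamma> L) f x)
      \<le> sqrt (L powr (-2 * \<alpha>) + real R / real (t + 1) * T)"
    by (simp add: A_def)
qed

section \<open>Sums over hyperbolic crosses\<close>

text \<open>One step of the integral test, from the mean value theorem for x powr (1 - s); the
  differences telescope when summed.\<close>

lemma powr_neg_Suc_le:
  fixes s :: real
  assumes s: "s > 1" and n: "n \<ge> 1"
  shows "real (Suc n) powr (- s) \<le> (real n powr (1 - s) - real (Suc n) powr (1 - s)) / (s - 1)"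
proof -
  have "\<exists>z>real n. z < real (Suc n) \<and>
      real (Suc n) powr (1 - s) - real n powr (1 - s) = (real (Suc n) - real n) * ((1 - s) * z powr (1 - s - 1))"
    using n by (intro MVT2) (auto intro!: derivative_eq_intros simp: has_field_derivative_powr)
  then obtain z where z: "real n < z" "z < real (Suc n)"
      "real (Suc n) powr (1 - s) - real n powr (1 - s) = (1 - s) * z powr (- s)"
    by auto
  have "real (Suc n) powr (- s) \<le> z powr (- s)"
    using z n s by (intro powr_mono2') auto
  also have "\<dots> = (real n powr (1 - s) - real (Suc n) powr (1 - s)) / (s - 1)"
    using z(3) s by (simp add: field_simps)
  finally show ?thesis .
qed

lemma sum_powr_neg_le:
  fixes s :: real
  assumes s: "s > 1" and m: "m \<ge> 1"
  shows "(\<Sum>n=m..M. real n powr (- s)) \<le> real m powr (- s) + real m powr (1 - s) / (s - 1)"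
proof (cases "m \<le> M")
  case True
  hence "(\<Sum>n=m..M. real n powr (- s)) \<le>
      real m powr (- s) + (real m powr (1 - s) - real M powr (1 - s)) / (s - 1)"
  proof (induction M rule: dec_induct)
    case (step M)
    have "(\<Sum>n=m..Suc M. real n powr (- s)) = (\<Sum>n=m..M. real n powr (- s)) + real (Suc M) powr (- s)"
      using step.hyps by (simp add: sum.nat_ivl_Suc')
    also have "\<dots> \<le> real m powr (- s) + (real m powr (1 - s) - real M powr (1 - s)) / (s - 1) +
        (real M powr (1 - s) - real (Suc M) powr (1 - s)) / (s - 1)"
      using step m by (intro add_mono powr_neg_Suc_le[OF s]) auto
    finally show ?case by (simp add: diff_divide_distrib)
  qed simp
  also have "\<dots> \<le> real m powr (- s) + real m powr (1 - s) / (s - 1)"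
    using s by (simp add: divide_right_mono)
  finally show ?thesis .
next
  case False
  thus ?thesis using s by simp
qed

lemma sum_powr_neg_from_1_le:
  fixes s :: real
  assumes "s > 1"
  shows "(\<Sum>n=1..M. real n powr (- s)) \<le> 1 + 1 / (s - 1)"
  using sum_powr_neg_le[OF assms, of 1 M] by simp

text \<open>The hypothesis on \<phi> in \<open>sum_rho_line_bound\<close> for the indicator of x <
  1. The count is at most y and vanishes for y < 1, so raising the exponent to 1 + e is harmless; it
  makes the sums over the other coordinates converge.\<close>

lemma sum_count_below_le:
  assumes "y > 0" "e \<ge> 0"
  shows "(\<Sum>n=1..M. if real n / y < 1 then 1 else 0) \<le> 1 * y powr (1 + e)"
proof -
  have "{n \<in> {1..M}. real n < y} \<subseteq> {1..nat \<lfloor>y\<rfloor>}" by (auto simp: le_nat_iff le_floor_iff)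
  hence c: "card {n \<in> {1..M}. real n < y} \<le> nat \<lfloor>y\<rfloor>" using card_mono[of "{1..nat \<lfloor>y\<rfloor>}"] by simp
  have "(\<Sum>n=1..M. if real n / y < 1 then 1 else 0) = real (card {n \<in> {1..M}. real n < y})"
    using assms by (simp add: sum.If_cases Int_def)
  also have "\<dots> \<le> y powr (1 + e)"
  proof (cases "y \<ge> 1")
    case True
    have "real (card {n \<in> {1..M}. real n < y}) \<le> real (nat \<lfloor>y\<rfloor>)" using c by simp
    also have "\<dots> \<le> y powr 1" using True by simp
    also have "\<dots> \<le> y powr (1 + e)" using True assms by (intro powr_mono) auto
    finally show ?thesis .
  next
    case False
    hence "{n \<in> {1..M}. real n < y} = {}" by auto
    thus ?thesis by (simp only: card.empty) simp
  qed
  finally show ?thesis by simp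
qed

text \<open>The companion for x powr (-s) on x \<ge> 1. For y < 1 the whole series remains and is of
  order y powr s, whence the restriction e \<le> s - 1.\<close>

lemma sum_tail_above_le:
  fixes s :: real
  assumes s: "s > 1" and y: "y > 0" and e: "e \<ge> 0" "e \<le> s - 1"
  shows "(\<Sum>n=1..M. if 1 \<le> real n / y then (real n / y) powr (- s) else 0) \<le> (1 + 1 / (s - 1)) * y powr (1 + e)"
proof -
  define m where "m = max 1 (nat \<lceil>y\<rceil>)"
  have m: "m \<ge> 1" "real m \<ge> y" using real_nat_ceiling_ge[of y] by (auto simp: m_def of_nat_max max_def)
  have "(\<Sum>n=1..M. if 1 \<le> real n / y then (real n / y) powr (- s) else 0) =
      (\<Sum>n | n \<in> {1..M} \<and> y \<le> real n. (real n / y) powr (- s))"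
    using y by (simp add: sum.If_cases Int_def)
  also have "{n. n \<in> {1..M} \<and> y \<le> real n} = {m..M}"
    by (auto simp: m_def nat_le_iff ceiling_le_iff)
  also have "(\<Sum>n\<in>{m..M}. (real n / y) powr (- s)) = y powr s * (\<Sum>n=m..M. real n powr (- s))"
    unfolding sum_distrib_left using y
    by (intro sum.cong) (auto simp: powr_divide powr_minus field_simps)
  also have "\<dots> \<le> y powr s * (real m powr (- s) + real m powr (1 - s) / (s - 1))"
    using m by (intro mult_left_mono sum_powr_neg_le s) auto
  also have "\<dots> \<le> (1 + 1 / (s - 1)) * y powr (1 + e)"
  proof (cases "y \<ge> 1")
    case True
    have "real m powr (- s) \<le> y powr (- s)" using m y s by (intro powr_mono2') auto
    also have "\<dots> \<le> y powr (1 - s)" using True by (intro powr_mono) auto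
    finally have "real m powr (- s) \<le> y powr (1 - s)" .
    moreover have "real m powr (1 - s) \<le> y powr (1 - s)" using m y s by (intro powr_mono2') auto
    ultimately have "y powr s * (real m powr (- s) + real m powr (1 - s) / (s - 1)) \<le>
        y powr s * (y powr (1 - s) + y powr (1 - s) / (s - 1))"
      using s by (intro mult_left_mono add_mono divide_right_mono) auto
    also have "\<dots> = (1 + 1 / (s - 1)) * (y powr s * y powr (1 - s))" by (simp add: field_simps)
    also have "y powr s * y powr (1 - s) = y powr 1" using y by (simp flip: powr_add)
    also have "(1 + 1 / (s - 1)) * y powr 1 \<le> (1 + 1 / (s - 1)) * y powr (1 + e)"
      using True e s by (intro mult_left_mono powr_mono) auto
    finally show ?thesis .
  next
    case False
    hence "\<lceil>y\<rceil> \<le> 1" by (simp add: ceiling_le_iff)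
    hence "m = 1" by (auto simp: m_def)
    have "y powr s \<le> y powr (1 + e)" using False y e by (intro powr_mono') auto
    hence "(1 + 1 / (s - 1)) * y powr s \<le> (1 + 1 / (s - 1)) * y powr (1 + e)"
      using s by (intro mult_left_mono) auto
    thus ?thesis using \<open>m = 1\<close> by (simp add: mult.commute)
  qed
  finally show ?thesis .
qed

lemma sum_symmetric_int:
  fixes f :: "int \<Rightarrow> 'a::comm_semiring_1"
  assumes "\<And>n. f (- n) = f n"
  shows "(\<Sum>n\<in>{- int M..int M}. f n) = f 0 + 2 * (\<Sum>n=1..M. f (int n))"
proof -
  have "{- int M..int M} = insert 0 (int ` {1..M} \<union> (\<lambda>n. - int n) ` {1..M})"
  proof (intro equalityI subsetI)
    fix n assume n: "n \<in> {- int M..int M}"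
    show "n \<in> insert 0 (int ` {1..M} \<union> (\<lambda>n. - int n) ` {1..M})"
      using n by (cases n rule: int_cases2) (auto simp: image_iff)
  qed auto
  also have "(\<Sum>n\<in>\<dots>. f n) = f 0 + ((\<Sum>n\<in>int ` {1..M}. f n) + (\<Sum>n\<in>(\<lambda>n. - int n) ` {1..M}. f n))"
    by (subst sum.insert, simp, force, subst sum.union_disjoint) auto
  also have "(\<Sum>n\<in>int ` {1..M}. f n) = (\<Sum>n=1..M. f (int n))"
    by (subst sum.reindex) (auto simp: inj_on_def)
  also have "(\<Sum>n\<in>(\<lambda>n. - int n) ` {1..M}. f n) = (\<Sum>n=1..M. f (int n))"
    by (subst sum.reindex) (auto simp: inj_on_def assms)
  finally show ?thesis by (simp add: mult_2)
qed

text \<open>With g j = \<gamma> j powr (1 / (2 \<alpha>)) and I = {1..d} this is the 2\<alpha>-th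
  root of \<open>freq_fun\<close>. The index set is free for the sake of induction, and g = 1 gives
  an unweighted majorant.\<close>

definition rho :: "nat set \<Rightarrow> (nat \<Rightarrow> real) \<Rightarrow> (nat \<Rightarrow> int) \<Rightarrow> real" where
  "rho I g k = (\<Prod>j\<in>I. if k j = 0 then 1 else \<bar>real_of_int (k j)\<bar> / g j)"

lemma rho_pos: "(\<And>j. j \<in> I \<Longrightarrow> g j > 0) \<Longrightarrow> rho I g k > 0"
  unfolding rho_def by (intro prod_pos) auto

text \<open>The box sum factors into one-dimensional sums. \<open>Z\<close> is any bound for the
  partial sums of zeta(s), so that explicit values such as 1 + \<tau> ln L can be
  substituted.\<close>

lemma sum_rho_powr_le:
  assumes I: "finite I" and g: "\<And>j. j \<in> I \<Longrightarrow> g j > 0"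
    and Z: "\<And>M. (\<Sum>n=1..M. real n powr (- s)) \<le> Z"
  shows "(\<Sum>k\<in>I \<rightarrow>\<^sub>E {- int M..int M}. rho I g k powr (- s)) \<le> (\<Prod>j\<in>I. 1 + 2 * g j powr s * Z)"
proof -
  define v where "v j n = (if n = 0 then 1 else \<bar>real_of_int n\<bar> / g j) powr (- s)" for j and n :: int
  have v: "(\<Sum>n\<in>{- int M..int M}. v j n) \<le> 1 + 2 * g j powr s * Z" if "j \<in> I" for j
  proof -
    have "(\<Sum>n\<in>{- int M..int M}. v j n) = 1 + 2 * (\<Sum>n=1..M. g j powr s * real n powr (- s))"
      using g[OF that] by (subst sum_symmetric_int)
        (auto simp: v_def powr_divide powr_minus field_simps intro!: sum.cong)
    also have "\<dots> \<le> 1 + 2 * (g j powr s * Z)"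
      unfolding sum_distrib_left[symmetric] using Z by (intro add_mono mult_left_mono) auto
    finally show ?thesis by simp
  qed
  have "rho I g k powr (- s) = (\<Prod>j\<in>I. v j (k j))" for k
    unfolding rho_def v_def
    by (subst prod_powr_distrib[symmetric]) (use g in \<open>auto simp: less_imp_le\<close>)
  hence "(\<Sum>k\<in>I \<rightarrow>\<^sub>E {- int M..int M}. rho I g k powr (- s)) = (\<Prod>j\<in>I. \<Sum>n\<in>{- int M..int M}. v j n)"
    using I by (simp add: prod_sum_PiE)
  also have "\<dots> \<le> (\<Prod>j\<in>I. 1 + 2 * g j powr s * Z)"
    using v by (intro prod_mono) (auto simp: v_def intro!: sum_nonneg)
  finally show ?thesis .
qed

text \<open>
  The factor \<open>1 / Z\<close> comes from summing over the last nonzero coordinate directly with the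
  bound on \<open>\<phi>\<close> and only over the remaining coordinates with the zeta-type bound \<open>Z\<close>.
\<close>

lemma sum_rho_line_bound:
  fixes \<phi> :: "real \<Rightarrow> real"
  assumes I: "finite I" and g: "\<And>j. j \<in> I \<Longrightarrow> g j > 0" and L: "L > 0" and D: "D \<ge> 0" and Z0: "Z > 0"
    and \<phi>: "\<And>y M. y > 0 \<Longrightarrow> (\<Sum>n=1..M. \<phi> (real n / y)) \<le> D * y powr s"
    and Z: "\<And>M. (\<Sum>n=1..M. real n powr (- s)) \<le> Z"
  shows "(\<Sum>k\<in>I \<rightarrow>\<^sub>E {- int M..int M}. if \<exists>j\<in>I. k j \<noteq> 0 then \<phi> (rho I g k / L) else 0)
     \<le> D * L powr s / Z * ((\<Prod>j\<in>I. 1 + 2 * g j powr s * Z) - 1)"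
  using I g
proof (induction I)
  case empty
  show ?case by simp
next
  case (insert j I)
  define B where "B = {- int M..int M}"
  have gj: "g j > 0" using insert.prems by simp
  have rpos: "rho I g k > 0" for k using insert.prems by (intro rho_pos) auto
  let ?F = "\<lambda>n k. if n \<noteq> 0 \<or> (\<exists>i\<in>I. k i \<noteq> 0)
      then \<phi> ((if n = 0 then 1 else \<bar>real_of_int n\<bar> / g j) * rho I g k / L) else 0"
  have rho_upd: "rho (insert j I) g (k(j := n)) = (if n = 0 then 1 else \<bar>real_of_int n\<bar> / g j) * rho I g k" for n k
    unfolding rho_def using insert.hyps by (subst prod.insert) (auto intro!: arg_cong2[where f = times] prod.cong)
  have nz: "(\<exists>i\<in>insert j I. (k(j := n)) i \<noteq> 0) \<longleftrightarrow> n \<noteq> 0 \<or> (\<exists>i\<in>I. k i \<noteq> 0)" for n and k :: "nat \<Rightarrow> int"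
    using insert.hyps by auto
  have "(\<Sum>k\<in>insert j I \<rightarrow>\<^sub>E B. if \<exists>i\<in>insert j I. k i \<noteq> 0 then \<phi> (rho (insert j I) g k / L) else 0) =
      (\<Sum>(n, k)\<in>B \<times> (I \<rightarrow>\<^sub>E B). ?F n k)"
    unfolding PiE_insert_eq
    by (subst sum.reindex[OF inj_combinator[OF insert.hyps(2)]], rule sum.cong[OF refl])
       (clarify, simp only: prod.case rho_upd nz comp_def)
  also have "\<dots> = (\<Sum>n\<in>B. \<Sum>k\<in>I \<rightarrow>\<^sub>E B. ?F n k)" by (simp add: sum.cartesian_product)
  also have "\<dots> = (\<Sum>k\<in>I \<rightarrow>\<^sub>E B. \<Sum>n\<in>B. ?F n k)" by (rule sum.swap)
  also have "\<dots> = (\<Sum>k\<in>I \<rightarrow>\<^sub>E B. ?F 0 k + 2 * (\<Sum>n=1..M. ?F (int n) k))"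
    unfolding B_def by (intro sum.cong refl sum_symmetric_int) simp
  also have "\<dots> \<le> (\<Sum>k\<in>I \<rightarrow>\<^sub>E B. ?F 0 k + 2 * (D * (L powr s * g j powr s * rho I g k powr (- s))))"
  proof (intro sum_mono add_mono mult_left_mono order.refl)
    fix k
    \<comment> \<open>For fixed \<open>k\<close> the new coordinate n scales \<open>rho\<close> by n
      / g j, which leaves the one-dimensional sum with y = L g j / rho.\<close>
    have "(\<Sum>n=1..M. ?F (int n) k) = (\<Sum>n=1..M. \<phi> (real n / (L * g j / rho I g k)))"
      by (intro sum.cong) (auto simp: mult_ac)
    also have "\<dots> \<le> D * (L * g j / rho I g k) powr s"
      using rpos gj L by (intro \<phi>) auto
    also have "(L * g j / rho I g k) powr s = L powr s * g j powr s * rho I g k powr (- s)"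
      using rpos[of k] gj L by (simp add: powr_divide powr_mult powr_minus field_simps)
    finally show "(\<Sum>n=1..M. ?F (int n) k) \<le> D * (L powr s * g j powr s * rho I g k powr (- s))" .
  qed simp
  also have "\<dots> = (\<Sum>k\<in>I \<rightarrow>\<^sub>E B. ?F 0 k) + 2 * D * L powr s * g j powr s * (\<Sum>k\<in>I \<rightarrow>\<^sub>E B. rho I g k powr (- s))"
    by (simp add: sum.distrib sum_distrib_left mult_ac)
  also have "\<dots> \<le> D * L powr s / Z * ((\<Prod>j\<in>I. 1 + 2 * g j powr s * Z) - 1) +
      2 * D * L powr s * g j powr s * (\<Prod>j\<in>I. 1 + 2 * g j powr s * Z)"
  proof (intro add_mono mult_left_mono)
    show "(\<Sum>k\<in>I \<rightarrow>\<^sub>E B. ?F 0 k) \<le> D * L powr s / Z * ((\<Prod>j\<in>I. 1 + 2 * g j powr s * Z) - 1)"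
      using insert.IH insert.prems by (simp add: B_def cong: if_cong)
    show "(\<Sum>k\<in>I \<rightarrow>\<^sub>E B. rho I g k powr (- s)) \<le> (\<Prod>j\<in>I. 1 + 2 * g j powr s * Z)"
      unfolding B_def using insert.hyps(1) insert.prems by (intro sum_rho_powr_le Z) auto
  qed (use D in auto)
  \<comment> \<open>With p the product over \<open>I\<close> and a = \<open>g j powr s\<close>: (p -
    1) / Z + 2 a p = ((1 + 2 a Z) p - 1) / Z. The subtracted 1 lets the induction start from
    0.\<close>
  also have "\<dots> = D * L powr s / Z * ((\<Prod>j\<in>insert j I. 1 + 2 * g j powr s * Z) - 1)"
    using insert.hyps Z0 by (simp add: field_simps)
  finally show ?case by (simp add: B_def)
qed

section \<open>The frequency set\<close>

text \<open>Integral-test bound for zeta(2\<alpha>).\<close>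

definition zeta_bound :: "real \<Rightarrow> real" where
  "zeta_bound \<alpha> = 1 + 1 / (2 * \<alpha> - 1)"

text \<open>The first summand is the allowance for aliases that occur at random, doubled so that
  Markov's inequality leaves u/2; the second bounds the aliases congruent to \<open>h\<close> modulo
  N, which occur for every generating vector.\<close>

definition alias_const :: "nat \<Rightarrow> real \<Rightarrow> real" where
  "alias_const d \<alpha> = 2 * zeta_bound \<alpha> ^ Suc d + 2 powr (2 * \<alpha>) * (1 + 2 * zeta_bound \<alpha>) ^ d"

text \<open>Half of it is the sum of 2\<alpha> + 3 and ln (4 (1 + 2 zeta_bound \<alpha>)^d): the
  power of L and the constant to be absorbed in \<open>large_tau_estimates\<close>.\<close>

definition log_const :: "nat \<Rightarrow> real \<Rightarrow> real" where
  "log_const d \<alpha> = 2 * (2 * \<alpha> + 3) + 2 * ln (4 * (1 + 2 * zeta_bound \<alpha>) ^ d)"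

locale weighted_frequencies =
  fixes d :: nat and \<alpha> :: real and \<gamma> :: "nat \<Rightarrow> real"
  assumes alpha: "\<alpha> > 1 / 2" and gamma: "\<And>j. j \<ge> 1 \<Longrightarrow> 0 < \<gamma> j \<and> \<gamma> j \<le> 1"
begin

definition g :: "nat \<Rightarrow> real" where "g j = \<gamma> j powr (1 / (2 * \<alpha>))"

abbreviation \<kappa> :: real where "\<kappa> \<equiv> zeta_bound \<alpha>"

abbreviation w :: "(nat \<Rightarrow> int) \<Rightarrow> real" where "w \<equiv> freq_fun d \<alpha> \<gamma>"

lemma kappa_ge_1: "\<kappa> \<ge> 1" using alpha by (simp add: zeta_bound_def)

lemma g_bounds: "j \<ge> 1 \<Longrightarrow> 0 < g j" "j \<ge> 1 \<Longrightarrow> g j \<le> 1"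
  using gamma[of j] alpha by (auto simp: g_def intro: powr_le1)

lemma w_eq_rho: "w k = rho {1..d} g k powr (2 * \<alpha>)"
proof -
  have "rho {1..d} g k powr (2 * \<alpha>) = (\<Prod>j\<in>{1..d}. (if k j = 0 then 1 else \<bar>real_of_int (k j)\<bar> / g j) powr (2 * \<alpha>))"
    unfolding rho_def using g_bounds by (subst prod_powr_distrib) (auto simp: less_imp_le)
  also have "\<dots> = (\<Prod>j\<in>{1..d}. if k j \<noteq> 0 then inverse (\<gamma> j) * \<bar>real_of_int (k j)\<bar> powr (2 * \<alpha>) else 1)"
  proof (intro prod.cong refl)
    fix j assume "j \<in> {1..d}"
    hence "\<gamma> j > 0" using gamma by simp
    thus "(if k j = 0 then 1 else \<bar>real_of_int (k j)\<bar> / g j) powr (2 * \<alpha>) =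
        (if k j \<noteq> 0 then inverse (\<gamma> j) * \<bar>real_of_int (k j)\<bar> powr (2 * \<alpha>) else 1)"
      using alpha by (simp add: g_def powr_divide powr_powr field_simps)
  qed
  also have "\<dots> = (\<Prod>j\<in>supp d k. inverse (\<gamma> j) * \<bar>real_of_int (k j)\<bar> powr (2 * \<alpha>))"
    unfolding supp_def by (rule prod.inter_filter[symmetric]) simp
  also have "\<dots> = w k"
    using prod_inversef[of \<gamma> "supp d k"] by (simp add: freq_fun_def weight_def prod.distrib comp_def)
  finally show ?thesis ..
qed

lemma rho_factor_ge_1: "j \<ge> 1 \<Longrightarrow> 1 \<le> (if n = 0 then 1 else \<bar>real_of_int n\<bar> / g j)"
proof (cases "n = 0")
  case False
  assume "j \<ge> 1"
  hence "g j \<le> 1" "0 < g j" by (auto intro: g_bounds)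
  moreover have "1 \<le> \<bar>real_of_int n\<bar>" using False by linarith
  ultimately have "g j \<le> \<bar>real_of_int n\<bar>" by linarith
  thus ?thesis using False \<open>0 < g j\<close> by simp
qed simp

lemma rho_ge_component:
  assumes "j \<in> {1..d}" "k j \<noteq> 0"
  shows "\<bar>real_of_int (k j)\<bar> / g j \<le> rho {1..d} g k"
proof -
  have "\<bar>real_of_int (k j)\<bar> / g j * 1 \<le> \<bar>real_of_int (k j)\<bar> / g j *
      (\<Prod>i\<in>{1..d} - {j}. if k i = 0 then 1 else \<bar>real_of_int (k i)\<bar> / g i)"
    using assms g_bounds[of j] by (intro mult_left_mono prod_ge_1 rho_factor_ge_1) auto
  also have "\<dots> = rho {1..d} g k"
    unfolding rho_def using assms by (subst (2) prod.remove[of _ j]) auto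
  finally show ?thesis by simp
qed

lemma rho_g_pos: "rho {1..d} g k > 0"
  using g_bounds by (intro rho_pos) auto

lemma w_pos: "w k > 0"
  unfolding w_eq_rho using rho_g_pos[of k] by simp

lemma inverse_w: "inverse (w k) = rho {1..d} g k powr (- (2 * \<alpha>))"
  by (simp add: w_eq_rho powr_minus)

lemma zeta_2alpha_le: "(\<Sum>n=1..M. real n powr (- (2 * \<alpha>))) \<le> \<kappa>"
  unfolding zeta_bound_def using alpha by (intro sum_powr_neg_from_1_le) auto

text \<open>Unweighted, so that the resulting constants do not depend on \<gamma>.\<close>

lemma sum_rho_one_le:
  assumes "finite F" "F \<subseteq> int_vecs d"
  shows "(\<Sum>k\<in>F. rho {1..d} (\<lambda>_. 1) k powr (- (2 * \<alpha>))) \<le> (1 + 2 * \<kappa>) ^ d"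
proof -
  obtain M where M: "F \<subseteq> int_box d M" using finite_subset_int_box[OF assms] by blast
  have "(\<Sum>k\<in>F. rho {1..d} (\<lambda>_. 1) k powr (- (2 * \<alpha>))) \<le> (\<Sum>k\<in>int_box d M. rho {1..d} (\<lambda>_. 1) k powr (- (2 * \<alpha>)))"
    using M by (intro sum_mono2) auto
  also have "\<dots> \<le> (\<Prod>j\<in>{1..d}. 1 + 2 * 1 powr (2 * \<alpha>) * \<kappa>)"
    unfolding int_box_def by (intro sum_rho_powr_le zeta_2alpha_le) auto
  finally show ?thesis by simp
qed

lemma inverse_w_le_rho_one: "inverse (w k) \<le> rho {1..d} (\<lambda>_. 1) k powr (- (2 * \<alpha>))"
proof -
  have "rho {1..d} (\<lambda>_. 1) k \<le> rho {1..d} g k"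
    unfolding rho_def
  proof (intro prod_mono conjI)
    fix j assume "j \<in> {1..d}"
    hence "0 < g j" "g j \<le> 1" using g_bounds by auto
    thus "(if k j = 0 then 1 else \<bar>real_of_int (k j)\<bar> / 1) \<le> (if k j = 0 then 1 else \<bar>real_of_int (k j)\<bar> / g j)"
      by (auto simp: field_simps mult_left_le)
  qed auto
  thus ?thesis unfolding inverse_w using alpha by (intro powr_mono2' rho_pos) auto
qed

lemma inverse_w_summable: "(\<lambda>k. inverse (w k)) summable_on int_vecs d"
proof (rule nonneg_bdd_above_summable_on)
  show "bdd_above (sum (\<lambda>k. inverse (w k)) ` {F. F \<subseteq> int_vecs d \<and> finite F})"
  proof (rule bdd_aboveI2[of _ _ "(1 + 2 * \<kappa>) ^ d"])
    fix F assume F: "F \<in> {F. F \<subseteq> int_vecs d \<and> finite F}"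
    have "(\<Sum>k\<in>F. inverse (w k)) \<le> (\<Sum>k\<in>F. rho {1..d} (\<lambda>_. 1) k powr (- (2 * \<alpha>)))"
      by (intro sum_mono inverse_w_le_rho_one)
    also have "\<dots> \<le> (1 + 2 * \<kappa>) ^ d" using F by (intro sum_rho_one_le) auto
    finally show "(\<Sum>k\<in>F. inverse (w k)) \<le> (1 + 2 * \<kappa>) ^ d" .
  qed
qed (use w_pos in \<open>auto simp: less_imp_le\<close>)

lemma freq_set_eq:
  assumes "L > 0"
  shows "freq_set d \<alpha> \<gamma> L = {k \<in> int_vecs d. rho {1..d} g k < L}"
proof -
  have "rho {1..d} g k powr (2 * \<alpha>) < L powr (2 * \<alpha>) \<longleftrightarrow> rho {1..d} g k < L" for k
    using powr_less_mono2[of "2 * \<alpha>" "rho {1..d} g k" L] powr_mono2[of "2 * \<alpha>" L "rho {1..d} g k"]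
      rho_g_pos[of k] assms alpha by linarith
  thus ?thesis by (simp add: freq_set_def w_eq_rho)
qed

lemma freq_set_component:
  assumes "L > 0" "k \<in> freq_set d \<alpha> \<gamma> L" "j \<in> {1..d}" "k j \<noteq> 0"
  shows "\<bar>real_of_int (k j)\<bar> < L * g j"
proof -
  have "\<bar>real_of_int (k j)\<bar> / g j < L"
    using rho_ge_component[of j k] assms by (simp add: freq_set_eq)
  thus ?thesis using g_bounds(1)[of j] assms by (simp add: field_simps)
qed

lemma finite_freq_set:
  assumes "L > 0"
  shows "finite (freq_set d \<alpha> \<gamma> L)"
proof (rule finite_subset)
  show "freq_set d \<alpha> \<gamma> L \<subseteq> int_box d (nat \<lceil>L\<rceil>)"
  proof
    fix k assume k: "k \<in> freq_set d \<alpha> \<gamma> L"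
    have "- int (nat \<lceil>L\<rceil>) \<le> k j \<and> k j \<le> int (nat \<lceil>L\<rceil>)" if j: "j \<in> {1..d}" for j
    proof (cases "k j = 0")
      case False
      have "\<bar>real_of_int (k j)\<bar> < L * g j" using freq_set_component[OF assms k j False] .
      also have "\<dots> \<le> L" using g_bounds[of j] j assms by (simp add: mult_left_le)
      finally have "real_of_int \<bar>k j\<bar> \<le> real_of_int \<lceil>L\<rceil>" by linarith
      hence "\<bar>k j\<bar> \<le> \<lceil>L\<rceil>" by (simp only: of_int_le_iff)
      thus ?thesis by linarith
    qed auto
    moreover have "k \<in> int_vecs d" using k by (simp add: freq_set_def)
    ultimately show "k \<in> int_box d (nat \<lceil>L\<rceil>)" by (auto simp: int_box_def int_vecs_def PiE_iff)
  qed
qed simp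

definition zero_vec :: "nat \<Rightarrow> int" where "zero_vec = (\<lambda>j\<in>{1..d}. 0)"

lemma rho_zero: "(\<And>j. j \<in> {1..d} \<Longrightarrow> k j = 0) \<Longrightarrow> rho {1..d} g k = 1"
  by (simp add: rho_def)

lemma zero_vec_in_freq_set: "L > 1 \<Longrightarrow> zero_vec \<in> freq_set d \<alpha> \<gamma> L"
  using rho_zero[of zero_vec] by (subst freq_set_eq) (auto simp: zero_vec_def int_vecs_def)

end

section \<open>The threshold, the size of the frequency set and the tail outside it\<close>

locale median_lattice_setting = weighted_frequencies +
  fixes \<tau> :: real and N :: nat
  assumes tau: "\<tau> > 0" and prime_N: "prime N" and odd_N: "odd N" and N2_gt_1: "N2 N d \<tau> \<alpha> \<gamma> > 1"
begin

abbreviation L :: real where "L \<equiv> N2 N d \<tau> \<alpha> \<gamma>"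

definition u :: real where "u = 1 / (1 + \<tau> * ln L)"

abbreviation A :: "(nat \<Rightarrow> int) set" where "A \<equiv> freq_set d \<alpha> \<gamma> L"

lemma N_ge_3: "N \<ge> 3"
  using prime_ge_2_nat[OF prime_N] odd_N by (cases "N = 2") auto

lemma ln_N_ge_1: "ln (real N) \<ge> 1"
proof -
  have "exp 1 \<le> (3::real)" by (rule exp_le)
  also have "\<dots> \<le> real N" using N_ge_3 by simp
  finally show ?thesis using N_ge_3 by (subst ln_ge_iff) auto
qed

lemma P_bound_eq: "P_bound N d \<tau> \<alpha> \<gamma> = (\<Prod>j=1..d. 1 + 2 * g j * (1 + \<tau> * ln (real N)))"
  by (simp add: P_bound_def g_def)

lemma P_factor_ge_1: "j \<in> {1..d} \<Longrightarrow> 1 \<le> 1 + 2 * g j * (1 + \<tau> * ln (real N))"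
  using g_bounds[of j] tau ln_N_ge_1 by simp

lemma P_bound_ge_1: "P_bound N d \<tau> \<alpha> \<gamma> \<ge> 1"
  unfolding P_bound_eq by (intro prod_ge_1 P_factor_ge_1)

lemma L_identity: "L * exp (1 / \<tau>) * P_bound N d \<tau> \<alpha> \<gamma> = real N - 1"
  using P_bound_ge_1 by (simp add: N2_def)

lemma L_P_le: "L * P_bound N d \<tau> \<alpha> \<gamma> \<le> real N - 1"
proof -
  have "L * 1 * P_bound N d \<tau> \<alpha> \<gamma> \<le> L * exp (1 / \<tau>) * P_bound N d \<tau> \<alpha> \<gamma>"
    using N2_gt_1 P_bound_ge_1 tau by (intro mult_right_mono mult_left_mono) auto
  thus ?thesis using L_identity by simp
qed

lemma L_le_N: "L \<le> real N - 1"
proof -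
  have "L * 1 \<le> L * P_bound N d \<tau> \<alpha> \<gamma>" using N2_gt_1 P_bound_ge_1 by (intro mult_left_mono) auto
  thus ?thesis using L_P_le by simp
qed

lemma ln_L: "0 < ln L" "ln L \<le> ln (real N)"
  using N2_gt_1 L_le_N by auto

lemma u_bounds: "0 < u" "u < 1"
  using mult_pos_pos[OF tau ln_L(1)] by (simp_all add: u_def)

text \<open>A single factor of \<open>P_bound\<close> is at least 2 g j, so 2 L g j \<le> N - 1.
  Hence distinct elements of \<open>A\<close> stay distinct modulo N, and shifting one by a nonzero
  multiple of N leads far from 0.\<close>

lemma freq_set_component_half:
  assumes k: "k \<in> A" and j: "j \<in> {1..d}"
  shows "2 * \<bar>real_of_int (k j)\<bar> < real N"
proof (cases "k j = 0")
  case True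
  thus ?thesis using N_ge_3 by simp
next
  case False
  have "1 + 2 * g j * (1 + \<tau> * ln (real N)) \<le> P_bound N d \<tau> \<alpha> \<gamma>"
  proof -
    have "(1 + 2 * g j * (1 + \<tau> * ln (real N))) * 1 \<le> (1 + 2 * g j * (1 + \<tau> * ln (real N))) *
        (\<Prod>i\<in>{1..d} - {j}. 1 + 2 * g i * (1 + \<tau> * ln (real N)))"
      using P_factor_ge_1 P_factor_ge_1[OF j] by (intro mult_left_mono prod_ge_1) auto
    also have "\<dots> = P_bound N d \<tau> \<alpha> \<gamma>" unfolding P_bound_eq using j by (subst (2) prod.remove[of _ j]) auto
    finally show ?thesis by simp
  qed
  moreover have "0 \<le> 2 * g j * (\<tau> * ln (real N))" using g_bounds[of j] j tau ln_N_ge_1 by simp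
  ultimately have "2 * g j \<le> P_bound N d \<tau> \<alpha> \<gamma>"
    unfolding distrib_left by linarith
  hence "L * (2 * g j) \<le> L * P_bound N d \<tau> \<alpha> \<gamma>" using N2_gt_1 by (intro mult_left_mono) auto
  moreover have "\<bar>real_of_int (k j)\<bar> < L * g j"
    using freq_set_component[OF _ k j False] N2_gt_1 by simp
  ultimately show ?thesis using L_P_le by linarith
qed

text \<open>Turns the output of \<open>sum_rho_line_bound\<close> into u (N - 1): the bound on e
  gives L powr e \<le> exp (1/\<tau>), each factor is at most c times one of \<open>P_bound\<close>,
  \<open>L_identity\<close> collects everything, and the saved 1/Z becomes u. The slack c serves the
  case where e must be smaller than 1 / (\<tau> ln L).\<close>

lemma line_bound_P:
  assumes e: "0 < e" "e \<le> 1 / (\<tau> * ln L)" and Z: "1 + \<tau> * ln L \<le> Z" "Z \<le> c * (1 + \<tau> * ln L)" and c: "c \<ge> 1"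
    and D: "D \<ge> 0"
  shows "D * L powr (1 + e) / Z * ((\<Prod>j\<in>{1..d}. 1 + 2 * g j powr (1 + e) * Z) - 1) \<le> D * c ^ d * u * (real N - 1)"
proof -
  have Zpos: "Z > 0" using Z(1) tau ln_L by (smt (verit) mult_pos_pos)
  have "L powr e \<le> L powr (1 / (\<tau> * ln L))" using e N2_gt_1 by (intro powr_mono) auto
  also have "\<dots> = exp (1 / \<tau>)" using N2_gt_1 tau ln_L by (simp add: powr_def)
  finally have Le: "L powr (1 + e) \<le> L * exp (1 / \<tau>)" using N2_gt_1 by (simp add: powr_add)
  have "(\<Prod>j\<in>{1..d}. 1 + 2 * g j powr (1 + e) * Z) \<le> (\<Prod>j\<in>{1..d}. c * (1 + 2 * g j * (1 + \<tau> * ln (real N))))"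
  proof (intro prod_mono conjI)
    fix j assume j: "j \<in> {1..d}"
    have g: "0 < g j" "g j \<le> 1" using g_bounds j by auto
    show "0 \<le> 1 + 2 * g j powr (1 + e) * Z" using Zpos by simp
    have "g j powr (1 + e) \<le> g j powr 1" using g e by (intro powr_mono') auto
    hence "g j powr (1 + e) * Z \<le> g j * (c * (1 + \<tau> * ln L))"
      using g Z Zpos by (intro mult_mono) auto
    also have "\<dots> \<le> g j * (c * (1 + \<tau> * ln (real N)))"
      using g c tau ln_L by (intro mult_left_mono add_left_mono) auto
    finally show "1 + 2 * g j powr (1 + e) * Z \<le> c * (1 + 2 * g j * (1 + \<tau> * ln (real N)))"
      using c by (simp add: algebra_simps)
  qed
  also have "\<dots> = c ^ d * P_bound N d \<tau> \<alpha> \<gamma>" unfolding P_bound_eq by (simp add: prod.distrib)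
  finally have P: "(\<Prod>j\<in>{1..d}. 1 + 2 * g j powr (1 + e) * Z) - 1 \<le> c ^ d * P_bound N d \<tau> \<alpha> \<gamma>" by simp
  have "0 < 1 + \<tau> * ln L" using mult_pos_pos[OF tau ln_L(1)] by linarith
  hence "1 / Z \<le> u" unfolding u_def using Z Zpos by (intro divide_left_mono mult_pos_pos) auto
  hence "(D * L powr (1 + e)) * (1 / Z) \<le> (D * (L * exp (1 / \<tau>))) * u"
    using D Le Zpos N2_gt_1 by (intro mult_mono mult_left_mono) auto
  moreover have "(\<Prod>j\<in>{1..d}. 1 + 2 * g j powr (1 + e) * Z) \<ge> 1"
    using Zpos by (intro prod_ge_1) auto
  ultimately have "D * L powr (1 + e) / Z * ((\<Prod>j\<in>{1..d}. 1 + 2 * g j powr (1 + e) * Z) - 1) \<le>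
      D * (L * exp (1 / \<tau>)) * u * (c ^ d * P_bound N d \<tau> \<alpha> \<gamma>)"
    using P D N2_gt_1 u_bounds by (intro mult_mono) auto
  also have "\<dots> = D * c ^ d * u * (L * exp (1 / \<tau>) * P_bound N d \<tau> \<alpha> \<gamma>)" by simp
  finally show ?thesis unfolding L_identity .
qed

lemma tau_ln_L_pos: "\<tau> * ln L > 0"
  using tau ln_L by simp

text \<open>The left side counts the nonzero elements of \<open>A\<close>, and equally the possible
  collision partners of a fixed frequency.\<close>

lemma card_freq_set_le: "real (card A) - 1 \<le> u * (real N - 1)"
proof -
  \<comment> \<open>The largest e with L powr e \<le> exp (1/\<tau>); it makes 1 + 1/e equal to 1 +
    \<tau> ln L.\<close>
  define e where "e = 1 / (\<tau> * ln L)"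
  have e: "e > 0" using tau_ln_L_pos by (simp add: e_def)
  have L0: "L > 0" using N2_gt_1 by simp
  let ?\<phi> = "\<lambda>x::real. if x < 1 then 1 else 0 :: real"
  obtain M where M: "A \<subseteq> int_box d M"
    using finite_subset_int_box[OF finite_freq_set[OF L0]] by (auto simp: freq_set_def)
  have "real (card (A - {zero_vec})) = (\<Sum>k\<in>A - {zero_vec}. 1)" by simp
  also have "\<dots> = (\<Sum>k\<in>A - {zero_vec}. if \<exists>j\<in>{1..d}. k j \<noteq> 0 then ?\<phi> (rho {1..d} g k / L) else 0)"
  proof (intro sum.cong refl)
    fix k assume k: "k \<in> A - {zero_vec}"
    have "\<exists>j\<in>{1..d}. k j \<noteq> 0"
    proof (rule ccontr)
      assume "\<not> ?thesis"
      hence "k = zero_vec"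
        using k by (intro int_vecs_eqI[of _ d]) (auto simp: freq_set_def zero_vec_def int_vecs_def)
      thus False using k by simp
    qed
    moreover have "rho {1..d} g k / L < 1" using k L0 by (simp add: freq_set_eq)
    ultimately show "1 = (if \<exists>j\<in>{1..d}. k j \<noteq> 0 then ?\<phi> (rho {1..d} g k / L) else 0)" by simp
  qed
  also have "\<dots> \<le> (\<Sum>k\<in>int_box d M. if \<exists>j\<in>{1..d}. k j \<noteq> 0 then ?\<phi> (rho {1..d} g k / L) else 0)"
    using M by (intro sum_mono2) auto
  also have "\<dots> \<le> 1 * L powr (1 + e) / (1 + \<tau> * ln L) * ((\<Prod>j\<in>{1..d}. 1 + 2 * g j powr (1 + e) * (1 + \<tau> * ln L)) - 1)"
    unfolding int_box_def
  proof (rule sum_rho_line_bound)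
    show "(\<Sum>n=1..M. ?\<phi> (real n / y)) \<le> 1 * y powr (1 + e)" if "y > 0" for y M
      using that e by (intro sum_count_below_le) auto
    show "(\<Sum>n=1..M. real n powr (- (1 + e))) \<le> 1 + \<tau> * ln L" for M
      using sum_powr_neg_from_1_le[of "1 + e" M] e by (simp add: e_def)
  qed (use L0 g_bounds tau_ln_L_pos in auto)
  also have "\<dots> \<le> 1 * 1 ^ d * u * (real N - 1)"
    using e by (intro line_bound_P) (auto simp: e_def)
  finally have "real (card (A - {zero_vec})) \<le> u * (real N - 1)" by simp
  moreover have "card (A - {zero_vec}) = card A - 1" "card A \<ge> 1"
    using zero_vec_in_freq_set[OF N2_gt_1] finite_freq_set[OF L0] by (auto simp: Suc_le_eq card_gt_0_iff)
  ultimately show ?thesis by (simp add: of_nat_diff)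
qed

lemma tail_sum_le:
  assumes F: "finite F" "F \<subseteq> int_vecs d - A"
  shows "(\<Sum>k\<in>F. inverse (w k)) \<le> \<kappa> ^ Suc d * u * (real N - 1) * L powr (- (2 * \<alpha>))"
proof -
  \<comment> \<open>The minimum meets the restriction in \<open>sum_tail_above_le\<close>. It may
    raise 1 + 1/e, but only up to \<kappa> (1 + \<tau> ln L), which accounts for d of the factors
    \<kappa>; the last one is the constant of the one-dimensional tail.\<close>
  define e where "e = min (1 / (\<tau> * ln L)) (2 * \<alpha> - 1)"
  have e: "e > 0" "e \<le> 1 / (\<tau> * ln L)" "e \<le> 2 * \<alpha> - 1" using tau_ln_L_pos alpha by (auto simp: e_def)
  have L0: "L > 0" using N2_gt_1 by simp
  let ?\<phi> = "\<lambda>x::real. if 1 \<le> x then x powr (- (2 * \<alpha>)) else 0 :: real"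
  obtain M where M: "F \<subseteq> int_box d M" using finite_subset_int_box[of F d] F by auto
  have "1 / e = max (\<tau> * ln L) (1 / (2 * \<alpha> - 1))"
  proof (cases "1 / (\<tau> * ln L) \<le> 2 * \<alpha> - 1")
    case True
    hence "inverse (2 * \<alpha> - 1) \<le> inverse (1 / (\<tau> * ln L))"
      using tau_ln_L_pos by (intro le_imp_inverse_le) auto
    thus ?thesis using True by (simp add: e_def inverse_eq_divide)
  next
    case False
    hence "inverse (1 / (\<tau> * ln L)) \<le> inverse (2 * \<alpha> - 1)"
      using alpha by (intro le_imp_inverse_le) auto
    thus ?thesis using False by (simp add: e_def inverse_eq_divide)
  qed
  hence Zeq: "1 + 1 / e = max (1 + \<tau> * ln L) \<kappa>"
    by (simp add: zeta_bound_def max_def)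
  have "max (1 + \<tau> * ln L) \<kappa> \<le> \<kappa> * (1 + \<tau> * ln L)"
    using kappa_ge_1 tau_ln_L_pos mult_right_mono[of 1 \<kappa> "1 + \<tau> * ln L"] mult_left_mono[of 1 "1 + \<tau> * ln L" \<kappa>]
    by auto
  hence Z: "1 + \<tau> * ln L \<le> 1 + 1 / e" "1 + 1 / e \<le> \<kappa> * (1 + \<tau> * ln L)" unfolding Zeq by auto
  have "(\<Sum>k\<in>F. inverse (w k)) = (\<Sum>k\<in>F. L powr (- (2 * \<alpha>)) * (if \<exists>j\<in>{1..d}. k j \<noteq> 0 then ?\<phi> (rho {1..d} g k / L) else 0))"
  proof (intro sum.cong refl)
    fix k assume "k \<in> F"
    hence k: "L \<le> rho {1..d} g k" using F L0 by (auto simp: freq_set_eq not_less)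
    hence "\<exists>j\<in>{1..d}. k j \<noteq> 0" using rho_zero[of k] N2_gt_1 by force
    thus "inverse (w k) = L powr (- (2 * \<alpha>)) * (if \<exists>j\<in>{1..d}. k j \<noteq> 0 then ?\<phi> (rho {1..d} g k / L) else 0)"
      using k L0 rho_g_pos[of k] unfolding inverse_w by (simp add: powr_divide powr_minus field_simps)
  qed
  also have "\<dots> \<le> L powr (- (2 * \<alpha>)) * (\<Sum>k\<in>int_box d M. if \<exists>j\<in>{1..d}. k j \<noteq> 0 then ?\<phi> (rho {1..d} g k / L) else 0)"
    unfolding sum_distrib_left[symmetric] using M by (intro mult_left_mono sum_mono2) auto
  also have "\<dots> \<le> L powr (- (2 * \<alpha>)) *
      (\<kappa> * L powr (1 + e) / (1 + 1 / e) * ((\<Prod>j\<in>{1..d}. 1 + 2 * g j powr (1 + e) * (1 + 1 / e)) - 1))"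
    unfolding int_box_def
  proof (intro mult_left_mono sum_rho_line_bound)
    show "(\<Sum>n=1..M. ?\<phi> (real n / y)) \<le> \<kappa> * y powr (1 + e)" if "y > 0" for y M
      unfolding zeta_bound_def using that e alpha by (intro sum_tail_above_le) auto
    show "(\<Sum>n=1..M. real n powr (- (1 + e))) \<le> 1 + 1 / e" for M
      using sum_powr_neg_from_1_le[of "1 + e" M] e by simp
  qed (use L0 g_bounds tau_ln_L_pos e kappa_ge_1 in \<open>auto intro: add_pos_pos\<close>)
  also have "\<dots> \<le> L powr (- (2 * \<alpha>)) * (\<kappa> * \<kappa> ^ d * u * (real N - 1))"
    using e Z kappa_ge_1 by (intro mult_left_mono line_bound_P) auto
  finally show ?thesis by (simp add: mult_ac)
qed

end

section \<open>Probability of bad generating vectors\<close>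

text \<open>Union bound over the n-element index sets on which all draws fall into \<open>B\<close>;
  independence gives q^n for each.\<close>

lemma binomial_tail_Pi_pmf:
  assumes "finite I" "measure_pmf.prob p B \<le> q"
  shows "measure_pmf.prob (Pi_pmf I dflt (\<lambda>_. p)) {f. n \<le> card {i \<in> I. f i \<in> B}} \<le> real (card I choose n) * q ^ n"
proof -
  let ?M = "Pi_pmf I dflt (\<lambda>_. p)"
  define Js where "Js = {J. J \<subseteq> I \<and> card J = n}"
  have fin: "finite Js" using assms(1) by (auto simp: Js_def)
  have "{f. n \<le> card {i \<in> I. f i \<in> B}} \<subseteq> (\<Union>J\<in>Js. {f. \<forall>i\<in>J. f i \<in> B})"
  proof
    fix f assume "f \<in> {f. n \<le> card {i \<in> I. f i \<in> B}}"
    hence "n \<le> card {i \<in> I. f i \<in> B}" by simp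
    then obtain J where "J \<subseteq> {i \<in> I. f i \<in> B}" "card J = n"
      by (rule obtain_subset_with_card_n)
    thus "f \<in> (\<Union>J\<in>Js. {f. \<forall>i\<in>J. f i \<in> B})" by (auto simp: Js_def)
  qed
  hence "measure_pmf.prob ?M {f. n \<le> card {i \<in> I. f i \<in> B}} \<le> measure_pmf.prob ?M (\<Union>J\<in>Js. {f. \<forall>i\<in>J. f i \<in> B})"
    by (intro measure_pmf.finite_measure_mono) auto
  also have "\<dots> \<le> (\<Sum>J\<in>Js. measure_pmf.prob ?M {f. \<forall>i\<in>J. f i \<in> B})"
    using fin by (intro measure_pmf.finite_measure_subadditive_finite) auto
  also have "\<dots> \<le> (\<Sum>J\<in>Js. q ^ n)"
  proof (rule sum_mono)
    fix J assume J: "J \<in> Js"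
    have "{f. \<forall>i\<in>J. f i \<in> B} = Pi I (\<lambda>i. if i \<in> J then B else UNIV)"
      using J by (auto simp: Js_def Pi_def split: if_splits)
    hence "measure_pmf.prob ?M {f. \<forall>i\<in>J. f i \<in> B} = (\<Prod>i\<in>I. measure_pmf.prob p (if i \<in> J then B else UNIV))"
      using assms(1) by (simp add: measure_Pi_pmf_Pi)
    also have "\<dots> = (\<Prod>i\<in>J. measure_pmf.prob p B)"
      using J assms(1) by (intro prod.mono_neutral_cong_right) (auto simp: Js_def)
    also have "\<dots> = measure_pmf.prob p B ^ n" using J by (simp add: Js_def)
    also have "\<dots> \<le> q ^ n" using assms(2) by (intro power_mono) auto
    finally show "measure_pmf.prob ?M {f. \<forall>i\<in>J. f i \<in> B} \<le> q ^ n" .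
  qed
  also have "\<dots> = real (card I choose n) * q ^ n"
    using assms(1) by (simp add: Js_def n_subsets)
  finally show ?thesis .
qed

context median_lattice_setting
begin

abbreviation "gen_vecs \<equiv> {1..d} \<rightarrow>\<^sub>E {1..N - 1}"

lemma finite_gen_vecs: "finite gen_vecs"
  by (intro finite_PiE) auto

lemma gen_vecs_nonempty: "gen_vecs \<noteq> {}"
  using N_ge_3 by (auto simp: PiE_eq_empty_iff)

lemma card_gen_vecs: "card gen_vecs = (N - 1) ^ d"
  by (simp add: card_PiE)

lemma prob_gen_vec:
  "measure_pmf.prob (pmf_of_set gen_vecs) S = real (card (gen_vecs \<inter> S)) / real (card gen_vecs)"
  using finite_gen_vecs gen_vecs_nonempty by (intro measure_pmf_of_set) auto

text \<open>As N is prime, fixing all coordinates except \<open>j\<close> leaves at most one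
  admissible \<open>z j\<close> among N - 1 candidates.\<close>

lemma card_aliased_le:
  assumes j: "j \<in> {1..d}" and nd: "\<not> int N dvd k j - h j"
  shows "(N - 1) * card {z \<in> gen_vecs. aliased d N z h k} \<le> card gen_vecs"
proof -
  let ?S = "{z \<in> gen_vecs. aliased d N z h k}"
  have inj: "inj_on (\<lambda>z. restrict z ({1..d} - {j})) ?S"
  proof (rule inj_onI)
    fix z z' assume z: "z \<in> ?S" "z' \<in> ?S" and eq: "restrict z ({1..d} - {j}) = restrict z' ({1..d} - {j})"
    have eq': "z i = z' i" if "i \<in> {1..d} - {j}" for i using fun_cong[OF eq, of i] that by simp
    have "int N dvd (\<Sum>i=1..d. (k i - h i) * int (z i)) - (\<Sum>i=1..d. (k i - h i) * int (z' i))"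
      using z by (intro dvd_diff) (auto simp: aliased_def)
    also have "(\<Sum>i=1..d. (k i - h i) * int (z i)) - (\<Sum>i=1..d. (k i - h i) * int (z' i)) =
        (\<Sum>i=1..d. if i = j then (k j - h j) * (int (z j) - int (z' j)) else 0)"
      unfolding sum_subtractf[symmetric] using eq' by (intro sum.cong) (auto simp: right_diff_distrib)
    also have "\<dots> = (k j - h j) * (int (z j) - int (z' j))" using j by simp
    finally have "int N dvd int (z j) - int (z' j)"
      using nd prime_N by (simp add: prime_dvd_mult_iff)
    moreover have "z j \<in> {1..N - 1}" "z' j \<in> {1..N - 1}" using z j by (auto simp: PiE_iff)
    hence "\<bar>int (z j) - int (z' j)\<bar> < int N" by auto
    ultimately have "z j = z' j" using zdvd_imp_le[of "int N" "\<bar>int (z j) - int (z' j)\<bar>"] by force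
    thus "z = z'" using z eq' by (intro PiE_ext[of z "{1..d}" "\<lambda>_. {1..N - 1}" z']) auto
  qed
  have "card ?S = card ((\<lambda>z. restrict z ({1..d} - {j})) ` ?S)" using inj by (simp add: card_image)
  also have "\<dots> \<le> card ({1..d} - {j} \<rightarrow>\<^sub>E {1..N - 1})"
    by (intro card_mono finite_PiE image_subsetI) (auto simp: restrict_PiE_iff dest: PiE_mem)
  also have "\<dots> = (N - 1) ^ (d - 1)" using j by (simp add: card_PiE)
  finally have "(N - 1) * card ?S \<le> (N - 1) * (N - 1) ^ (d - 1)" by simp
  also have "\<dots> = card gen_vecs" unfolding card_gen_vecs using j by (cases d) auto
  finally show ?thesis .
qed

text \<open>If only coordinate \<open>j\<close> differed, N would divide \<open>z j\<close>,
  although 0 < z j < N. This excludes random aliasing for d = 1 and yields the second factor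
  L/\<tau> for large \<tau>.\<close>

lemma aliased_differs_twice:
  assumes z: "z \<in> gen_vecs" and al: "aliased d N z h k" and j: "j \<in> {1..d}" "\<not> int N dvd k j - h j"
  shows "\<exists>i\<in>{1..d}. i \<noteq> j \<and> k i \<noteq> h i"
proof (rule ccontr)
  assume "\<not> ?thesis"
  hence "(\<Sum>i=1..d. (k i - h i) * int (z i)) = (\<Sum>i=1..d. if i = j then (k j - h j) * int (z j) else 0)"
    by (intro sum.cong) auto
  also have "\<dots> = (k j - h j) * int (z j)" using j by simp
  finally have "int N dvd (k j - h j) * int (z j)" using al by (simp add: aliased_def)
  hence "int N dvd int (z j)" using j prime_N by (simp add: prime_dvd_mult_iff)
  moreover have "z j \<in> {1..N - 1}" using z j by (auto simp: PiE_iff)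
  ultimately show False by (auto dest: dvd_imp_le)
qed

definition alias_mass :: "(nat \<Rightarrow> int) set \<Rightarrow> (nat \<Rightarrow> int) \<Rightarrow> (nat \<Rightarrow> nat) \<Rightarrow> real" where
  "alias_mass S h z = (\<Sum>\<^sub>\<infinity>k\<in>{k \<in> S. aliased d N z h k}. inverse (w k))"

lemma inverse_w_summable_subset: "S \<subseteq> int_vecs d \<Longrightarrow> (\<lambda>k. inverse (w k)) summable_on S"
  by (rule summable_on_subset_banach[OF inverse_w_summable])

lemma inverse_w_nonneg: "inverse (w k) \<ge> 0"
  using w_pos[of k] by simp

text \<open>Markov's inequality: each \<open>k\<close> in \<open>S\<close> is aliased with
  \<open>h\<close> for at most a fraction 1/(N - 1) of the vectors, so the mean alias mass is at
  most B/(N - 1).\<close>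

lemma prob_alias_mass_ge:
  assumes S: "S \<subseteq> int_vecs d" "\<And>k. k \<in> S \<Longrightarrow> \<exists>j\<in>{1..d}. \<not> int N dvd k j - h j"
    and B: "\<And>F. finite F \<Longrightarrow> F \<subseteq> S \<Longrightarrow> (\<Sum>k\<in>F. inverse (w k)) \<le> B" and t: "t > 0"
  shows "measure_pmf.prob (pmf_of_set gen_vecs) {z. t \<le> alias_mass S h z} \<le> B / (t * (real N - 1))"
proof -
  define c where "c = real (card gen_vecs)"
  have c: "c > 0" using N_ge_3 unfolding c_def card_gen_vecs by simp
  let ?ind = "\<lambda>z k. if aliased d N z h k then inverse (w k) else 0"
  have hs: "(?ind z has_sum alias_mass S h z) S" for z
  proof -
    have "((\<lambda>k. inverse (w k)) has_sum alias_mass S h z) {k \<in> S. aliased d N z h k}"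
      unfolding alias_mass_def using S(1) by (intro has_sum_infsum inverse_w_summable_subset) auto
    thus ?thesis by (rule has_sum_cong_neutral[THEN iffD1, rotated -1]) auto
  qed
  have nonneg: "alias_mass S h z \<ge> 0" for z
    unfolding alias_mass_def by (intro infsum_nonneg inverse_w_nonneg)
  have "((\<lambda>k. \<Sum>z\<in>gen_vecs. ?ind z k) has_sum (\<Sum>z\<in>gen_vecs. alias_mass S h z)) S"
    by (intro has_sum_sum hs)
  hence "(\<Sum>z\<in>gen_vecs. alias_mass S h z) \<le> c / (real N - 1) * B"
  proof (rule has_sum_le_finite_sums)
    fix F assume F: "finite F" "F \<subseteq> S"
    have "(\<Sum>k\<in>F. \<Sum>z\<in>gen_vecs. ?ind z k) \<le> (\<Sum>k\<in>F. c / (real N - 1) * inverse (w k))"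
    proof (rule sum_mono)
      fix k assume "k \<in> F"
      then obtain j where "j \<in> {1..d}" "\<not> int N dvd k j - h j" using F S by blast
      hence "real ((N - 1) * card {z \<in> gen_vecs. aliased d N z h k}) \<le> c"
        unfolding c_def of_nat_le_iff by (rule card_aliased_le)
      hence le: "real (card {z \<in> gen_vecs. aliased d N z h k}) \<le> c / (real N - 1)"
        using N_ge_3 by (simp add: field_simps of_nat_diff)
      have eq: "(\<Sum>z\<in>gen_vecs. ?ind z k) = real (card {z \<in> gen_vecs. aliased d N z h k}) * inverse (w k)"
        using finite_gen_vecs by (simp add: sum.If_cases Int_def)
      show "(\<Sum>z\<in>gen_vecs. ?ind z k) \<le> c / (real N - 1) * inverse (w k)"
        unfolding eq by (rule mult_right_mono[OF le inverse_w_nonneg])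
    qed
    also have "\<dots> \<le> c / (real N - 1) * B"
      unfolding sum_distrib_left[symmetric] using c N_ge_3 by (intro mult_left_mono B F) auto
    finally show "(\<Sum>k\<in>F. \<Sum>z\<in>gen_vecs. ?ind z k) \<le> c / (real N - 1) * B" .
  qed
  moreover have "real (card (gen_vecs \<inter> {z. t \<le> alias_mass S h z})) * t \<le> (\<Sum>z\<in>gen_vecs. alias_mass S h z)"
  proof -
    have "real (card (gen_vecs \<inter> {z. t \<le> alias_mass S h z})) * t = (\<Sum>z\<in>gen_vecs \<inter> {z. t \<le> alias_mass S h z}. t)"
      by simp
    also have "\<dots> \<le> (\<Sum>z\<in>gen_vecs \<inter> {z. t \<le> alias_mass S h z}. alias_mass S h z)" by (intro sum_mono) auto
    also have "\<dots> \<le> (\<Sum>z\<in>gen_vecs. alias_mass S h z)"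
      using finite_gen_vecs nonneg by (intro sum_mono2) auto
    finally show ?thesis .
  qed
  ultimately have "real (card (gen_vecs \<inter> {z. t \<le> alias_mass S h z})) * t \<le> c / (real N - 1) * B" by linarith
  thus ?thesis
    unfolding prob_gen_vec c_def[symmetric] using c t N_ge_3 by (simp add: field_simps)
qed

abbreviation T :: real where "T \<equiv> alias_const d \<alpha> * L powr (- (2 * \<alpha>))"

text \<open>Such k = h + N l are aliased for every \<open>z\<close>, so no averaging can help. Since
  |h j| < N/2, a nonzero l j forces |k j| \<ge> (N/2) |l j|; hence \<open>rho\<close> at k is at
  least N/2 times the unweighted \<open>rho\<close> at l, and N > L.\<close>

lemma periodic_alias_mass_le:
  assumes h: "h \<in> A"
  shows "alias_mass {k \<in> int_vecs d - A. \<forall>j\<in>{1..d}. int N dvd k j - h j} h z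
      \<le> 2 powr (2 * \<alpha>) * (1 + 2 * \<kappa>) ^ d * L powr (- (2 * \<alpha>))"
  unfolding alias_mass_def
proof (rule infsum_le_finite_sums)
  let ?S = "{k \<in> {k \<in> int_vecs d - A. \<forall>j\<in>{1..d}. int N dvd k j - h j}. aliased d N z h k}"
  show "(\<lambda>k. inverse (w k)) summable_on ?S" by (intro inverse_w_summable_subset) auto
  fix F assume F: "finite F" "F \<subseteq> ?S"
  have hv: "h \<in> int_vecs d" using h by (simp add: freq_set_def)
  define l where "l k = (\<lambda>j\<in>{1..d}. (k j - h j) div int N)" for k
  have l: "k j = h j + int N * l k j" if "k \<in> F" "j \<in> {1..d}" for k j
    using F that by (auto simp: l_def)
  have inj: "inj_on l F"
  proof (rule inj_onI)
    fix k k' assume k: "k \<in> F" "k' \<in> F" "l k = l k'"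
    thus "k = k'" using F by (intro int_vecs_eqI[of k d k']) (auto simp: l)
  qed
  have "(\<Sum>k\<in>F. inverse (w k)) \<le> (\<Sum>k\<in>F. (real N / 2) powr (- (2 * \<alpha>)) * rho {1..d} (\<lambda>_. 1) (l k) powr (- (2 * \<alpha>)))"
  proof (rule sum_mono)
    fix k assume k: "k \<in> F"
    define e where "e j = (if l k j = 0 then 1 else \<bar>real_of_int (l k j)\<bar>)" for j
    define b where "b j = (if l k j = 0 then 1 else real N / 2)" for j
    \<comment> \<open>One such coordinate suffices for a factor N/2, and it exists because
      \<open>h\<close> lies in \<open>A\<close> while \<open>k\<close> does not.\<close>
    have "\<exists>j\<in>{1..d}. l k j \<noteq> 0"
    proof (rule ccontr)
      assume "\<not> ?thesis"
      hence "k = h" using k F hv by (intro int_vecs_eqI[of k d h]) (auto simp: l)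
      thus False using k F h by auto
    qed
    then obtain j0 where j0: "j0 \<in> {1..d}" "l k j0 \<noteq> 0" by blast
    have b1: "b j \<ge> 1" for j using N_ge_3 by (simp add: b_def)
    have "real N / 2 * 1 \<le> b j0 * (\<Prod>j\<in>{1..d} - {j0}. b j)"
      using j0 b1 N_ge_3 by (intro mult_mono prod_ge_1) (auto simp: b_def)
    also have "\<dots> = (\<Prod>j\<in>{1..d}. b j)" using j0 by (subst (2) prod.remove[of _ j0]) auto
    finally have "real N / 2 * (\<Prod>j\<in>{1..d}. e j) \<le> (\<Prod>j\<in>{1..d}. b j) * (\<Prod>j\<in>{1..d}. e j)"
      by (intro mult_right_mono prod_nonneg) (auto simp: e_def)
    also have "\<dots> = (\<Prod>j\<in>{1..d}. b j * e j)" by (simp add: prod.distrib)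
    also have "\<dots> \<le> rho {1..d} g k"
      unfolding rho_def
    proof (intro prod_mono conjI)
      fix j assume j: "j \<in> {1..d}"
      show "0 \<le> b j * e j" using b1[of j] by (auto simp: e_def)
      show "b j * e j \<le> (if k j = 0 then 1 else \<bar>real_of_int (k j)\<bar> / g j)"
      proof (cases "l k j = 0")
        case True
        thus ?thesis using rho_factor_ge_1[of j "k j"] j by (simp add: b_def e_def)
      next
        case False
        have hj: "2 * \<bar>real_of_int (h j)\<bar> < real N" using freq_set_component_half[OF h j] .
        have "1 \<le> \<bar>l k j\<bar>" using False by linarith
        hence l1: "1 \<le> \<bar>real_of_int (l k j)\<bar>" by linarith
        have "real N * \<bar>real_of_int (l k j)\<bar> - \<bar>real_of_int (h j)\<bar> \<le> \<bar>real_of_int (k j)\<bar>"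
          unfolding l[OF k j] using abs_triangle_ineq4[of "real N * real_of_int (l k j) + real_of_int (h j)" "real_of_int (h j)"]
          by (simp add: abs_mult add.commute)
        moreover have "real N / 2 * 1 \<le> real N / 2 * \<bar>real_of_int (l k j)\<bar>" using l1 by (intro mult_left_mono) auto
        ultimately have le: "real N / 2 * \<bar>real_of_int (l k j)\<bar> < \<bar>real_of_int (k j)\<bar>" using hj by linarith
        hence "k j \<noteq> 0" by (auto simp: mult_less_0_iff)
        moreover have "\<bar>real_of_int (k j)\<bar> \<le> \<bar>real_of_int (k j)\<bar> / g j"
          using g_bounds[of j] j by (simp add: field_simps mult_left_le)
        ultimately have "k j \<noteq> 0" "real N / 2 * \<bar>real_of_int (l k j)\<bar> \<le> \<bar>real_of_int (k j)\<bar> / g j"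
          using le by linarith+
        thus ?thesis using False by (simp add: b_def e_def)
      qed
    qed
    also have "(\<Prod>j\<in>{1..d}. e j) = rho {1..d} (\<lambda>_. 1) (l k)"
      by (simp add: rho_def e_def cong: if_cong)
    finally have "real N / 2 * rho {1..d} (\<lambda>_. 1) (l k) \<le> rho {1..d} g k" .
    moreover have "0 < real N / 2 * rho {1..d} (\<lambda>_. 1) (l k)" using N_ge_3 by (intro mult_pos_pos rho_pos) auto
    ultimately have "inverse (w k) \<le> (real N / 2 * rho {1..d} (\<lambda>_. 1) (l k)) powr (- (2 * \<alpha>))"
      unfolding inverse_w using alpha by (intro powr_mono2') auto
    thus "inverse (w k) \<le> (real N / 2) powr (- (2 * \<alpha>)) * rho {1..d} (\<lambda>_. 1) (l k) powr (- (2 * \<alpha>))"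
      by (subst powr_mult[symmetric]) (use rho_pos[of "{1..d}" "\<lambda>_. 1" "l k"] in auto)
  qed
  also have "\<dots> = (real N / 2) powr (- (2 * \<alpha>)) * (\<Sum>k\<in>l ` F. rho {1..d} (\<lambda>_. 1) k powr (- (2 * \<alpha>)))"
    using inj by (simp add: sum_distrib_left sum.reindex)
  also have "\<dots> \<le> (real N / 2) powr (- (2 * \<alpha>)) * (1 + 2 * \<kappa>) ^ d"
    using F by (intro mult_left_mono sum_rho_one_le) (auto simp: l_def int_vecs_def)
  also have "\<dots> \<le> 2 powr (2 * \<alpha>) * L powr (- (2 * \<alpha>)) * (1 + 2 * \<kappa>) ^ d"
  proof (rule mult_right_mono)
    have "(real N / 2) powr (- (2 * \<alpha>)) \<le> (L / 2) powr (- (2 * \<alpha>))"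
      using N2_gt_1 L_le_N alpha by (intro powr_mono2') auto
    also have "\<dots> = 2 powr (2 * \<alpha>) * L powr (- (2 * \<alpha>))"
      using N2_gt_1 by (simp add: powr_divide powr_minus field_simps)
    finally show "(real N / 2) powr (- (2 * \<alpha>)) \<le> 2 powr (2 * \<alpha>) * L powr (- (2 * \<alpha>))" .
  qed (use kappa_ge_1 in auto)
  finally show "(\<Sum>k\<in>F. inverse (w k)) \<le> 2 powr (2 * \<alpha>) * (1 + 2 * \<kappa>) ^ d * L powr (- (2 * \<alpha>))"
    by (simp add: mult_ac)
qed

lemma freq_set_not_congruent:
  assumes "h \<in> A" "k \<in> A" "k \<noteq> h"
  shows "\<exists>j\<in>{1..d}. \<not> int N dvd k j - h j"
proof -
  obtain j where j: "j \<in> {1..d}" "k j \<noteq> h j"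
    using assms int_vecs_eqI[of k d h] by (auto simp: freq_set_def)
  have "2 * \<bar>real_of_int (k j)\<bar> < real N" "2 * \<bar>real_of_int (h j)\<bar> < real N"
    using assms j freq_set_component_half by auto
  hence "\<bar>k j - h j\<bar> < int N" by linarith
  hence "\<not> int N dvd k j - h j" using j zdvd_imp_le[of "int N" "\<bar>k j - h j\<bar>"] by auto
  thus ?thesis using j by blast
qed

text \<open>The aliases congruent to \<open>h\<close> use up only the second summand of
  \<open>alias_const\<close>, so without a collision the remaining ones alone must reach the
  first.\<close>

lemma bad_index_cases:
  assumes h: "h \<in> A" and bad: "\<not> good_index d \<alpha> \<gamma> L N T z h"
  obtains k where "k \<in> A" "k \<noteq> h" "aliased d N z h k"
  | "2 * \<kappa> ^ Suc d * L powr (- (2 * \<alpha>)) \<le> alias_mass {k \<in> int_vecs d - A. \<exists>j\<in>{1..d}. \<not> int N dvd k j - h j} h z"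
proof (cases "\<exists>k\<in>A. k \<noteq> h \<and> aliased d N z h k")
  case False
  let ?S0 = "{k \<in> int_vecs d - A. \<forall>j\<in>{1..d}. int N dvd k j - h j}"
  let ?S1 = "{k \<in> int_vecs d - A. \<exists>j\<in>{1..d}. \<not> int N dvd k j - h j}"
  have "T < (\<Sum>\<^sub>\<infinity>k\<in>{k \<in> int_vecs d - A. aliased d N z h k}. inverse (w k))"
    using bad False by (auto simp: good_index_def)
  also have "{k \<in> int_vecs d - A. aliased d N z h k} = {k \<in> ?S0. aliased d N z h k} \<union> {k \<in> ?S1. aliased d N z h k}"
    by auto
  also have "(\<Sum>\<^sub>\<infinity>k\<in>\<dots>. inverse (w k)) = alias_mass ?S0 h z + alias_mass ?S1 h z"
    unfolding alias_mass_def by (intro infsum_Un_disjoint inverse_w_summable_subset) auto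
  finally have "2 * \<kappa> ^ Suc d * L powr (- (2 * \<alpha>)) \<le> alias_mass ?S1 h z"
    using periodic_alias_mass_le[OF h, of z] by (simp add: alias_const_def ring_distribs)
  thus ?thesis by (rule that(2))
qed (use that(1) in blast)

text \<open>Collisions inside \<open>A\<close> cost at most u. The random alias mass outside has
  mean at most \<kappa>^(d+1) u L^(-2\<alpha>), so it reaches 2 \<kappa>^(d+1) L^(-2\<alpha>) with
  probability at most u/2.\<close>

lemma prob_bad_le:
  assumes h: "h \<in> A"
  shows "measure_pmf.prob (pmf_of_set gen_vecs) {z. \<not> good_index d \<alpha> \<gamma> L N T z h} \<le> 3 / 2 * u"
proof -
  let ?P = "measure_pmf.prob (pmf_of_set gen_vecs)"
  let ?S1 = "{k \<in> int_vecs d - A. \<exists>j\<in>{1..d}. \<not> int N dvd k j - h j}"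
  define t where "t = 2 * \<kappa> ^ Suc d * L powr (- (2 * \<alpha>))"
  have fin: "finite A" using finite_freq_set N2_gt_1 by simp
  have kL: "\<kappa> ^ Suc d * L powr (- (2 * \<alpha>)) > 0" using kappa_ge_1 N2_gt_1 by (intro mult_pos_pos zero_less_power) auto
  have "{z. \<not> good_index d \<alpha> \<gamma> L N T z h} \<subseteq> (\<Union>k\<in>A - {h}. {z. aliased d N z h k}) \<union> {z. t \<le> alias_mass ?S1 h z}"
    unfolding t_def by (auto elim!: bad_index_cases[OF h])
  hence "?P {z. \<not> good_index d \<alpha> \<gamma> L N T z h} \<le> ?P ((\<Union>k\<in>A - {h}. {z. aliased d N z h k}) \<union> {z. t \<le> alias_mass ?S1 h z})"
    by (intro measure_pmf.finite_measure_mono) auto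
  also have "\<dots> \<le> ?P (\<Union>k\<in>A - {h}. {z. aliased d N z h k}) + ?P {z. t \<le> alias_mass ?S1 h z}"
    by (intro measure_Un_le) auto
  also have "?P (\<Union>k\<in>A - {h}. {z. aliased d N z h k}) \<le> (\<Sum>k\<in>A - {h}. ?P {z. aliased d N z h k})"
    using fin by (intro measure_pmf.finite_measure_subadditive_finite) auto
  also have "\<dots> \<le> (\<Sum>k\<in>A - {h}. 1 / (real N - 1))"
  proof (rule sum_mono)
    fix k assume "k \<in> A - {h}"
    then obtain j where "j \<in> {1..d}" "\<not> int N dvd k j - h j" using freq_set_not_congruent h by blast
    hence "real ((N - 1) * card {z \<in> gen_vecs. aliased d N z h k}) \<le> real (card gen_vecs)"
      unfolding of_nat_le_iff by (rule card_aliased_le)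
    moreover have "real (card gen_vecs) > 0" using N_ge_3 unfolding card_gen_vecs by simp
    moreover have "gen_vecs \<inter> {z. aliased d N z h k} = {z \<in> gen_vecs. aliased d N z h k}" by auto
    ultimately show "?P {z. aliased d N z h k} \<le> 1 / (real N - 1)"
      unfolding prob_gen_vec using N_ge_3 by (simp add: field_simps of_nat_diff)
  qed
  also have "\<dots> = (real (card A) - 1) / (real N - 1)"
  proof -
    have "card A \<ge> 1" using h fin by (auto simp: Suc_le_eq card_gt_0_iff)
    thus ?thesis using h by (simp add: of_nat_diff)
  qed
  also have "\<dots> \<le> u" using card_freq_set_le N_ge_3 by (simp add: field_simps)
  also have "?P {z. t \<le> alias_mass ?S1 h z} \<le> (\<kappa> ^ Suc d * u * (real N - 1) * L powr (- (2 * \<alpha>))) / (t * (real N - 1))"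
    using kL by (intro prob_alias_mass_ge tail_sum_le) (auto simp: t_def)
  also have "\<dots> = u / 2"
    using kL N_ge_3 kappa_ge_1 N2_gt_1 by (simp add: t_def field_simps)
  finally show ?thesis by simp
qed

text \<open>
  After division by \<open>P_bound\<close>, every coordinate in which \<open>k\<close> and \<open>h\<close> differ yields a factor
  \<open>L / \<tau>\<close>: either \<open>\<gamma> j\<close> occurs in the weight of \<open>k\<close>, or \<open>h j \<noteq> 0\<close> forces \<open>g j > 1 / L\<close>.
\<close>

lemma inverse_w_le_of_differs_twice:
  assumes h: "h \<in> A" and D: "2 \<le> card {j \<in> {1..d}. k j \<noteq> h j}" and tauL: "L \<le> \<tau>"
  shows "inverse (w k) \<le> (real N - 1) / L * (L / \<tau>)\<^sup>2 * rho {1..d} (\<lambda>_. 1) k powr (- (2 * \<alpha>))"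
proof -
  define p where "p j = 1 + 2 * g j * (1 + \<tau> * ln (real N))" for j
  define e where "e j = (if k j = 0 then 1 else \<bar>real_of_int (k j)\<bar>) powr (- (2 * \<alpha>))" for j
  define s where "s j = (if k j \<noteq> h j then L / \<tau> else 1)" for j
  have L1: "L > 1" by (rule N2_gt_1)
  have factor: "(if k j = 0 then 1 else \<bar>real_of_int (k j)\<bar> / g j) powr (- (2 * \<alpha>)) \<le> p j * s j * e j"
    if j: "j \<in> {1..d}" for j
  proof -
    have g: "0 < g j" "g j \<le> 1" using g_bounds j by auto
    have p1: "1 \<le> p j" using P_factor_ge_1[OF j] by (simp add: p_def)
    have "g j * \<tau> * 1 \<le> g j * \<tau> * ln (real N)" using g tau ln_N_ge_1 by (intro mult_left_mono) auto
    moreover have "p j = 1 + 2 * g j + 2 * (g j * \<tau> * ln (real N))" by (simp add: p_def algebra_simps)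
    moreover have "g j * \<tau> \<ge> 0" using g tau by simp
    ultimately have p2: "g j * \<tau> \<le> p j" using g by linarith
    have e: "(if k j = 0 then 1 else \<bar>real_of_int (k j)\<bar> / g j) powr (- (2 * \<alpha>)) \<le> (if k j = 0 then 1 else g j) * e j"
    proof (cases "k j = 0")
      case False
      have "(\<bar>real_of_int (k j)\<bar> / g j) powr (- (2 * \<alpha>)) = g j powr (2 * \<alpha>) * e j"
        using False g by (simp add: e_def powr_divide powr_minus field_simps)
      also have "g j powr (2 * \<alpha>) \<le> g j powr 1" using g alpha by (intro powr_mono') auto
      finally show ?thesis using False g by (simp add: e_def mult_right_mono)
    qed (simp add: e_def)
    also have "\<dots> \<le> p j * s j * e j"
    proof (rule mult_right_mono)
      show "(if k j = 0 then 1 else g j) \<le> p j * s j"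
      proof (cases "k j = h j")
        case True
        thus ?thesis using p1 g by (simp add: s_def)
      next
        case False
        have "g j * \<tau> * (L / \<tau>) \<le> p j * (L / \<tau>)" using p2 L1 tau by (intro mult_right_mono) auto
        hence le: "g j * L \<le> p j * s j" using False tau by (simp add: s_def)
        show ?thesis
        proof (cases "k j = 0")
          case True
          hence "h j \<noteq> 0" using False by simp
          hence "\<bar>real_of_int (h j)\<bar> < L * g j" using freq_set_component[OF _ h j] L1 by simp
          moreover have "1 \<le> \<bar>real_of_int (h j)\<bar>" using \<open>h j \<noteq> 0\<close> by linarith
          ultimately show ?thesis using True le by (simp add: mult.commute)
        next
          case False
          have "g j * 1 \<le> g j * L" using g L1 by (intro mult_left_mono) auto
          thus ?thesis using False le by simp
        qed
      qed
    qed (simp add: e_def)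
    finally show ?thesis .
  qed
  have "inverse (w k) = (\<Prod>j\<in>{1..d}. (if k j = 0 then 1 else \<bar>real_of_int (k j)\<bar> / g j) powr (- (2 * \<alpha>)))"
    unfolding inverse_w rho_def using g_bounds by (subst prod_powr_distrib) (auto simp: less_imp_le)
  also have "\<dots> \<le> (\<Prod>j\<in>{1..d}. p j * s j * e j)" by (intro prod_mono conjI factor) auto
  also have "\<dots> = P_bound N d \<tau> \<alpha> \<gamma> * (\<Prod>j\<in>{1..d}. s j) * (\<Prod>j\<in>{1..d}. e j)"
    by (simp add: prod.distrib P_bound_eq p_def)
  also have "(\<Prod>j\<in>{1..d}. e j) = rho {1..d} (\<lambda>_. 1) k powr (- (2 * \<alpha>))"
    unfolding rho_def e_def by (subst prod_powr_distrib[symmetric]) (auto cong: if_cong)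
  also have "(\<Prod>j\<in>{1..d}. s j) = (\<Prod>j\<in>{j \<in> {1..d}. k j \<noteq> h j}. L / \<tau>)"
    unfolding s_def by (rule prod.inter_filter[symmetric]) simp
  also have "\<dots> = (L / \<tau>) ^ card {j \<in> {1..d}. k j \<noteq> h j}" by simp
  also have "P_bound N d \<tau> \<alpha> \<gamma> * (L / \<tau>) ^ card {j \<in> {1..d}. k j \<noteq> h j} * rho {1..d} (\<lambda>_. 1) k powr (- (2 * \<alpha>))
      \<le> (real N - 1) / L * (L / \<tau>)\<^sup>2 * rho {1..d} (\<lambda>_. 1) k powr (- (2 * \<alpha>))"
  proof (intro mult_right_mono mult_mono)
    \<comment> \<open>The N - 1 introduced here later cancels against the alias probability 1/(N -
      1).\<close>
    show "P_bound N d \<tau> \<alpha> \<gamma> \<le> (real N - 1) / L" using L_P_le L1 by (simp add: field_simps)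
    show "(L / \<tau>) ^ card {j \<in> {1..d}. k j \<noteq> h j} \<le> (L / \<tau>)\<^sup>2"
      using D tauL L1 tau by (intro power_decreasing) auto
  qed (use L1 tau N_ge_3 in auto)
  finally show ?thesis .
qed

text \<open>Both kinds of badness produce alias mass at least L^(-2\<alpha>), since a single
  colliding \<open>k\<close> in \<open>A\<close> has 1 / w k that large. One application of Markov's
  inequality to the frequencies differing from \<open>h\<close> in two coordinates therefore covers
  both.\<close>

lemma prob_bad_le_large_tau:
  assumes h: "h \<in> A" and tauL: "L \<le> \<tau>"
  shows "measure_pmf.prob (pmf_of_set gen_vecs) {z. \<not> good_index d \<alpha> \<gamma> L N T z h}
    \<le> (1 + 2 * \<kappa>) ^ d * L powr (2 * \<alpha> + 1) / \<tau>\<^sup>2"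
proof -
  let ?P = "measure_pmf.prob (pmf_of_set gen_vecs)"
  define S1 where "S1 = {k \<in> int_vecs d - A. \<exists>j\<in>{1..d}. \<not> int N dvd k j - h j}"
  define S2 where "S2 = {k \<in> int_vecs d. (\<exists>j\<in>{1..d}. \<not> int N dvd k j - h j) \<and> 2 \<le> card {j \<in> {1..d}. k j \<noteq> h j}}"
  define t where "t = L powr (- (2 * \<alpha>))"
  have t: "t > 0" using N2_gt_1 by (simp add: t_def)
  have in_S2: "k \<in> S2" if z: "z \<in> gen_vecs" and k: "k \<in> int_vecs d" "aliased d N z h k" "\<exists>j\<in>{1..d}. \<not> int N dvd k j - h j" for z k
  proof -
    obtain j where j: "j \<in> {1..d}" "\<not> int N dvd k j - h j" using k by blast
    obtain i where i: "i \<in> {1..d}" "i \<noteq> j" "k i \<noteq> h i" using aliased_differs_twice[OF z k(2) j] by blast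
    have "card {i, j} \<le> card {j \<in> {1..d}. k j \<noteq> h j}" using i j by (intro card_mono) auto
    thus ?thesis using i k by (simp add: S2_def)
  qed
  have "t \<le> alias_mass S2 h z" if z: "z \<in> gen_vecs" and bad: "\<not> good_index d \<alpha> \<gamma> L N T z h" for z
    using h bad
  proof (cases rule: bad_index_cases)
    case (1 k)
    have k: "k \<in> int_vecs d" using 1 by (simp add: freq_set_def)
    have "k \<in> S2" using in_S2[OF z k] 1 freq_set_not_congruent[OF h] by blast
    have "t \<le> inverse (w k)"
      unfolding t_def inverse_w using 1 alpha rho_g_pos[of k] N2_gt_1 by (intro powr_mono2') (auto simp: freq_set_eq)
    also have "\<dots> = (\<Sum>k\<in>{k}. inverse (w k))" by simp
    also have "\<dots> \<le> alias_mass S2 h z"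
      unfolding alias_mass_def using 1 \<open>k \<in> S2\<close>
      by (intro finite_sum_le_infsum inverse_w_summable_subset inverse_w_nonneg) (auto simp: S2_def)
    finally show ?thesis .
  next
    case 2
    have "1 * t \<le> 2 * \<kappa> ^ Suc d * t"
      using t one_le_power[OF kappa_ge_1, of "Suc d"] by (intro mult_right_mono) linarith+
    also have "\<dots> \<le> alias_mass S1 h z" using 2 by (simp add: t_def S1_def)
    also have "\<dots> \<le> alias_mass S2 h z"
      unfolding alias_mass_def using in_S2[OF z]
      by (intro infsum_mono2 inverse_w_summable_subset inverse_w_nonneg) (auto simp: S1_def S2_def)
    finally show ?thesis by simp
  qed
  hence sub: "gen_vecs \<inter> {z. \<not> good_index d \<alpha> \<gamma> L N T z h} \<subseteq> gen_vecs \<inter> {z. t \<le> alias_mass S2 h z}" by blast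
  have "?P {z. \<not> good_index d \<alpha> \<gamma> L N T z h} \<le> ?P {z. t \<le> alias_mass S2 h z}"
    unfolding prob_gen_vec using card_mono[OF _ sub] finite_gen_vecs
    by (intro divide_right_mono) auto
  also have "\<dots> \<le> ((real N - 1) / L * (L / \<tau>)\<^sup>2 * (1 + 2 * \<kappa>) ^ d) / (t * (real N - 1))"
  proof (rule prob_alias_mass_ge)
    fix F assume F: "finite F" "F \<subseteq> S2"
    have "(\<Sum>k\<in>F. inverse (w k)) \<le> (\<Sum>k\<in>F. (real N - 1) / L * (L / \<tau>)\<^sup>2 * rho {1..d} (\<lambda>_. 1) k powr (- (2 * \<alpha>)))"
      using F by (intro sum_mono inverse_w_le_of_differs_twice[OF h _ tauL]) (auto simp: S2_def)
    also have "\<dots> \<le> (real N - 1) / L * (L / \<tau>)\<^sup>2 * (1 + 2 * \<kappa>) ^ d"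
      unfolding sum_distrib_left[symmetric] using F N2_gt_1 N_ge_3
      by (intro mult_left_mono sum_rho_one_le) (auto simp: S2_def)
    finally show "(\<Sum>k\<in>F. inverse (w k)) \<le> (real N - 1) / L * (L / \<tau>)\<^sup>2 * (1 + 2 * \<kappa>) ^ d" .
  qed (auto simp: S2_def t)
  also have "\<dots> = (1 + 2 * \<kappa>) ^ d * (L / t) / \<tau>\<^sup>2"
  proof -
    have *: "(x / L * (L / \<tau>)\<^sup>2 * c) / (t * x) = c * (L / t) / \<tau>\<^sup>2" if "x \<noteq> 0" for x c
      using that N2_gt_1 by (simp add: power2_eq_square mult_ac)
    show ?thesis by (rule *) (use N_ge_3 in auto)
  qed
  also have "L / t = L powr (2 * \<alpha> + 1)"
    using N2_gt_1 by (simp add: t_def powr_minus powr_add field_simps)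
  finally show ?thesis .
qed

section \<open>From single draws to a surplus of good draws for all frequencies\<close>

text \<open>If fewer than m + t of the R = 2m - 1 draws are good, at least n = m - t are bad. The
  union bound gives |A| (R choose n) q^n, and R choose n \<le> 4^m / 4 makes this at most |A| (8u)^m
  / 4, half of \<open>eps2\<close>.\<close>

lemma all_good_probability:
  assumes R: "odd R" and t: "t \<le> R div 2" and q: "q \<ge> 0"
    and bad: "\<And>h. h \<in> A \<Longrightarrow> measure_pmf.prob (pmf_of_set gen_vecs) {z. \<not> good_index d \<alpha> \<gamma> L N T z h} \<le> q"
    and q_le: "q ^ (R div 2 + 1 - t) \<le> (2 * u) ^ (R div 2 + 1)"
  shows "1 - eps2 N d R \<tau> \<alpha> \<gamma> \<le> measure_pmf.prob (gen_vectors_pmf d N R)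
    {zs. \<forall>h\<in>A. R div 2 + 1 + t \<le> card {r \<in> {1..R}. good_index d \<alpha> \<gamma> L N T (zs r) h}}"
proof -
  let ?M = "gen_vectors_pmf d N R"
  define m where "m = R div 2 + 1"
  define n where "n = m - t"
  have Rm: "R = 2 * m - 1" "m \<ge> 1" using R unfolding m_def by presburger+
  have n: "n \<ge> 1" "n \<le> m" using t by (auto simp: n_def m_def)
  define S where "S = {zs. \<forall>h\<in>A. R div 2 + 1 + t \<le> card {r \<in> {1..R}. good_index d \<alpha> \<gamma> L N T (zs r) h}}"
  define B where "B h = {zs. n \<le> card {r \<in> {1..R}. zs r \<in> {z. \<not> good_index d \<alpha> \<gamma> L N T z h}}}" for h
  have fin: "finite A" using finite_freq_set N2_gt_1 by simp
  have "- S \<subseteq> (\<Union>h\<in>A. B h)"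
  proof
    fix zs assume "zs \<in> - S"
    then obtain h where h: "h \<in> A" "\<not> m + t \<le> card {r \<in> {1..R}. good_index d \<alpha> \<gamma> L N T (zs r) h}"
      by (auto simp: S_def m_def)
    have "card {r \<in> {1..R}. good_index d \<alpha> \<gamma> L N T (zs r) h} + card {r \<in> {1..R}. \<not> good_index d \<alpha> \<gamma> L N T (zs r) h} =
        card ({r \<in> {1..R}. good_index d \<alpha> \<gamma> L N T (zs r) h} \<union> {r \<in> {1..R}. \<not> good_index d \<alpha> \<gamma> L N T (zs r) h})"
      by (intro card_Un_disjoint[symmetric]) auto
    also have "{r \<in> {1..R}. good_index d \<alpha> \<gamma> L N T (zs r) h} \<union> {r \<in> {1..R}. \<not> good_index d \<alpha> \<gamma> L N T (zs r) h} = {1..R}"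
      by auto
    finally have "n \<le> card {r \<in> {1..R}. \<not> good_index d \<alpha> \<gamma> L N T (zs r) h}"
      using h Rm n unfolding n_def by simp
    thus "zs \<in> (\<Union>h\<in>A. B h)" using h by (auto simp: B_def)
  qed
  hence "measure_pmf.prob ?M (- S) \<le> measure_pmf.prob ?M (\<Union>h\<in>A. B h)"
    by (intro measure_pmf.finite_measure_mono) auto
  also have "\<dots> \<le> (\<Sum>h\<in>A. measure_pmf.prob ?M (B h))"
    using fin by (intro measure_pmf.finite_measure_subadditive_finite) auto
  also have "\<dots> \<le> (\<Sum>h\<in>A. real (card {1..R} choose n) * q ^ n)"
    unfolding gen_vectors_pmf_def B_def by (intro sum_mono binomial_tail_Pi_pmf bad) auto
  also have "\<dots> = real (card A) * (real (R choose n) * q ^ n)" by simp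
  also have "\<dots> \<le> real (card A) * (4 ^ m / 4 * (2 * u) ^ m)"
  proof (intro mult_left_mono mult_mono)
    \<comment> \<open>As R is odd, n and R - n are two different places of the binomial row with
      equal entries, which halves the bound 2^R.\<close>
    have "(\<Sum>i\<in>{n, R - n}. R choose i) \<le> (\<Sum>i\<le>R. R choose i)"
      using n Rm by (intro sum_mono2) auto
    moreover have "n \<noteq> R - n"
    proof
      assume "n = R - n"
      hence "R = 2 * n" using n Rm by linarith
      thus False using R by simp
    qed
    moreover have "R choose (R - n) = R choose n" using n Rm by (intro binomial_symmetric[symmetric]) simp
    ultimately have "2 * (R choose n) \<le> 2 ^ R" by (simp add: choose_row_sum)
    hence "2 * real (R choose n) \<le> 2 ^ R" by (metis of_nat_le_iff of_nat_mult of_nat_numeral of_nat_power)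
    also have "(2::real) ^ R = 4 ^ m / 2"
    proof -
      have "(2::real) ^ R * 2 = 2 ^ (R + 1)" by simp
      also have "R + 1 = 2 * m" using Rm by simp
      finally show ?thesis by (simp add: power_mult)
    qed
    finally show "real (R choose n) \<le> 4 ^ m / 4" by simp
    show "q ^ n \<le> (2 * u) ^ m" using q_le by (simp add: n_def m_def)
  qed (use q u_bounds in auto)
  also have "4 ^ m / 4 * (2 * u) ^ m = (4 * (2 * u)) ^ m / 4"
    by (simp only: power_mult_distrib times_divide_eq_left)
  also have "4 * (2 * u) = 8 * u" by simp
  also have "real (card A) * ((8 * u) ^ m / 4) \<le> real (card A) * ((8 * u) ^ m / 2)"
    using u_bounds by (intro mult_left_mono divide_left_mono) auto
  also have "\<dots> = eps2 N d R \<tau> \<alpha> \<gamma>"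
  proof -
    have "\<lceil>real R / 2\<rceil> = int m"
      using Rm by (intro ceiling_unique) (auto simp: of_nat_diff)
    thus ?thesis by (simp add: eps2_def u_def)
  qed
  finally have "measure_pmf.prob ?M (- S) \<le> eps2 N d R \<tau> \<alpha> \<gamma>" .
  moreover have "measure_pmf.prob ?M (- S) = 1 - measure_pmf.prob ?M S"
    using measure_pmf.prob_compl[of S ?M] by (simp add: Compl_eq_Diff_UNIV)
  ultimately show ?thesis by (simp add: S_def)
qed

text \<open>A single differing coordinate never gives an alias modulo a prime, so no admissible
  vector is bad and the surplus can be as large as R div 2.\<close>

lemma prob_bad_dim_1:
  assumes d: "d = 1" and h: "h \<in> A"
  shows "measure_pmf.prob (pmf_of_set gen_vecs) {z. \<not> good_index d \<alpha> \<gamma> L N T z h} \<le> 0"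
proof -
  have no_alias: "\<not> aliased d N z h k" if z: "z \<in> gen_vecs" and ex: "\<exists>j\<in>{1..d}. \<not> int N dvd k j - h j" for z k
  proof
    assume al: "aliased d N z h k"
    obtain j where j: "j \<in> {1..d}" "\<not> int N dvd k j - h j" using ex by blast
    thus False using aliased_differs_twice[OF z al j] d by auto
  qed
  have "good_index d \<alpha> \<gamma> L N T z h" if z: "z \<in> gen_vecs" for z
  proof (rule ccontr)
    assume "\<not> good_index d \<alpha> \<gamma> L N T z h"
    with h show False
    proof (cases rule: bad_index_cases)
      case (1 k)
      thus False using no_alias[OF z] freq_set_not_congruent[OF h] by blast
    next
      case 2
      have empty: "{k \<in> {k \<in> int_vecs d - A. \<exists>j\<in>{1..d}. \<not> int N dvd k j - h j}. aliased d N z h k} = {}"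
        using no_alias[OF z] by blast
      have "0 < 2 * \<kappa> ^ Suc d * L powr (- (2 * \<alpha>))"
        using kappa_ge_1 N2_gt_1 by (intro mult_pos_pos zero_less_power) auto
      thus False using 2 unfolding alias_mass_def empty by simp
    qed
  qed
  hence "gen_vecs \<inter> {z. \<not> good_index d \<alpha> \<gamma> L N T z h} = {}" by blast
  thus ?thesis unfolding prob_gen_vec by simp
qed

section \<open>Choosing the surplus of good draws\<close>

lemma log_const_ge: "log_const d \<alpha> \<ge> 8" "log_const d \<alpha> \<ge> 2 * (2 * \<alpha> + 3)"
proof -
  have "1 \<le> (1 + 2 * \<kappa>) ^ d" using kappa_ge_1 by (intro one_le_power) auto
  hence "0 \<le> ln (4 * (1 + 2 * \<kappa>) ^ d)" by (intro ln_ge_zero) auto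
  thus "log_const d \<alpha> \<ge> 8" "log_const d \<alpha> \<ge> 2 * (2 * \<alpha> + 3)"
    using alpha by (auto simp: log_const_def)
qed

text \<open>Here u \<tau> ln L = 1 - u \<ge> 1/2, hence \<tau> \<ge> 1/(2uL), while 1/u exceeds a
  high power of L; so \<tau> \<ge> L. In L^(2\<alpha>+1) / \<tau>^2 \<le> 4 u^2 L^(2\<alpha>+3) the
  square splits as u^(1/2) u^(3/2), and u^(1/2) absorbs the constants and the powers of L.\<close>

lemma large_tau_estimates:
  assumes big: "log_const d \<alpha> * (1 + log 2 L) < ln (1 / u)"
  shows "L \<le> \<tau>" "(1 + 2 * \<kappa>) ^ d * L powr (2 * \<alpha> + 1) / \<tau>\<^sup>2 \<le> u powr (3 / 2)"
proof -
  define l where "l = ln L"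
  define D where "D = (1 + 2 * \<kappa>) ^ d"
  define K where "K = log_const d \<alpha>"
  have L: "L > 1" "L = exp l" using N2_gt_1 by (simp_all add: l_def)
  have l: "l > 0" using L by simp
  have lL: "l \<le> L" using exp_ge_add_one_self[of l] L(2) by linarith
  have D: "D \<ge> 1" unfolding D_def using kappa_ge_1 by (intro one_le_power) auto
  have K: "K \<ge> 8" "K = 2 * (2 * \<alpha> + 3) + 2 * ln (4 * D)"
    using log_const_ge by (simp_all add: K_def log_const_def D_def)
  have "l \<le> l / ln 2" using l ln_2_less_1 by (simp add: field_simps mult_left_le)
  hence "K * (1 + l) \<le> K * (1 + log 2 L)" using K by (intro mult_left_mono) (auto simp: log_def l_def)
  hence lnu: "ln u < - K - K * l"
    using big u_bounds by (simp add: K_def ln_div algebra_simps)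
  have Kl: "8 * l \<le> K * l" using K l by (intro mult_right_mono) auto
  have u_exp: "u = exp (ln u)" using u_bounds by simp
  have "u < 1 / 2"
  proof -
    have "ln u < - 1" using lnu Kl K(1) l by linarith
    also have "- 1 \<le> - ln (2::real)" using ln_2_less_1 by simp
    also have "- ln (2::real) = ln (1 / 2)" by (simp add: ln_div)
    finally show ?thesis using u_bounds by simp
  qed
  moreover have "u * (1 + \<tau> * l) = 1" using tau_ln_L_pos by (simp add: u_def l_def)
  ultimately have "1 / 2 \<le> u * \<tau> * l" by (simp add: algebra_simps)
  also have "\<dots> \<le> u * \<tau> * L" using u_bounds tau lL by (intro mult_left_mono) auto
  finally have tau_ge: "1 \<le> 2 * u * L * \<tau>" by (simp add: mult_ac)
  \<comment> \<open>Replacing 2 by exp 1 puts the whole product into one exponent.\<close>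
  have "2 * u * L * L \<le> exp 1 * u * L * L"
    using exp_ge_add_one_self[of 1] u_bounds L by (intro mult_right_mono) auto
  also have "\<dots> = exp (1 + ln u + l + l)" unfolding exp_add using L u_exp by simp
  also have "\<dots> \<le> exp 0" using lnu Kl K(1) l by (intro iffD2[OF exp_le_cancel_iff]) linarith
  also have "exp 0 = (1::real)" by simp
  finally have "2 * u * L * L \<le> 2 * u * L * \<tau>" using tau_ge by linarith
  thus "L \<le> \<tau>" using u_bounds L by simp
  have L_powr: "L powr a = exp (a * l)" for a using N2_gt_1 by (simp add: powr_def l_def)
  have u_powr: "u powr (1 / 2) = exp (ln u / 2)" using u_bounds by (simp add: powr_def)
  have "1 / \<tau> \<le> 2 * u * L" using tau_ge tau by (simp add: field_simps)
  hence "(1 / \<tau>)\<^sup>2 \<le> (2 * u * L)\<^sup>2" using tau by (intro power_mono) auto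
  hence "D * L powr (2 * \<alpha> + 1) * (1 / \<tau>)\<^sup>2 \<le> D * L powr (2 * \<alpha> + 1) * (2 * u * L)\<^sup>2"
    using D by (intro mult_left_mono) auto
  also have "\<dots> = 4 * D * L powr (2 * \<alpha> + 1) * (L powr 2) * (u powr (1 / 2) * u powr (3 / 2))"
  proof -
    have "u powr (1 / 2) * u powr (3 / 2) = u\<^sup>2" "L powr 2 = L\<^sup>2"
      using u_bounds N2_gt_1 by (simp_all flip: powr_add)
    thus ?thesis by (simp add: power_mult_distrib)
  qed
  also have "\<dots> = exp (ln (4 * D)) * exp ((2 * \<alpha> + 1) * l) * exp (2 * l) * exp (ln u / 2) * u powr (3 / 2)"
  proof -
    have "exp (ln (4 * D)) = 4 * D" using D by simp
    thus ?thesis by (simp only: L_powr u_powr mult_ac)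
  qed
  also have "\<dots> = exp (ln (4 * D) + (2 * \<alpha> + 3) * l + ln u / 2) * u powr (3 / 2)"
    by (simp only: exp_add[symmetric]) (simp add: algebra_simps)
  also have "\<dots> \<le> 1 * u powr (3 / 2)"
  proof (rule mult_right_mono)
    have "0 \<le> ln (4 * D)" using D by (intro ln_ge_zero) auto
    hence "(2 * \<alpha> + 3) * l \<le> K / 2 * l" using K l by (intro mult_right_mono) auto
    moreover have "ln (4 * D) \<le> K / 2" using K alpha by simp
    ultimately have "ln (4 * D) + (2 * \<alpha> + 3) * l + ln u / 2 \<le> 0" using lnu by simp
    thus "exp (ln (4 * D) + (2 * \<alpha> + 3) * l + ln u / 2) \<le> 1" by simp
  qed simp
  finally show "(1 + 2 * \<kappa>) ^ d * L powr (2 * \<alpha> + 1) / \<tau>\<^sup>2 \<le> u powr (3 / 2)"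
    by (simp add: D_def power_divide)
qed

text \<open>The surplus \<open>t\<close> trades probability for accuracy. For d = 1 the logarithmic
  factor is 1, so \<open>t\<close> has to be proportional to R; this is affordable because q = 0.
  For d \<ge> 2 a whole logarithm is available.\<close>

lemma majority_parameters:
  assumes d: "d \<ge> 1" and R: "odd R"
  obtains t q where "t \<le> R div 2" "q \<ge> 0"
    "\<And>h. h \<in> A \<Longrightarrow> measure_pmf.prob (pmf_of_set gen_vecs) {z. \<not> good_index d \<alpha> \<gamma> L N T z h} \<le> q"
    "q ^ (R div 2 + 1 - t) \<le> (2 * u) ^ (R div 2 + 1)"
    "real R / real (t + 1) \<le> 8 * log_const d \<alpha> * (1 + log 2 L) powr (real d - 1)"
proof (cases "d = 1")
  case True
  have "real R \<le> real (2 * (R div 2 + 1))" unfolding of_nat_le_iff by presburger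
  hence "real R \<le> 2 * real (R div 2 + 1)" by simp
  hence "real R / real (R div 2 + 1) \<le> 2" by (simp add: field_simps)
  also have "2 \<le> 8 * log_const d \<alpha> * (1 + log 2 L) powr (real d - 1)"
  proof -
    have "log 2 L > 0" using N2_gt_1 by simp
    hence "(1 + log 2 L) powr (real d - 1) = 1" using True by simp
    thus ?thesis using log_const_ge by simp
  qed
  finally show ?thesis using prob_bad_dim_1[OF True] u_bounds by (intro that[of "R div 2" 0]) auto
next
  case False
  define K where "K = log_const d \<alpha>"
  define \<Lambda> where "\<Lambda> = 1 + log 2 L"
  define m where "m = R div 2 + 1"
  \<comment> \<open>With this \<open>t\<close>, ln (1/u) \<le> K \<Lambda> implies t ln (1/u) \<le>
    m/4, and K \<Lambda> \<ge> 8 gives t \<le> m/32.\<close>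
  define t where "t = nat \<lfloor>real m / (4 * K * \<Lambda>)\<rfloor>"
  have K: "K \<ge> 8" using log_const_ge by (simp add: K_def)
  have \<Lambda>: "\<Lambda> \<ge> 1" using N2_gt_1 by (simp add: \<Lambda>_def)
  have KL: "K * \<Lambda> \<ge> 8" using mult_mono[of 8 K 1 \<Lambda>] K \<Lambda> by simp
  have t_le: "real t \<le> real m / (4 * K * \<Lambda>)" and t_gt: "real m / (4 * K * \<Lambda>) < real (t + 1)"
    using K \<Lambda> by (simp_all add: t_def) linarith+
  have tKL: "real t * (K * \<Lambda>) \<le> real m / 4" using t_le K \<Lambda> by (simp add: field_simps)
  moreover have "real t * 8 \<le> real t * (K * \<Lambda>)" using KL by (intro mult_left_mono) auto
  ultimately have t32: "32 * real t \<le> real m" by simp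
  hence t: "t \<le> R div 2" "t \<le> m" by (auto simp: m_def)
  have ratio: "real R / real (t + 1) \<le> 8 * log_const d \<alpha> * (1 + log 2 L) powr (real d - 1)"
  proof -
    have "R \<le> 2 * m" unfolding m_def by presburger
    hence "real R \<le> 2 * real m" by linarith
    also have "\<dots> \<le> 8 * K * \<Lambda> * real (t + 1)" using t_gt K \<Lambda> by (simp add: field_simps)
    finally have "real R / real (t + 1) \<le> 8 * K * \<Lambda> powr 1" using \<Lambda> by (simp add: field_simps)
    \<comment> \<open>This needs d \<ge> 2: one factor \<Lambda> has to fit into \<Lambda> powr (d -
      1).\<close>
    also have "\<dots> \<le> 8 * K * \<Lambda> powr (real d - 1)"
      using \<Lambda> K False d by (intro mult_left_mono powr_mono) auto
    finally show ?thesis by (simp add: K_def \<Lambda>_def)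
  qed
  show ?thesis
  proof (cases "ln (1 / u) \<le> K * \<Lambda>")
    case True
    have "(3 / 2 * u) ^ (m - t) \<le> (2 * u) ^ m"
    proof -
      \<comment> \<open>3/4 is the ratio of 3u/2 to 2u; the chain (3/4)^m \<le> exp (-m/4) \<le> u^t
        pays for the t missing factors.\<close>
      have "(3 / 4 :: real) \<le> exp (- (1 / 4))" using exp_ge_add_one_self[of "- (1 / 4) :: real"] by simp
      hence "(3 / 4 :: real) ^ m \<le> exp (- (1 / 4)) ^ m" by (intro power_mono) auto
      also have "\<dots> = exp (- (real m / 4))" by (simp flip: exp_of_nat_mult)
      also have "\<dots> \<le> exp (- (real t * ln (1 / u)))"
        using tKL mult_left_mono[OF True, of "real t"] by simp
      also have "\<dots> = u ^ t" using u_bounds by (simp add: ln_div exp_of_nat_mult)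
      also have "\<dots> \<le> (3 / 2 * u) ^ t" using u_bounds by (intro power_mono) auto
      finally have le: "(3 / 4) ^ m \<le> (3 / 2 * u) ^ t" .
      have "(3 / 2 * u) ^ (m - t) * (3 / 2 * u) ^ t = (3 / 2 * u) ^ m"
        using t by (simp flip: power_add)
      also have "\<dots> = (2 * u * (3 / 4)) ^ m" by simp
      also have "\<dots> = (2 * u) ^ m * (3 / 4) ^ m" by (rule power_mult_distrib)
      also have "\<dots> \<le> (2 * u) ^ m * (3 / 2 * u) ^ t" using le u_bounds by (intro mult_left_mono) auto
      finally show ?thesis using u_bounds by (simp only: mult_le_cancel_right) (auto simp: not_less)
    qed
    thus ?thesis using t ratio prob_bad_le u_bounds by (intro that[of t "3 / 2 * u"]) (auto simp: m_def)
  next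
    case False
    note large = large_tau_estimates[OF False[unfolded K_def \<Lambda>_def not_le]]
    have "(u powr (3 / 2)) ^ (m - t) = u powr (3 / 2 * real (m - t))"
      using u_bounds by (simp add: powr_powr flip: powr_realpow)
    \<comment> \<open>From 32 t \<le> m the exponent 3/2 (m - t) is at least m, and u < 1.\<close>
    also have "\<dots> \<le> u powr (real m)"
      using u_bounds t t32 by (intro powr_mono') (auto simp: of_nat_diff)
    also have "\<dots> = u ^ m" using u_bounds by (simp add: powr_realpow)
    also have "\<dots> \<le> (2 * u) ^ m" using u_bounds by (intro power_mono) auto
    finally have "(u powr (3 / 2)) ^ (m - t) \<le> (2 * u) ^ m" .
    thus ?thesis
      using t ratio order.trans[OF prob_bad_le_large_tau[OF _ large(1)] large(2)]
      by (intro that[of t "u powr (3 / 2)"]) (auto simp: m_def)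
  qed
qed

text \<open>Under the root, the 1 stems from truncating to \<open>A\<close> and the other term from
  the medians; taking the root halves the exponents of the logarithm and of L.\<close>

lemma median_lattice_error_probability:
  assumes d: "d \<ge> 1" and R: "odd R"
  shows "1 - eps2 N d R \<tau> \<alpha> \<gamma> \<le> measure_pmf.prob (gen_vectors_pmf d N R)
    {zs. wc_err d \<alpha> \<gamma> (median_lattice_alg d N R zs A) \<le>
      ereal (sqrt (1 + 8 * log_const d \<alpha> * alias_const d \<alpha>) * (1 + log 2 L) powr ((real d - 1) / 2) / L powr \<alpha>)}"
proof -
  obtain t q where tq: "t \<le> R div 2" "q \<ge> 0"
    "\<And>h. h \<in> A \<Longrightarrow> measure_pmf.prob (pmf_of_set gen_vecs) {z. \<not> good_index d \<alpha> \<gamma> L N T z h} \<le> q"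
    "q ^ (R div 2 + 1 - t) \<le> (2 * u) ^ (R div 2 + 1)"
    "real R / real (t + 1) \<le> 8 * log_const d \<alpha> * (1 + log 2 L) powr (real d - 1)"
    using majority_parameters[OF d R] by metis
  define \<Lambda> where "\<Lambda> = 1 + log 2 L"
  define c where "c = 8 * log_const d \<alpha> * alias_const d \<alpha>"
  have \<Lambda>: "\<Lambda> \<ge> 1" using N2_gt_1 by (simp add: \<Lambda>_def)
  have alias_const: "alias_const d \<alpha> \<ge> 0" using kappa_ge_1 by (simp add: alias_const_def)
  have c: "c \<ge> 0" using alias_const log_const_ge by (simp add: c_def)
  have "sqrt (L powr (- 2 * \<alpha>) + real R / real (t + 1) * T) \<le>
      sqrt ((1 + c) * \<Lambda> powr (real d - 1) * L powr (- 2 * \<alpha>))"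
  proof (rule real_sqrt_le_mono)
    have "real R / real (t + 1) * T \<le> 8 * log_const d \<alpha> * \<Lambda> powr (real d - 1) * T"
      using tq(5) alias_const by (intro mult_right_mono) (auto simp: \<Lambda>_def)
    also have "\<dots> = c * \<Lambda> powr (real d - 1) * L powr (- 2 * \<alpha>)" by (simp add: c_def)
    finally have "real R / real (t + 1) * T \<le> c * \<Lambda> powr (real d - 1) * L powr (- 2 * \<alpha>)" .
    moreover have "1 * L powr (- 2 * \<alpha>) \<le> \<Lambda> powr (real d - 1) * L powr (- 2 * \<alpha>)"
      using \<Lambda> d by (intro mult_right_mono ge_one_powr_ge_zero) auto
    ultimately show "L powr (- 2 * \<alpha>) + real R / real (t + 1) * T \<le> (1 + c) * \<Lambda> powr (real d - 1) * L powr (- 2 * \<alpha>)"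
      by (simp add: ring_distribs)
  qed
  also have "\<dots> = sqrt (1 + c) * \<Lambda> powr ((real d - 1) / 2) / L powr \<alpha>"
  proof -
    have sqrt_powr: "sqrt (x powr a) = x powr (a / 2)" for x a :: real
      by (subst powr_half_sqrt[symmetric]) (simp_all add: powr_powr)
    have "sqrt (L powr (- 2 * \<alpha>)) = L powr (- \<alpha>)" by (simp add: sqrt_powr)
    thus ?thesis by (simp only: real_sqrt_mult sqrt_powr powr_minus divide_inverse)
  qed
  finally have bound: "sqrt (L powr (- 2 * \<alpha>) + real R / real (t + 1) * T) \<le>
      sqrt (1 + c) * \<Lambda> powr ((real d - 1) / 2) / L powr \<alpha>" .
  have "{zs. \<forall>h\<in>A. R div 2 + 1 + t \<le> card {r \<in> {1..R}. good_index d \<alpha> \<gamma> L N T (zs r) h}} \<subseteq>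
    {zs. wc_err d \<alpha> \<gamma> (median_lattice_alg d N R zs A) \<le>
      ereal (sqrt (1 + c) * \<Lambda> powr ((real d - 1) / 2) / L powr \<alpha>)}"
  proof clarify
    fix zs assume good: "\<forall>h\<in>A. R div 2 + 1 + t \<le> card {r \<in> {1..R}. good_index d \<alpha> \<gamma> L N T (zs r) h}"
    have "wc_err d \<alpha> \<gamma> (median_lattice_alg d N R zs A) \<le>
        ereal (sqrt (L powr (- 2 * \<alpha>) + real R / real (t + 1) * T))"
    proof (rule median_lattice_error[where t = t])
      show "R div 2 + 1 + t \<le> card {r \<in> {1..R}. good_index d \<alpha> \<gamma> L N T (zs r) h}" if "h \<in> A" for h
        using good that by blast
    qed (use w_pos inverse_w_summable finite_freq_set N2_gt_1 R N_ge_3 alias_const in auto)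
    also have "\<dots> \<le> ereal (sqrt (1 + c) * \<Lambda> powr ((real d - 1) / 2) / L powr \<alpha>)" using bound by simp
    finally show "wc_err d \<alpha> \<gamma> (median_lattice_alg d N R zs A) \<le>
      ereal (sqrt (1 + c) * \<Lambda> powr ((real d - 1) / 2) / L powr \<alpha>)" .
  qed
  hence "measure_pmf.prob (gen_vectors_pmf d N R)
      {zs. \<forall>h\<in>A. R div 2 + 1 + t \<le> card {r \<in> {1..R}. good_index d \<alpha> \<gamma> L N T (zs r) h}} \<le>
    measure_pmf.prob (gen_vectors_pmf d N R) {zs. wc_err d \<alpha> \<gamma> (median_lattice_alg d N R zs A) \<le>
      ereal (sqrt (1 + c) * \<Lambda> powr ((real d - 1) / 2) / L powr \<alpha>)}"
    by (intro measure_pmf.finite_measure_mono) auto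
  with all_good_probability[OF R tq(1-4)] show ?thesis
    by (simp add: c_def \<Lambda>_def)
qed

end

theorem theorem4p9:
  fixes \<alpha> :: real and d :: nat
  assumes "\<alpha> > 1 / 2" and "d \<ge> 1"
  shows "\<exists>C::real. C > 0 \<and>
    (\<forall>(\<tau>::real) (R::nat) (\<gamma>::nat \<Rightarrow> real) (N::nat).
       \<tau> > 0 \<longrightarrow> R > 1 \<longrightarrow> odd R \<longrightarrow>
       antimono_on {1..} \<gamma> \<longrightarrow> (\<forall>j\<ge>1. 0 < \<gamma> j \<and> \<gamma> j \<le> 1) \<longrightarrow>
       prime N \<longrightarrow> odd N \<longrightarrow> N2 N d \<tau> \<alpha> \<gamma> > 1 \<longrightarrow>
       measure_pmf.prob (gen_vectors_pmf d N R)
         {zs. wc_err d \<alpha> \<gamma> (median_lattice_alg d N R zs (freq_set d \<alpha> \<gamma> (N2 N d \<tau> \<alpha> \<gamma>)))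
              \<le> ereal (C * (1 + log 2 (N2 N d \<tau> \<alpha> \<gamma>)) powr ((real d - 1) / 2)
                         / N2 N d \<tau> \<alpha> \<gamma> powr \<alpha>)}
       \<ge> 1 - eps2 N d R \<tau> \<alpha> \<gamma>)"
proof (intro exI conjI allI impI)
  have kappa: "zeta_bound \<alpha> \<ge> 1" using assms(1) by (simp add: zeta_bound_def)
  have "1 \<le> (1 + 2 * zeta_bound \<alpha>) ^ d" using kappa by (intro one_le_power) auto
  hence "0 \<le> ln (4 * (1 + 2 * zeta_bound \<alpha>) ^ d)" by (intro ln_ge_zero) auto
  hence "log_const d \<alpha> \<ge> 0" using assms(1) by (simp add: log_const_def)
  moreover have "alias_const d \<alpha> \<ge> 0" using kappa by (simp add: alias_const_def)
  ultimately have "0 \<le> 8 * log_const d \<alpha> * alias_const d \<alpha>" by simp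
  hence "0 < 1 + 8 * log_const d \<alpha> * alias_const d \<alpha>" by linarith
  \<comment> \<open>The witness for C, built from \<open>d\<close> and \<alpha> alone before \<tau>,
    R, \<gamma> and N are introduced.\<close>
  thus "0 < sqrt (1 + 8 * log_const d \<alpha> * alias_const d \<alpha>)" by (rule real_sqrt_gt_zero)
  fix \<tau> :: real and R :: nat and \<gamma> :: "nat \<Rightarrow> real" and N :: nat
  assume "\<tau> > 0" "R > 1" and R: "odd R" and "antimono_on {1..} \<gamma>"
    and "\<forall>j\<ge>1. 0 < \<gamma> j \<and> \<gamma> j \<le> 1" "prime N" "odd N" "N2 N d \<tau> \<alpha> \<gamma> > 1"
  then interpret median_lattice_setting d \<alpha> \<gamma> \<tau> N
    using assms by unfold_locales auto
  show "1 - eps2 N d R \<tau> \<alpha> \<gamma> \<le> measure_pmf.prob (gen_vectors_pmf d N R)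
      {zs. wc_err d \<alpha> \<gamma> (median_lattice_alg d N R zs (freq_set d \<alpha> \<gamma> (N2 N d \<tau> \<alpha> \<gamma>)))
        \<le> ereal (sqrt (1 + 8 * log_const d \<alpha> * alias_const d \<alpha>) *
             (1 + log 2 (N2 N d \<tau> \<alpha> \<gamma>)) powr ((real d - 1) / 2) / N2 N d \<tau> \<alpha> \<gamma> powr \<alpha>)}"
    by (rule median_lattice_error_probability[OF assms(2) R])
qed

end
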